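(* Let $G_n\sim G(n,p)$ with $p=p(n)=n^{-\alpha+o(1)}$ for a constant $\alpha>0$, and let $X_n$ denote the maximum number of edges of a chordal subgraph of $G_n$. (1) If $\alpha\in(1/2,1]$ and $\alpha\notin\{\frac{1+k}{1+2k}:k\in\mathbb{Z}_{\geq0}\}$, then $X_n/n\to\frac{1+2k_\alpha}{1+k_\alpha}$ in probability, where $k_\alpha$ is the largest integer $k\ge 0$ such that $\alpha<\frac{1+k}{1+2k}$. (2) If $\alpha\in(0,1/2]$, then $X_n/n\to1/\alpha$ in probability.
   Context: A graph is chordal if it contains no induced cycle of length at least 4. $G(n,p)$ is the binomial random graph on vertex set $[n]$ in which each pair is an edge independently with probability $p$. *)

theory Defs
  imports "HOL-Probability.Probability"
begin

text \<open>Graphs on vertex set [n] = {0..<n} are represented by their edge sets,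
  sets of 2-element vertex sets.\<close>

definition all_edges :: "nat \<Rightarrow> nat set set" where
  "all_edges n = {e. \<exists>u v. u < n \<and> v < n \<and> u \<noteq> v \<and> e = {u, v}}"

definition gnp :: "nat \<Rightarrow> real \<Rightarrow> nat set set pmf" where
  "gnp n p = map_pmf (\<lambda>f. {e \<in> all_edges n. f e})
                     (Pi_pmf (all_edges n) False (\<lambda>_. bernoulli_pmf p))"

definition adj :: "'a set set \<Rightarrow> 'a \<Rightarrow> 'a \<Rightarrow> bool" where
  "adj E u v \<longleftrightarrow> {u, v} \<in> E"

definition induced_cycle :: "'a set set \<Rightarrow> 'a list \<Rightarrow> bool" where
  "induced_cycle E vs \<longleftrightarrow>
     length vs \<ge> 4 \<and> distinct vs \<and>
     (\<forall>i < length vs. adj E (vs ! i) (vs ! ((i + 1) mod length vs))) \<and>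
     (\<forall>i < length vs. \<forall>j < length vs. adj E (vs ! i) (vs ! j) \<longrightarrow>
         j = (i + 1) mod length vs \<or> i = (j + 1) mod length vs)"

definition chordal :: "'a set set \<Rightarrow> bool" where
  "chordal E \<longleftrightarrow> \<not> (\<exists>vs. induced_cycle E vs)"

definition max_chordal_edges :: "'a set set \<Rightarrow> nat" where
  "max_chordal_edges E = Max (card ` {F. F \<subseteq> E \<and> chordal F})"

definition conv_prob_chordal :: "(nat \<Rightarrow> real) \<Rightarrow> real \<Rightarrow> bool" where
  "conv_prob_chordal p c \<longleftrightarrow>
     (\<forall>\<epsilon>>0. (\<lambda>n. measure_pmf.prob (gnp n (p n))
                 {E. \<bar>real (max_chordal_edges E) / real n - c\<bar> > \<epsilon>}) \<longlonglongrightarrow> 0)"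

end

theory Submission
  imports Defs
begin

text \<open>Upper bounds: a chordal graph has an elimination order, in which the earlier neighbours of a vertex
  other than the latest one are earlier neighbours of the latest one. As cliques of G(n,p) have bounded
  size, a subgraph built from s such attachments can be chosen in at most n^s 2^O(n) ways, so by a
  first moment computation no subgraph with linearly many attachments s and more than
  (1 + \<eta>) s / \<alpha> edges appears. For \<alpha> \<le> 1/2 this bounds the whole chordal graph. For \<alpha> > 1/2
  it is applied to the union of the blocks that are too dense; the remaining blocks, on s + 1 vertices, have
  2 s - 1 edges with s \<le> k + 1.

  Lower bounds: if a chordal pattern on {0..N} satisfies \<alpha> e(T) < |T| - 1 for all subsets T that
  span an edge, then by Janson's inequality and a union bound all large subsets of the vertex levels
  contain a copy of the pattern. Copies are chosen greedily, disjoint except that their roots are taken from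
  a small reusable set, and their union is chordal with about n e / N edges. The patterns are powers of
  paths in which the number of earlier neighbours alternates between two consecutive integers as evenly as
  possible.\<close>

section \<open>Elimination orders of chordal graphs\<close>

text \<open>Both bounds compare with n, not with 1. A pattern with v vertices and e edges occurs
  about n^(v - \<alpha> e) times. For about n copies, and for an exponent in Janson's inequality
  that beats the 2^n vertex sets of the union bound, this must exceed n by a power of n, whence
  \<alpha> e < v - 1. The square of a path on k + 2 vertices has 2 k + 1 edges, which gives \<alpha>
  < (1 + k) / (1 + 2 k); at equality the comparison is lost in the o(1). Conversely, choosing d
  earlier neighbours freely would cost n^d. Once the parent is chosen, the others lie in a set of
  bounded size, so a new vertex costs a factor n 2^R p^d, and d can average at most about 1 /
  \<alpha>. The two bounds meet because a block attached at one vertex to what precedes it brings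
  one vertex less than it has. The shared roots imitate this: a copy on N + 1 vertices uses up only
  N, and its density is e / N.\<close>

lemma adj_commute: "adj E u v \<longleftrightarrow> adj E v u"
  by (simp add: adj_def insert_commute)

section \<open>Shortest walks and linked vertex sets\<close>

text \<open>A chord that skips a position shortens the walk, and so does a repeated vertex.\<close>

lemma shortest_walk_induced:
  assumes xs: "xs \<noteq> []" "hd xs = u" "last xs = v" "set xs \<subseteq> M" "successively R xs"
    and min: "\<And>ys. ys \<noteq> [] \<Longrightarrow> hd ys = u \<Longrightarrow> last ys = v \<Longrightarrow> set ys \<subseteq> M \<Longrightarrow> successively R ys
               \<Longrightarrow> length xs \<le> length ys"
  shows "distinct xs" and "\<And>i j. i < j \<Longrightarrow> j < length xs \<Longrightarrow> R (xs ! i) (xs ! j) \<Longrightarrow> j = Suc i"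
proof -
  have shortcut: False
    if "i < length xs" "j < length xs" "Suc i < j" "R (xs ! i) (xs ! j)" for i j
  proof -
    let ?ys = "take (Suc i) xs @ drop j xs"
    have 1: "?ys \<noteq> []" using xs by simp
    have 2: "hd ?ys = u" using xs by (simp add: hd_append)
    have 3: "last ?ys = v" using xs that by (simp add: last_append)
    have 4: "set ?ys \<subseteq> M" using xs by (auto dest: in_set_takeD in_set_dropD)
    have l: "last (take (Suc i) xs) = xs ! i" using that by (simp add: take_Suc_conv_app_nth)
    have h: "hd (drop j xs) = xs ! j" using that by (simp add: hd_drop_conv_nth)
    have s1: "successively R (take (Suc i) xs)" "successively R (drop j xs)"
      using xs(5) by (metis append_take_drop_id successively_append_iff)+
    have 5: "successively R ?ys"
      unfolding successively_append_iff using s1 l h that by simp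
    have "length xs \<le> length ?ys" by (rule min[OF 1 2 3 4 5])
    then show False using that by simp
  qed
  have d: False if "i < j" "j < length xs" "xs ! i = xs ! j" for i j
  proof (cases i)
    case 0
    let ?ys = "drop j xs"
    have h: "hd ?ys = u" using that xs 0 by (simp add: hd_drop_conv_nth hd_conv_nth)
    have "successively R ?ys" using xs(5) by (metis append_take_drop_id successively_append_iff)
    then have "length xs \<le> length ?ys"
      using xs h that by (intro min) (auto dest: in_set_dropD)
    then show False using that by simp
  next
    case (Suc i')
    have "R (xs ! i') (xs ! i)" using xs(5) that Suc by (metis Suc_lessD less_trans successively_conv_nth)
    then show False using shortcut[of i' j] that Suc by simp
  qed
  show "distinct xs" 
    unfolding distinct_conv_nth
  proof (intro allI impI)
    fix i j assume "i < length xs" "j < length xs" "i \<noteq> j"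
    then show "xs ! i \<noteq> xs ! j" using d[of i j] d[of j i] by (cases i j rule: linorder_cases) auto
  qed
  show "j = Suc i" if "i < j" "j < length xs" "R (xs ! i) (xs ! j)" for i j
    using shortcut[of i j] that by (cases "Suc i < j") auto
qed

text \<open>Walks instead of paths, so that reversal and extension are plain list operations;
  distinct vertices are recovered by \<open>shortest_walk_induced\<close>.\<close>

definition joined :: "'a set set \<Rightarrow> 'a set \<Rightarrow> 'a \<Rightarrow> 'a \<Rightarrow> bool" where
  "joined E U x y \<longleftrightarrow> (\<exists>xs. xs \<noteq> [] \<and> hd xs = x \<and> last xs = y \<and> set xs \<subseteq> U \<and> successively (adj E) xs)"

abbreviation linked :: "'a set set \<Rightarrow> 'a set \<Rightarrow> bool" where
  "linked E U \<equiv> (\<forall>x\<in>U. \<forall>y\<in>U. joined E U x y)"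

lemma joined_refl: "x \<in> U \<Longrightarrow> joined E U x x"
  unfolding joined_def by (rule exI[of _ "[x]"]) simp

lemma joined_mono: "joined E U x y \<Longrightarrow> U \<subseteq> U' \<Longrightarrow> joined E U' x y"
  unfolding joined_def by blast

lemma joined_sym:
  assumes "joined E U x y"
  shows "joined E U y x"
proof -
  obtain xs where xs: "xs \<noteq> []" "hd xs = x" "last xs = y" "set xs \<subseteq> U" "successively (adj E) xs"
    using assms unfolding joined_def by blast
  have "successively (\<lambda>a b. adj E b a) xs"
    by (rule successively_mono[OF xs(5)]) (simp add: adj_commute)
  then show ?thesis
    unfolding joined_def using xs by (intro exI[of _ "rev xs"]) (simp add: hd_rev last_rev)
qed

lemma joined_Cons:
  assumes "joined E U x y" "adj E v x" "v \<in> U"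
  shows "joined E U v y"
proof -
  obtain xs where xs: "xs \<noteq> []" "hd xs = x" "last xs = y" "set xs \<subseteq> U" "successively (adj E) xs"
    using assms(1) unfolding joined_def by blast
  then show ?thesis
    unfolding joined_def using assms(2,3) by (intro exI[of _ "v # xs"]) (simp add: successively_Cons)
qed

lemma linked_insert:
  assumes "linked E U" "u \<in> U" "adj E v u"
  shows "linked E (insert v U)"
proof -
  have old: "joined E (insert v U) x y" if "x \<in> U" "y \<in> U" for x y
    by (rule joined_mono[OF _ subset_insertI]) (simp add: assms(1) that)
  have new: "joined E (insert v U) v y" if "y \<in> U" for y
    using joined_Cons[OF old[OF assms(2) that] assms(3)] by simp
  show ?thesis
  proof (intro ballI)
    fix x y assume "x \<in> insert v U" "y \<in> insert v U"
    then consider "x = v" "y = v" | "x = v" "y \<in> U" | "x \<in> U" "y = v" | "x \<in> U" "y \<in> U" by blast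
    then show "joined E (insert v U) x y"
      by cases (simp_all add: joined_refl old new new[THEN joined_sym])
  qed
qed

section \<open>Simplicial vertices of chordal graphs\<close>

definition simplicial :: "'a set set \<Rightarrow> 'a set \<Rightarrow> 'a \<Rightarrow> bool" where
  "simplicial E V v \<longleftrightarrow> (\<forall>x\<in>V. \<forall>y\<in>V. adj E v x \<longrightarrow> adj E v y \<longrightarrow> x \<noteq> y \<longrightarrow> adj E x y)"

text \<open>Closing a shortest walk from \<open>u\<close> to \<open>v\<close> through
  \<open>U\<close> by \<open>w\<close> gives an induced cycle, since \<open>w\<close> sees only the
  two ends. As \<open>u\<close> and \<open>v\<close> are not adjacent, the walk has an inner vertex,
  and the cycle has length at least 4.\<close>

lemma chordal_common_neighbours:
  assumes ch: "chordal E" and irr: "\<And>x. \<not> adj E x x" and U: "linked E U"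
    and uv: "u \<noteq> v" "\<not> adj E u v" "u \<notin> U" "v \<notin> U"
    and uU: "u' \<in> U" "adj E u u'" and vU: "v' \<in> U" "adj E v v'"
    and w: "adj E w u" "adj E w v" "\<And>x. x \<in> U \<Longrightarrow> \<not> adj E w x" "w \<notin> U"
  shows False
proof -
  define P where "P xs \<longleftrightarrow> xs \<noteq> [] \<and> hd xs = u \<and> last xs = v \<and> set xs \<subseteq> insert u (insert v U)
      \<and> successively (adj E) xs" for xs
  have "linked E (insert u (insert v U))"
    using linked_insert[OF linked_insert[OF U vU] _ uU(2)] uU(1) by blast
  then have "\<exists>xs. P xs" unfolding joined_def P_def by blast
  then obtain xs where xs: "P xs" "\<And>ys. P ys \<Longrightarrow> length xs \<le> length ys"
    using ex_has_least_nat[of P _ length] by blast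
  have dist: "distinct xs"
    and ind: "\<And>i j. i < j \<Longrightarrow> j < length xs \<Longrightarrow> adj E (xs ! i) (xs ! j) \<Longrightarrow> j = Suc i"
    using shortest_walk_induced[of xs u v "insert u (insert v U)" "adj E"] xs
    unfolding P_def by auto
  have succ: "adj E (xs ! i) (xs ! Suc i)" if "Suc i < length xs" for i
    using xs(1) that unfolding P_def successively_conv_nth by blast
  let ?l = "length xs"
  have h: "xs ! 0 = u" and l: "xs ! (?l - 1) = v" and ne: "xs \<noteq> []"
    using xs(1) unfolding P_def by (auto simp: hd_conv_nth last_conv_nth)
  have "?l \<noteq> 1" using h l uv by auto
  moreover have "?l \<noteq> 2" using h l uv succ[of 0] by (auto simp: numeral_2_eq_2)
  moreover have "?l \<noteq> 0" using ne by simp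
  ultimately have l3: "?l \<ge> 3" by linarith
  have mid: "xs ! i \<in> U" if "0 < i" "i < ?l - 1" for i
  proof -
    have "xs ! i \<noteq> xs ! 0" "xs ! i \<noteq> xs ! (?l - 1)"
      using that ne by (auto simp: nth_eq_iff_index_eq[OF dist])
    then have "xs ! i \<noteq> u" "xs ! i \<noteq> v" using h l by simp_all
    moreover have "xs ! i \<in> set xs" using that by simp
    ultimately show ?thesis using xs(1) unfolding P_def by blast
  qed
  have wxs: "w \<notin> set xs" using xs(1) w irr unfolding P_def by blast
  have wadj: "adj E w (xs ! i) \<longleftrightarrow> i = 0 \<or> i = ?l - 1" if "i < ?l" for i
  proof (cases "i = 0 \<or> i = ?l - 1")
    case True then show ?thesis using w(1,2) h l by auto
  next
    case False
    then have "0 < i" "i < ?l - 1" using that by linarith+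
    then have "xs ! i \<in> U" using mid[of i] by blast
    then show ?thesis using w(3) False by blast
  qed
  let ?c = "w # xs"
  have "induced_cycle E ?c"
    unfolding induced_cycle_def
  proof (intro conjI allI impI)
    show "4 \<le> length ?c" using l3 by simp
    show "distinct ?c" using dist wxs by simp
  next
    fix i assume i: "i < length ?c"
    show "adj E (?c ! i) (?c ! ((i + 1) mod length ?c))"
    proof (cases i)
      case 0 then show ?thesis using wadj[of 0] ne by simp
    next
      case (Suc i')
      have i': "i' < ?l" using i unfolding Suc by simp
      have c: "?c ! i = xs ! i'" unfolding Suc by (rule nth_Cons_Suc)
      show ?thesis
      proof (cases "i' = ?l - 1")
        case True
        have "adj E (xs ! i') w" using wadj[OF i'] True adj_commute[of E w] by blast
        moreover have "(i + 1) mod length ?c = 0" unfolding Suc True using ne by simp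
        ultimately show ?thesis unfolding c by simp
      next
        case False
        then have "Suc i' < ?l" using i' by linarith
        moreover from this have "(i + 1) mod length ?c = Suc (Suc i')"
          unfolding Suc by simp
        ultimately show ?thesis unfolding c using succ[of i'] by simp
      qed
    qed
  next
    fix i j assume ij: "i < length ?c" "j < length ?c" "adj E (?c ! i) (?c ! j)"
    have *: "b = (a + 1) mod length ?c \<or> a = (b + 1) mod length ?c"
      if "a < b" "b < length ?c" "adj E (?c ! a) (?c ! b)" for a b
    proof -
      obtain b' where b: "b = Suc b'" using \<open>a < b\<close> by (cases b) auto
      then have b': "b' < ?l" using that by simp
      show ?thesis
      proof (cases a)
        case 0
        then have "b' = 0 \<or> b' = ?l - 1" using that(3) wadj[OF b'] b by simp
        then show ?thesis using 0 b l3 by auto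
      next
        case (Suc a')
        then have "b' = Suc a'" using that ind[of a' b'] b by simp
        then show ?thesis using Suc b b' by simp
      qed
    qed
    have "i \<noteq> j" using ij irr by blast
    then consider "i < j" | "j < i" by linarith
    then show "j = (i + 1) mod length ?c \<or> i = (j + 1) mod length ?c"
    proof cases
      case 1 then show ?thesis using *[of i j] ij by blast
    next
      case 2
      have "adj E (?c ! j) (?c ! i)" using ij(3) adj_commute[of E] by blast
      then show ?thesis using *[of j i] ij 2 by blast
    qed
  qed
  then show False using ch unfolding chordal_def by blast
qed

text \<open>Take a largest linked set \<open>U\<close> whose closed neighbourhood is not all of
  \<open>V\<close>, and let \<open>W\<close> be what lies outside. By maximality every neighbour of
  \<open>U\<close> sees all of \<open>W\<close>; the neighbours of \<open>U\<close> form a clique,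
  since otherwise a vertex of \<open>W\<close> closes an induced cycle through \<open>U\<close>.
  Hence a vertex that is simplicial in \<open>W\<close> is simplicial in \<open>V\<close>.\<close>

theorem chordal_has_simplicial:
  assumes "chordal E" and irr: "\<And>x. \<not> adj E x x"
  shows "finite V \<Longrightarrow> V \<noteq> {} \<Longrightarrow> \<exists>v\<in>V. simplicial E V v"
proof (induction V rule: finite_psubset_induct)
  case (psubset V)
  show ?case
  proof (cases "\<forall>x\<in>V. \<forall>y\<in>V. x \<noteq> y \<longrightarrow> adj E x y")
    case True
    then show ?thesis using psubset.prems unfolding simplicial_def by blast
  next
    case False
    then obtain a b where ab: "a \<in> V" "b \<in> V" "a \<noteq> b" "\<not> adj E a b" by blast
    define N where "N U = {x \<in> V - U. \<exists>u\<in>U. adj E u x}" for U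
    define P where "P U \<longleftrightarrow> U \<noteq> {} \<and> U \<subseteq> V \<and> linked E U \<and> U \<union> N U \<noteq> V" for U
    have "linked E {a}" using joined_refl[of a "{a}" E] by blast
    \<comment> \<open>The vertex \<open>b\<close> lies outside the closed neighbourhood of
      \<open>a\<close>.\<close>
    then have "P {a}" unfolding P_def N_def using ab by auto
    moreover have "card U < Suc (card V)" if "P U" for U
      using that psubset.hyps unfolding P_def by (simp add: card_mono less_Suc_eq_le)
    ultimately obtain U where U: "P U" "\<And>U'. P U' \<Longrightarrow> card U' \<le> card U"
      using ex_has_greatest_nat[of P "{a}" card "Suc (card V)"] by (auto simp: less_imp_le)
    define W where "W = V - (U \<union> N U)"
    have finU: "finite U" using U(1) psubset.hyps unfolding P_def using finite_subset by auto
    have W: "W \<noteq> {}" "W \<subset> V" using U(1) unfolding P_def W_def N_def by auto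
    then obtain z where z: "z \<in> W" "simplicial E W z" using psubset.IH by blast
    \<comment> \<open>Otherwise \<open>insert v U\<close> would be a larger set of the same kind,
      with \<open>w\<close> still outside its closed neighbourhood.\<close>
    have full: "adj E v w" if v: "v \<in> N U" and w: "w \<in> W" for v w
    proof (rule ccontr)
      assume n: "\<not> adj E v w"
      obtain u where u: "u \<in> U" "adj E v u" and vV: "v \<in> V - U" using v unfolding N_def by (auto simp: adj_commute)
      have "linked E (insert v U)" using linked_insert[OF _ u] U(1) unfolding P_def by blast
      moreover have "w \<notin> insert v U \<union> N (insert v U)" "w \<in> V"
        using w v n unfolding W_def N_def by auto
      ultimately have "P (insert v U)" using U(1) vV unfolding P_def by blast
      then have "card (insert v U) \<le> card U" by (rule U(2))
      then show False using vV finU by simp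
    qed
    have clique: "adj E x y" if "x \<in> N U" "y \<in> N U" "x \<noteq> y" for x y
    proof (rule ccontr)
      assume n: "\<not> adj E x y"
      obtain x' y' where x': "x' \<in> U" "adj E x x'" and y': "y' \<in> U" "adj E y y'"
        using \<open>x \<in> N U\<close> \<open>y \<in> N U\<close> unfolding N_def by (auto simp: adj_commute)
      have lU: "linked E U" using U(1) unfolding P_def by blast
      have xyU: "x \<notin> U" "y \<notin> U" using that unfolding N_def by blast+
      have zxy: "adj E z x" "adj E z y"
        using full[OF \<open>x \<in> N U\<close> z(1)] full[OF \<open>y \<in> N U\<close> z(1)] by (simp_all add: adj_commute)
      have zU: "z \<notin> U" "\<not> adj E z a" if "a \<in> U" for a
        using z(1) that unfolding W_def N_def by (auto simp: adj_commute)
      show False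
        by (rule chordal_common_neighbours[OF assms(1) irr lU \<open>x \<noteq> y\<close> n xyU x' y' zxy zU(2) zU(1)])
           (use x' in auto)
    qed
    have "simplicial E V z"
      unfolding simplicial_def
    proof (intro ballI impI)
      fix x y assume xy: "x \<in> V" "y \<in> V" "adj E z x" "adj E z y" "x \<noteq> y"
      have "x \<in> W \<union> N U" "y \<in> W \<union> N U"
        using xy z(1) unfolding W_def N_def by (auto simp: adj_commute)
      then show "adj E x y"
        using xy full[of x y] full[of y x] clique[of x y] z(2) adj_commute[of E x y]
        unfolding simplicial_def by blast
    qed
    then show ?thesis using z(1) W by blast
  qed
qed

section \<open>Elimination ranks and chordality\<close>

theorem chordal_elimination_rank:
  assumes "chordal E" and irr: "\<And>x. \<not> adj E x x"
  shows "finite V \<Longrightarrow> \<exists>r :: 'a \<Rightarrow> nat. inj_on r V \<and>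
     (\<forall>v\<in>V. \<forall>x\<in>V. \<forall>y\<in>V. adj E v x \<and> adj E v y \<and> x \<noteq> y \<and> r x < r v \<and> r y < r v \<longrightarrow> adj E x y)"
proof (induction V rule: finite_psubset_induct)
  case (psubset V)
  show ?case
  proof (cases "V = {}")
    case False
    then obtain z where z: "z \<in> V" "simplicial E V z"
      using chordal_has_simplicial[OF assms psubset.hyps] by blast
    then have "V - {z} \<subset> V" by blast
    then obtain r :: "'a \<Rightarrow> nat" where r: "inj_on r (V - {z})"
      "\<forall>v\<in>V-{z}. \<forall>x\<in>V-{z}. \<forall>y\<in>V-{z}. adj E v x \<and> adj E v y \<and> x \<noteq> y \<and> r x < r v \<and> r y < r v \<longrightarrow> adj E x y"
      using psubset.IH[of "V - {z}"] by metis
    \<comment> \<open>A rank above all others makes every neighbour of \<open>z\<close> in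
      \<open>V\<close> an earlier one, and these are pairwise adjacent because \<open>z\<close> is
      simplicial.\<close>
    define k where "k = Suc (Max (insert 0 (r ` V)))"
    have k: "r x < k" if "x \<in> V" for x
      unfolding k_def using psubset.hyps that by (simp add: less_Suc_eq_le)
    let ?r = "r(z := k)"
    have "inj_on ?r V"
    proof (rule inj_onI)
      fix x y assume "x \<in> V" "y \<in> V" "?r x = ?r y"
      then show "x = y" using r(1) k[of x] k[of y] by (auto simp: inj_on_def split: if_splits)
    qed
    moreover have "\<forall>v\<in>V. \<forall>x\<in>V. \<forall>y\<in>V. adj E v x \<and> adj E v y \<and> x \<noteq> y \<and> ?r x < ?r v \<and> ?r y < ?r v \<longrightarrow> adj E x y"
    proof (intro ballI impI)
      fix v x y assume a: "v \<in> V" "x \<in> V" "y \<in> V"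
        and b: "adj E v x \<and> adj E v y \<and> x \<noteq> y \<and> ?r x < ?r v \<and> ?r y < ?r v"
      show "adj E x y"
      proof (cases "v = z")
        case True then show ?thesis using z a b unfolding simplicial_def by blast
      next
        case False
        then have n: "x \<noteq> z" "y \<noteq> z" using a b k[of v] by (auto split: if_splits)
        then have "r x < r v" "r y < r v" using b False by simp_all
        then show ?thesis using r(2) a b n False by blast
      qed
    qed
    ultimately show ?thesis by blast
  qed auto
qed

text \<open>A vertex of greatest rank on an induced cycle has its two cycle neighbours among its
  earlier neighbours, so they are adjacent: a chord, as the length is at least 4. Ranks may repeat
  on non-adjacent vertices, which later allows the level of a vertex to serve as its rank.\<close>

theorem chordal_if_elimination_rank:
  fixes r :: "'a \<Rightarrow> nat"
  assumes ne: "\<And>x y. adj E x y \<Longrightarrow> r x \<noteq> r y"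
    and cl: "\<And>v x y. adj E v x \<Longrightarrow> adj E v y \<Longrightarrow> x \<noteq> y \<Longrightarrow> r x < r v \<Longrightarrow> r y < r v \<Longrightarrow> adj E x y"
  shows "chordal E"
  unfolding chordal_def
proof
  assume "\<exists>vs. induced_cycle E vs"
  then obtain vs where vs: "induced_cycle E vs" by blast
  let ?l = "length vs"
  have l: "?l \<ge> 4" and d: "distinct vs"
    and a: "\<And>i. i < ?l \<Longrightarrow> adj E (vs ! i) (vs ! ((i + 1) mod ?l))"
    and c: "\<And>i j. i < ?l \<Longrightarrow> j < ?l \<Longrightarrow> adj E (vs ! i) (vs ! j) \<Longrightarrow> j = (i + 1) mod ?l \<or> i = (j + 1) mod ?l"
    using vs unfolding induced_cycle_def by blast+
  obtain i where i: "i < ?l" "\<And>j. j < ?l \<Longrightarrow> r (vs ! j) \<le> r (vs ! i)"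
  proof -
    have f: "finite (r ` set vs)" "r ` set vs \<noteq> {}" using l by auto
    obtain x where x: "x \<in> set vs" "r x = Max (r ` set vs)"
      using Max_in[OF f] by (metis imageE)
    then obtain i where "i < ?l" "vs ! i = x" by (auto simp: in_set_conv_nth)
    moreover have "r (vs ! j) \<le> r x" if "j < ?l" for j
      using x(2) Max_ge[OF f(1), of "r (vs ! j)"] that by simp
    ultimately show ?thesis using that by blast
  qed
  define j where "j = (i + 1) mod ?l"
  define h where "h = (if i = 0 then ?l - 1 else i - 1)"
  have j: "j < ?l" "j = (if i = ?l - 1 then 0 else i + 1)" and h: "h < ?l" "(h + 1) mod ?l = i"
    using i l unfolding j_def h_def by (auto simp: mod_Suc)
  have ij: "adj E (vs ! i) (vs ! j)" using a[OF i(1)] j_def by simp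
  have ih: "adj E (vs ! i) (vs ! h)" using a[OF h(1)] h(2) by (simp add: adj_commute)
  have jh: "j \<noteq> h" using j h i l unfolding h_def by (auto split: if_splits)
  have "r (vs ! j) < r (vs ! i)" "r (vs ! h) < r (vs ! i)"
    using ne[OF ij] ne[OF ih] i(2)[OF j(1)] i(2)[OF h(1)] by simp_all
  moreover have "vs ! j \<noteq> vs ! h" using d jh j(1) h(1) by (simp add: nth_eq_iff_index_eq)
  ultimately have "adj E (vs ! j) (vs ! h)" using cl[OF ij ih] by blast
  then have "h = (j + 1) mod ?l \<or> j = (h + 1) mod ?l" using c[OF j(1) h(1)] by blast
  then show False using j h i l unfolding h_def by (auto simp: mod_Suc split: if_splits)
qed

section \<open>Janson's inequality\<close>

text \<open>The ground set is arbitrary because \<open>janson\<close> also draws a random subset of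
  an index set.\<close>

definition rset :: "'a set \<Rightarrow> real \<Rightarrow> 'a set pmf" where
  "rset A p = map_pmf (\<lambda>f. {e \<in> A. f e}) (Pi_pmf A False (\<lambda>_. bernoulli_pmf p))"

definition expct :: "'a set \<Rightarrow> real \<Rightarrow> ('a set \<Rightarrow> real) \<Rightarrow> real" where
  "expct A p f = measure_pmf.expectation (rset A p) f"

lemma gnp_eq_rset: "gnp n p = rset (all_edges n) p"
  by (simp add: gnp_def rset_def)

lemma set_pmf_rset: "set_pmf (rset A p) \<subseteq> Pow A"
  by (auto simp: rset_def)

lemma rset_insert:
  assumes "finite A" "a \<notin> A"
  shows "rset (insert a A) p =
    bernoulli_pmf p \<bind> (\<lambda>b. map_pmf (\<lambda>X. if b then insert a X else X) (rset A p))"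
proof -
  have *: "{e. (e = a \<longrightarrow> b) \<and> (e \<noteq> a \<longrightarrow> e \<in> A \<and> f e)}
      = (if b then insert a {e\<in>A. f e} else {e\<in>A. f e})" for f b
    using assms(2) by auto
  show ?thesis
    unfolding rset_def Pi_pmf_insert'[OF assms]
    by (simp add: map_bind_pmf map_pmf_def bind_return_pmf bind_assoc_pmf *)
qed

context
  fixes A :: "'a set" and p :: real
  assumes A: "finite A"
begin

lemma integrable_rset: "integrable (measure_pmf (rset A p)) (f :: _ \<Rightarrow> real)"
  by (intro integrable_measure_pmf_finite finite_subset[OF set_pmf_rset]) (simp add: A)

lemma expct_cong: "(\<And>X. X \<subseteq> A \<Longrightarrow> f X = g X) \<Longrightarrow> expct A p f = expct A p g"
  unfolding expct_def
  by (intro integral_cong_AE) (auto simp: AE_measure_pmf_iff dest!: set_pmf_rset[THEN subsetD])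

lemma expct_mono: "(\<And>X. X \<subseteq> A \<Longrightarrow> f X \<le> g X) \<Longrightarrow> expct A p f \<le> expct A p g"
  unfolding expct_def
  by (intro integral_mono_AE integrable_rset)
     (auto simp: AE_measure_pmf_iff dest!: set_pmf_rset[THEN subsetD])

lemma expct_const: "expct A p (\<lambda>_. c) = c"
  unfolding expct_def by simp

lemma expct_diff: "expct A p (\<lambda>X. f X - g X) = expct A p f - expct A p g"
  unfolding expct_def by (simp add: integrable_rset)

lemma expct_cmult: "expct A p (\<lambda>X. c * f X) = c * expct A p f"
  unfolding expct_def by simp

lemma expct_sum: "expct A p (\<lambda>X. \<Sum>i\<in>I. f i X) = (\<Sum>i\<in>I. expct A p (f i))"
  unfolding expct_def by (intro Bochner_Integration.integral_sum integrable_rset)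

lemma expct_nonneg: "(\<And>X. X \<subseteq> A \<Longrightarrow> 0 \<le> f X) \<Longrightarrow> 0 \<le> expct A p f"
  using expct_mono[of "\<lambda>_. 0" f] by (simp add: expct_const)

lemma expct_le_attained: "\<exists>X\<subseteq>A. expct A p f \<le> f X"
proof -
  have fin: "finite (f ` Pow A)" "f ` Pow A \<noteq> {}" using A by auto
  obtain X where X: "X \<subseteq> A" "f X = Max (f ` Pow A)" using Max_in[OF fin] by (metis PowD imageE)
  have "expct A p f \<le> expct A p (\<lambda>_. f X)"
    using X fin by (intro expct_mono) auto
  then show ?thesis using X expct_const by auto
qed

lemma prob_rset: "measure_pmf.prob (rset A p) {X. Q X} = expct A p (\<lambda>X. of_bool (Q X))"
proof -
  have "(\<lambda>X. of_bool (Q X) :: real) = indicator {X. Q X}" by (auto simp: indicator_def)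
  then show ?thesis by (simp add: expct_def)
qed

end

lemma expct_insert:
  assumes "finite A" "a \<notin> A" "0 \<le> p" "p \<le> 1"
  shows "expct (insert a A) p f = p * expct A p (\<lambda>X. f (insert a X)) + (1 - p) * expct A p f"
proof -
  have "expct (insert a A) p f = (\<Sum>b\<in>UNIV. pmf (bernoulli_pmf p) b *\<^sub>R
      measure_pmf.expectation (map_pmf (\<lambda>X. if b then insert a X else X) (rset A p)) f)"
    unfolding expct_def rset_insert[OF assms(1,2)]
  proof (rule pmf_expectation_bind)
    show "finite (set_pmf (map_pmf (\<lambda>X. if b then insert a X else X) (rset A p)))" for b
      using assms(1) set_pmf_rset[of A p] finite_subset by (simp add: finite_subset)
  qed auto
  also have "\<dots> = p * expct A p (\<lambda>X. f (insert a X)) + (1 - p) * expct A p f"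
    using assms by (simp add: UNIV_bool expct_def)
  finally show ?thesis .
qed

lemma expct_member:
  assumes "finite A" "a \<in> A" "0 \<le> p" "p \<le> 1"
  shows "expct A p (\<lambda>X. of_bool (a \<in> X) * f X) = p * expct A p (\<lambda>X. f (insert a X))"
proof -
  define A' where "A' = A - {a}"
  have A': "finite A'" "a \<notin> A'" and A: "A = insert a A'" using assms unfolding A'_def by auto
  have "expct A' p (\<lambda>X. of_bool (a \<in> X) * f X) = expct A' p (\<lambda>_. 0)"
    using A' by (intro expct_cong) auto
  then show ?thesis
    unfolding A expct_insert[OF A' assms(3,4)] using A' by (simp add: expct_const algebra_simps)
qed

text \<open>By independence, conditioning on B \<subseteq> X amounts to replacing X by B \<union> X.
  This form avoids conditional probabilities throughout.\<close>

lemma expct_superset: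
  assumes A: "finite A" and p: "0 \<le> p" "p \<le> 1"
  shows "finite B \<Longrightarrow> B \<subseteq> A \<Longrightarrow> expct A p (\<lambda>X. of_bool (B \<subseteq> X) * f X) = p ^ card B * expct A p (\<lambda>X. f (B \<union> X))"
proof (induction B arbitrary: f rule: finite_induct)
  case (insert b B)
  have "expct A p (\<lambda>X. of_bool (insert b B \<subseteq> X) * f X)
      = expct A p (\<lambda>X. of_bool (b \<in> X) * (of_bool (B \<subseteq> X) * f X))"
    by (intro expct_cong A) auto
  also have "\<dots> = p * expct A p (\<lambda>X. of_bool (B \<subseteq> insert b X) * f (insert b X))"
    using insert.prems by (intro expct_member A p) auto
  also have "\<dots> = p * expct A p (\<lambda>X. of_bool (B \<subseteq> X) * f (insert b X))"
    using insert.hyps by (simp add: subset_insert)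
  also have "\<dots> = p * (p ^ card B * expct A p (\<lambda>X. f (insert b (B \<union> X))))"
    using insert by simp
  finally show ?case using insert.hyps by simp
qed simp

lemma expct_superset_prob:
  assumes "finite A" "0 \<le> p" "p \<le> 1" "B \<subseteq> A"
  shows "expct A p (\<lambda>X. of_bool (B \<subseteq> X)) = p ^ card B"
  using expct_superset[OF assms(1-3) finite_subset[OF assms(4,1)] assms(4), of "\<lambda>_. 1"] assms(1)
  by (simp add: expct_const)

theorem union_bound:
  assumes "finite A" "0 \<le> p" "p \<le> 1" "finite I"
    and Q: "\<And>X. X \<subseteq> A \<Longrightarrow> Q X \<Longrightarrow> \<exists>i\<in>I. R i X"
  shows "measure_pmf.prob (rset A p) {X. Q X} \<le> (\<Sum>i\<in>I. measure_pmf.prob (rset A p) {X. R i X})"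
proof -
  have "measure_pmf.prob (rset A p) {X. Q X} \<le> expct A p (\<lambda>X. \<Sum>i\<in>I. of_bool (R i X))"
    unfolding prob_rset[OF assms(1)]
  proof (intro expct_mono assms)
    fix X assume X: "X \<subseteq> A"
    show "of_bool (Q X) \<le> (\<Sum>i\<in>I. of_bool (R i X) :: real)"
    proof (cases "Q X")
      case True
      then obtain i where i: "i \<in> I" "R i X" using Q X by blast
      then have "(1::real) \<le> (\<Sum>i\<in>I. of_bool (R i X))"
        using member_le_sum[of i I "\<lambda>i. of_bool (R i X) :: real"] assms(4) by simp
      then show ?thesis using True by simp
    qed (simp add: sum_nonneg)
  qed
  then show ?thesis using assms(1) by (simp add: expct_sum prob_rset)
qed

section \<open>The exponential bound for containing no set of a family\<close>

text \<open>Split the family into \<open>J\<close>, the sets disjoint from \<open>C\<close>, and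
  \<open>K\<close>, those that meet it. The event \<open>z\<close> of avoiding \<open>J\<close> is
  independent of C \<subseteq> X. Each set in \<open>K\<close> costs at most p^|C \<union> B j|
  times the expectation of \<open>z\<close>, because \<open>z\<close> is decreasing; this
  monotonicity stands in for the Harris inequality.\<close>

lemma janson_step:
  assumes A: "finite A" and p: "0 \<le> p" "p \<le> 1" and I: "finite I"
    and B: "\<And>j. j \<in> I \<Longrightarrow> B j \<subseteq> A" "C \<subseteq> A"
  shows "expct A p (\<lambda>X. of_bool (C \<subseteq> X) * of_bool (\<forall>j\<in>I. \<not> B j \<subseteq> X)) \<ge>
    (p ^ card C - (\<Sum>j\<in>I. of_bool (C \<inter> B j \<noteq> {}) * p ^ card (C \<union> B j)))
     * expct A p (\<lambda>X. of_bool (\<forall>j\<in>I. \<not> B j \<subseteq> X))" (is "?L \<ge> ?c * ?Z")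
proof -
  define J where "J = {j\<in>I. C \<inter> B j = {}}"
  define K where "K = {j\<in>I. C \<inter> B j \<noteq> {}}"
  have IJK: "I = J \<union> K" "J \<inter> K = {}" "finite J" "finite K" using I unfolding J_def K_def by auto
  define z where "z X = (of_bool (\<forall>j\<in>J. \<not> B j \<subseteq> X) :: real)" for X
  have finC: "finite C" "\<And>j. j \<in> I \<Longrightarrow> finite (B j)" using A B finite_subset by blast+
  have zC: "expct A p (\<lambda>X. of_bool (C \<subseteq> X) * z X) = p ^ card C * expct A p z"
  proof -
    have "z (C \<union> X) = z X" for X unfolding z_def J_def by (intro arg_cong[of _ _ of_bool]) blast
    then show ?thesis using expct_superset[OF A p finC(1) B(2)] by simp
  qed
  have zD: "expct A p (\<lambda>X. of_bool (C \<union> B j \<subseteq> X) * z X) \<le> p ^ card (C \<union> B j) * expct A p z" if "j \<in> I" for j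
  proof -
    have "expct A p (\<lambda>X. z (C \<union> B j \<union> X)) \<le> expct A p z"
      by (intro expct_mono A) (auto simp: z_def)
    then have "p ^ card (C \<union> B j) * expct A p (\<lambda>X. z (C \<union> B j \<union> X)) \<le> p ^ card (C \<union> B j) * expct A p z"
      using p by (intro mult_left_mono) auto
    then show ?thesis using expct_superset[OF A p, of "C \<union> B j" z] finC B that by simp
  qed
  have Zz: "?Z \<le> expct A p z"
    by (intro expct_mono A) (auto simp: z_def J_def)
  have Z0: "0 \<le> ?Z" by (intro expct_nonneg A) auto
  have csum: "(\<Sum>j\<in>I. of_bool (C \<inter> B j \<noteq> {}) * p ^ card (C \<union> B j)) = (\<Sum>j\<in>K. p ^ card (C \<union> B j))"
    unfolding K_def using I by (intro sum.mono_neutral_cong_right) auto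
  have "?c * expct A p z \<le> expct A p (\<lambda>X. of_bool (C \<subseteq> X) * z X) - (\<Sum>j\<in>K. expct A p (\<lambda>X. of_bool (C \<union> B j \<subseteq> X) * z X))"
  proof -
    have "(\<Sum>j\<in>K. expct A p (\<lambda>X. of_bool (C \<union> B j \<subseteq> X) * z X)) \<le> (\<Sum>j\<in>K. p ^ card (C \<union> B j) * expct A p z)"
      using zD by (intro sum_mono) (auto simp: K_def)
    then show ?thesis unfolding zC csum by (simp add: left_diff_distrib sum_distrib_right)
  qed
  also have "\<dots> = expct A p (\<lambda>X. of_bool (C \<subseteq> X) * z X - (\<Sum>j\<in>K. of_bool (C \<union> B j \<subseteq> X) * z X))"
    using A by (simp add: expct_diff expct_sum)
  \<comment> \<open>Bonferroni: if C \<subseteq> X, \<open>J\<close> is avoided and some set of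
    \<open>K\<close> lies in X, then the subtracted sum is at least 1.\<close>
  also have "\<dots> \<le> ?L"
  proof (intro expct_mono A)
    fix X
    have S: "0 \<le> (\<Sum>j\<in>K. of_bool (C \<union> B j \<subseteq> X) * z X)" by (intro sum_nonneg) (simp add: z_def)
    show "of_bool (C \<subseteq> X) * z X - (\<Sum>j\<in>K. of_bool (C \<union> B j \<subseteq> X) * z X)
        \<le> of_bool (C \<subseteq> X) * of_bool (\<forall>j\<in>I. \<not> B j \<subseteq> X)"
    proof (cases "C \<subseteq> X \<and> z X = 1 \<and> \<not> (\<forall>j\<in>I. \<not> B j \<subseteq> X)")
      case True
      then obtain k where k: "k \<in> K" "B k \<subseteq> X" unfolding z_def IJK(1) by (auto split: if_splits)
      then have "1 \<le> (\<Sum>j\<in>K. of_bool (C \<union> B j \<subseteq> X) * z X)"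
        using member_le_sum[of k K "\<lambda>j. of_bool (C \<union> B j \<subseteq> X) * z X"] True IJK(4) by simp
      then show ?thesis using True by simp
    next
      case False
      then have "of_bool (C \<subseteq> X) * z X \<le> of_bool (C \<subseteq> X) * (of_bool (\<forall>j\<in>I. \<not> B j \<subseteq> X)::real)"
        unfolding z_def J_def by auto
      then show ?thesis using S by linarith
    qed
  qed
  finally have main: "?c * expct A p z \<le> ?L" .
  \<comment> \<open>Passing from the expectation of \<open>z\<close> to the smaller
    \<open>?Z\<close> is allowed only for a nonnegative factor; for a negative one the bound is
    trivial.\<close>
  show ?thesis
  proof (cases "?c \<ge> 0")
    case True
    then have "?c * ?Z \<le> ?c * expct A p z" using Zz by (intro mult_left_mono)
    then show ?thesis using main by linarith
  next
    case False
    then have "?c * ?Z \<le> 0" using Z0 by (simp add: mult_nonpos_nonneg)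
    also have "0 \<le> ?L" by (intro expct_nonneg A) auto
    finally show ?thesis .
  qed
qed

text \<open>A new index multiplies the probability by at most 1 - c \<le> exp (-c), with c from
  \<open>janson_step\<close>. The double sum takes each pair in both orders, twice what the
  induction produces.\<close>

lemma janson_basic:
  assumes A: "finite A" and p: "0 \<le> p" "p \<le> 1"
  shows "finite I \<Longrightarrow> (\<And>i. i \<in> I \<Longrightarrow> B i \<subseteq> A) \<Longrightarrow>
    expct A p (\<lambda>X. of_bool (\<forall>i\<in>I. \<not> B i \<subseteq> X)) \<le>
    exp (- (\<Sum>i\<in>I. p ^ card (B i)) + (\<Sum>i\<in>I. \<Sum>j\<in>I-{i}. of_bool (B i \<inter> B j \<noteq> {}) * p ^ card (B i \<union> B j)))"
proof (induction I rule: finite_induct)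
  case empty
  then show ?case using A by (simp add: expct_const)
next
  case (insert i I)
  define w where "w i j = of_bool (B i \<inter> B j \<noteq> {}) * p ^ card (B i \<union> B j)" for i j
  have w0: "0 \<le> w i j" for i j unfolding w_def using p by simp
  define c where "c = p ^ card (B i) - (\<Sum>j\<in>I. w i j)"
  let ?Z = "expct A p (\<lambda>X. of_bool (\<forall>j\<in>I. \<not> B j \<subseteq> X))"
  have "expct A p (\<lambda>X. of_bool (\<forall>j\<in>insert i I. \<not> B j \<subseteq> X))
      = expct A p (\<lambda>X. of_bool (\<forall>j\<in>I. \<not> B j \<subseteq> X) - of_bool (B i \<subseteq> X) * of_bool (\<forall>j\<in>I. \<not> B j \<subseteq> X))"
    by (intro expct_cong A) auto
  also have "\<dots> \<le> ?Z - c * ?Z"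
    using janson_step[OF A p insert.hyps(1), of B "B i"] insert.prems A unfolding c_def w_def
    by (simp add: expct_diff)
  also have "\<dots> = (1 - c) * ?Z" by (simp add: algebra_simps)
  also have "\<dots> \<le> exp (- c) * ?Z"
    using exp_ge_add_one_self[of "-c"] by (intro mult_right_mono expct_nonneg A) auto
  also have "\<dots> \<le> exp (- c) * exp (- (\<Sum>i\<in>I. p ^ card (B i)) + (\<Sum>i\<in>I. \<Sum>j\<in>I-{i}. w i j))"
    using insert.IH insert.prems unfolding w_def by (intro mult_left_mono) auto
  also have "\<dots> = exp (- c - (\<Sum>i\<in>I. p ^ card (B i)) + (\<Sum>i\<in>I. \<Sum>j\<in>I-{i}. w i j))"
    by (simp add: exp_add[symmetric])
  also have "\<dots> \<le> exp (- (\<Sum>i\<in>insert i I. p ^ card (B i)) + (\<Sum>k\<in>insert i I. \<Sum>j\<in>insert i I-{k}. w k j))"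
  proof -
    have "(\<Sum>k\<in>I. \<Sum>j\<in>I-{k}. w k j) \<le> (\<Sum>k\<in>I. \<Sum>j\<in>insert i I-{k}. w k j)"
      using insert.hyps w0 by (intro sum_mono sum_mono2) auto
    then have "(\<Sum>j\<in>I. w i j) + (\<Sum>k\<in>I. \<Sum>j\<in>I-{k}. w k j) \<le> (\<Sum>k\<in>insert i I. \<Sum>j\<in>insert i I-{k}. w k j)"
      using insert.hyps by simp
    then show ?thesis unfolding c_def using insert.hyps by simp
  qed
  finally show ?case unfolding w_def .
qed

text \<open>The factor q comes from applying the basic inequality to a random subfamily that keeps each
  index with probability q.\<close>

theorem janson:
  assumes A: "finite A" and p: "0 \<le> p" "p \<le> 1" and q: "0 \<le> q" "q \<le> 1" and I: "finite I"
    and B: "\<And>i. i \<in> I \<Longrightarrow> B i \<subseteq> A"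
  shows "measure_pmf.prob (rset A p) {X. \<forall>i\<in>I. \<not> B i \<subseteq> X} \<le>
    exp (- q * (\<Sum>i\<in>I. p ^ card (B i))
      + q\<^sup>2 * (\<Sum>i\<in>I. \<Sum>j\<in>I. of_bool (B i \<inter> B j \<noteq> {}) * p ^ card (B i \<union> B j)))"
proof -
  define w where "w i j = of_bool (B i \<inter> B j \<noteq> {}) * p ^ card (B i \<union> B j)" for i j
  have w0: "0 \<le> w i j" for i j unfolding w_def using p by simp
  \<comment> \<open>For a subfamily S this is the negated exponent of \<open>janson_basic\<close>.
    Single indices survive with probability q and pairs with q^2, which explains the two powers of q
    in the result.\<close>
  define g where "g S = (\<Sum>i\<in>I. p ^ card (B i) * of_bool ({i} \<subseteq> S))
      - (\<Sum>i\<in>I. \<Sum>j\<in>I-{i}. w i j * of_bool ({i,j} \<subseteq> S))" for S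
  have pr: "expct I q (\<lambda>S. of_bool (T \<subseteq> S)) = q ^ card T" if "T \<subseteq> I" for T
    using expct_superset_prob[OF I q that] .
  have "expct I q g = (\<Sum>i\<in>I. p ^ card (B i) * q) - (\<Sum>i\<in>I. \<Sum>j\<in>I-{i}. w i j * q\<^sup>2)"
    unfolding g_def expct_diff[OF I] expct_sum[OF I] expct_cmult[OF I]
  proof (intro arg_cong2[where f="(-)"] sum.cong refl arg_cong2[where f="(*)"])
    show "expct I q (\<lambda>S. of_bool ({i} \<subseteq> S)) = q" if "i \<in> I" for i
      using pr[of "{i}"] that by simp
    show "expct I q (\<lambda>S. of_bool ({i, j} \<subseteq> S)) = q\<^sup>2" if "i \<in> I" "j \<in> I - {i}" for i j
      using pr[of "{i, j}"] that by (auto simp: card_insert_if power2_eq_square)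
  qed
  also have "\<dots> \<ge> q * (\<Sum>i\<in>I. p ^ card (B i)) - q\<^sup>2 * (\<Sum>i\<in>I. \<Sum>j\<in>I. w i j)"
  proof -
    have "(\<Sum>i\<in>I. \<Sum>j\<in>I-{i}. w i j * q\<^sup>2) \<le> (\<Sum>i\<in>I. \<Sum>j\<in>I. w i j * q\<^sup>2)"
      using I w0 by (intro sum_mono sum_mono2) auto
    then show ?thesis by (simp add: sum_distrib_left sum_distrib_right mult.commute)
  qed
  finally have "expct I q g \<ge> q * (\<Sum>i\<in>I. p ^ card (B i)) - q\<^sup>2 * (\<Sum>i\<in>I. \<Sum>j\<in>I. w i j)" .
  \<comment> \<open>Some subfamily does at least as well as the average.\<close>
  then obtain S where S: "S \<subseteq> I" "g S \<ge> q * (\<Sum>i\<in>I. p ^ card (B i)) - q\<^sup>2 * (\<Sum>i\<in>I. \<Sum>j\<in>I. w i j)"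
    using expct_le_attained[OF I, of q g] by force
  have gS: "g S = (\<Sum>i\<in>S. p ^ card (B i)) - (\<Sum>i\<in>S. \<Sum>j\<in>S-{i}. w i j)"
  proof -
    have 1: "(\<Sum>i\<in>I. p ^ card (B i) * of_bool ({i} \<subseteq> S)) = (\<Sum>i\<in>S. p ^ card (B i))"
      using S(1) I by (intro sum.mono_neutral_cong_right) auto
    have 2: "(\<Sum>j\<in>I-{i}. w i j * of_bool ({i,j} \<subseteq> S)) = (if i \<in> S then \<Sum>j\<in>S-{i}. w i j else 0)" for i
    proof (cases "i \<in> S")
      case True
      then show ?thesis using S(1) I by (auto intro!: sum.mono_neutral_cong_right)
    qed simp
    show ?thesis unfolding g_def 1 2 using S(1) I by (simp add: sum.If_cases Int_absorb1)
  qed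
  have "measure_pmf.prob (rset A p) {X. \<forall>i\<in>I. \<not> B i \<subseteq> X} \<le> expct A p (\<lambda>X. of_bool (\<forall>i\<in>S. \<not> B i \<subseteq> X))"
    unfolding prob_rset[OF A] using S(1) by (intro expct_mono A) auto
  also have "\<dots> \<le> exp (- g S)"
    using janson_basic[OF A p, of S B] finite_subset[OF S(1) I] B S(1) unfolding gS w_def by auto
  also have "\<dots> \<le> exp (- q * (\<Sum>i\<in>I. p ^ card (B i)) + q\<^sup>2 * (\<Sum>i\<in>I. \<Sum>j\<in>I. w i j))"
    using S(2) by simp
  finally show ?thesis unfolding w_def .
qed

section \<open>Counting attachments\<close>

text \<open>An attachment records, along an elimination order, the set S v of earlier neighbours of each v in V;
  the latest of them is a parent f, and the others are earlier neighbours of f. As S is empty outside V,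
  a vertex whose parent lies outside V has that parent as its only earlier neighbour.\<close>

definition attachment :: "nat \<Rightarrow> nat \<Rightarrow> nat set \<Rightarrow> (nat \<Rightarrow> nat set) \<Rightarrow> bool" where
  "attachment n R V S \<longleftrightarrow> V \<subseteq> {..<n} \<and> (\<forall>v. v \<notin> V \<longrightarrow> S v = {}) \<and>
     (\<forall>v\<in>V. S v \<subseteq> {..<n} \<and> card (S v) \<le> R \<and> (\<exists>f\<in>S v. S v \<subseteq> insert f (S f))) \<and>
     (\<exists>r :: nat \<Rightarrow> nat. \<forall>v\<in>V. \<forall>u\<in>S v. r u < r v)"

definition attachment_edges :: "nat set \<Rightarrow> (nat \<Rightarrow> nat set) \<Rightarrow> nat set set" where
  "attachment_edges V S = (\<Union>v\<in>V. (\<lambda>u. {v, u}) ` S v)"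

lemma finite_all_edges: "finite (all_edges n)"
proof (rule finite_subset)
  show "all_edges n \<subseteq> Pow {..<n}" unfolding all_edges_def by auto
qed simp

text \<open>Ranks orient the edges, so each edge is listed only at its later end.\<close>

lemma card_ranked_edges:
  fixes r :: "'a \<Rightarrow> nat"
  assumes "finite V" "\<And>v. v \<in> V \<Longrightarrow> finite (S v)" "\<And>v u. v \<in> V \<Longrightarrow> u \<in> S v \<Longrightarrow> r u < r v"
  shows "card (\<Union>v\<in>V. (\<lambda>u. {v, u}) ` S v) = (\<Sum>v\<in>V. card (S v))"
proof -
  have "card (\<Union>v\<in>V. (\<lambda>u. {v, u}) ` S v) = (\<Sum>v\<in>V. card ((\<lambda>u. {v, u}) ` S v))"
  proof (rule card_UN_disjoint)
    show "\<forall>v\<in>V. \<forall>w\<in>V. v \<noteq> w \<longrightarrow> (\<lambda>u. {v, u}) ` S v \<inter> (\<lambda>u. {w, u}) ` S w = {}"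
    proof (intro ballI impI, rule ccontr)
      fix v w assume vw: "v \<in> V" "w \<in> V" "v \<noteq> w" "(\<lambda>u. {v, u}) ` S v \<inter> (\<lambda>u. {w, u}) ` S w \<noteq> {}"
      then have "w \<in> S v" "v \<in> S w" by (auto simp: doubleton_eq_iff)
      then show False using assms(3)[OF vw(1)] assms(3)[OF vw(2)] by (meson less_asym)
    qed
  qed (use assms in auto)
  also have "\<dots> = (\<Sum>v\<in>V. card (S v))"
    by (intro sum.cong refl card_image inj_onI) (auto simp: doubleton_eq_iff)
  finally show ?thesis .
qed

lemma card_attachment_edges:
  assumes "attachment n R V S"
  shows "card (attachment_edges V S) = (\<Sum>v\<in>V. card (S v))"
proof -
  obtain r :: "nat \<Rightarrow> nat" where r: "\<forall>v\<in>V. \<forall>u\<in>S v. r u < r v" using assms unfolding attachment_def by blast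
  have "finite V" using assms finite_subset unfolding attachment_def by blast
  moreover have "finite (S v)" if "v \<in> V" for v
    using assms that finite_subset[of "S v" "{..<n}"] unfolding attachment_def by simp
  ultimately show ?thesis unfolding attachment_edges_def using r by (intro card_ranked_edges[where r=r]) auto
qed

lemma attachment_edges_subset:
  assumes "attachment n R V S"
  shows "attachment_edges V S \<subseteq> all_edges n"
proof -
  obtain r :: "nat \<Rightarrow> nat" where r: "\<forall>v\<in>V. \<forall>u\<in>S v. r u < r v" using assms unfolding attachment_def by blast
  have "v < n" "u < n" "v \<noteq> u" if "v \<in> V" "u \<in> S v" for u v
    using assms r that unfolding attachment_def by auto
  then show ?thesis unfolding attachment_edges_def all_edges_def by blast
qed

text \<open>An attachment is determined by choosing for each vertex a parent f and, as a bitmask, the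
  remaining neighbours among those of f.\<close>

lemma card_attachments:
  assumes "V \<subseteq> {..<n}"
  shows "finite {S. attachment n R V S}" "card {S. attachment n R V S} \<le> (n * 2 ^ R) ^ card V"
proof -
  have finV: "finite V" using assms finite_subset by blast
  define par where "par S v = (SOME f. f \<in> S v \<and> S v \<subseteq> insert f (S f))" for S :: "nat \<Rightarrow> nat set" and v
  define ls where "ls S v = sorted_list_of_set (S (par S v))" for S :: "nat \<Rightarrow> nat set" and v
  define mask where "mask S v = {i. i < length (ls S v) \<and> ls S v ! i \<in> S v}" for S v
  define code where "code S = (\<lambda>v\<in>V. (par S v, mask S v))" for S
  have par: "par S v \<in> S v" "S v \<subseteq> insert (par S v) (S (par S v))" if "attachment n R V S" "v \<in> V" for S v
  proof -
    have "\<exists>f. f \<in> S v \<and> S v \<subseteq> insert f (S f)" using that unfolding attachment_def by blast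
    from someI_ex[OF this] show "par S v \<in> S v" "S v \<subseteq> insert (par S v) (S (par S v))"
      unfolding par_def by blast+
  qed
  have finS: "finite (S v)" "card (S v) \<le> R" if "attachment n R V S" for S v
  proof -
    have "finite (S v) \<and> card (S v) \<le> R"
    proof (cases "v \<in> V")
      case True
      then have "S v \<subseteq> {..<n}" "card (S v) \<le> R" using that unfolding attachment_def by blast+
      then show ?thesis using finite_subset by blast
    next
      case False
      then have "S v = {}" using that unfolding attachment_def by blast
      then show ?thesis by simp
    qed
    then show "finite (S v)" "card (S v) \<le> R" by blast+
  qed
  have decode: "S v = insert (par S v) ((\<lambda>i. ls S v ! i) ` mask S v)" if "attachment n R V S" "v \<in> V" for S v
  proof -
    have "set (ls S v) = S (par S v)" unfolding ls_def using finS(1)[OF that(1)] by simp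
    then have "(\<lambda>i. ls S v ! i) ` mask S v = S (par S v) \<inter> S v"
      unfolding mask_def by (auto simp: set_conv_nth)
    then show ?thesis using par[OF that] by blast
  qed
  have inj: "inj_on code {S. attachment n R V S}"
  proof (rule inj_onI)
    fix S S' assume S: "S \<in> {S. attachment n R V S}" "S' \<in> {S. attachment n R V S}" "code S = code S'"
    have c: "par S v = par S' v" "mask S v = mask S' v" if "v \<in> V" for v
      using fun_cong[OF S(3), of v] that unfolding code_def by auto
    obtain r :: "nat \<Rightarrow> nat" where r: "\<forall>v\<in>V. \<forall>u\<in>S v. r u < r v" using S(1) unfolding attachment_def by blast
    \<comment> \<open>Induction along the rank of \<open>S\<close> alone. The codes give both the
      same parent, whose sets agree by induction, so equal masks select equal neighbours. Outside
      \<open>V\<close> both sets are empty.\<close>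
    have "S v = S' v" for v
    proof (induction v rule: measure_induct_rule[where f=r])
      case (less v)
      show ?case
      proof (cases "v \<in> V")
        case True
        have a: "attachment n R V S" "attachment n R V S'" using S by auto
        have "S (par S v) = S' (par S v)"
          using less[of "par S v"] r True par(1)[OF a(1) True] by blast
        then have "ls S v = ls S' v" unfolding ls_def using c(1)[OF True] by simp
        then show ?thesis by (subst decode[OF a(1) True], subst decode[OF a(2) True]) (simp add: c[OF True])
      next
        case False
        then have "S v = {}" "S' v = {}" using S(1,2) unfolding attachment_def by simp_all
        then show ?thesis by simp
      qed
    qed
    then show "S = S'" by blast
  qed
  have sub: "code ` {S. attachment n R V S} \<subseteq> V \<rightarrow>\<^sub>E {..<n} \<times> Pow {..<R}" (is "_ \<subseteq> ?P")
  proof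
    fix c assume "c \<in> code ` {S. attachment n R V S}"
    then obtain S where S: "attachment n R V S" "c = code S" by blast
    have "par S v < n" if "v \<in> V" for v
      using par(1)[OF S(1) that] S(1) that unfolding attachment_def by blast
    moreover have "mask S v \<subseteq> {..<R}" for v
    proof -
      have "length (ls S v) \<le> R" unfolding ls_def using finS[OF S(1)] by simp
      then show ?thesis unfolding mask_def by auto
    qed
    ultimately show "c \<in> ?P" unfolding S(2) code_def by auto
  qed
  have finP: "finite ?P" using finV by (intro finite_PiE) auto
  show "finite {S. attachment n R V S}"
    using finite_imageD[OF finite_subset[OF sub finP] inj] .
  have "card {S. attachment n R V S} \<le> card ?P"
    by (rule card_inj_on_le[OF inj sub finP])
  also have "\<dots> = (n * 2 ^ R) ^ card V"
    using finV by (simp add: card_PiE card_cartesian_product card_Pow)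
  finally show "card {S. attachment n R V S} \<le> (n * 2 ^ R) ^ card V" .
qed

section \<open>First moment bound for dense attachments\<close>

definition dense_attachment :: "nat \<Rightarrow> nat \<Rightarrow> real \<Rightarrow> real \<Rightarrow> nat set set \<Rightarrow> bool" where
  "dense_attachment n R \<kappa> s E \<longleftrightarrow> (\<exists>V S. attachment n R V S \<and> attachment_edges V S \<subseteq> E \<and>
     s \<le> real (card V) \<and> \<kappa> * real (card V) \<le> real (\<Sum>v\<in>V. card (S v)))"

text \<open>For fixed \<open>V\<close> there are at most (n 2^R)^|V| attachments, each present with
  probability at most p^(\<kappa> |V|). So \<open>x\<close> is the cost per vertex, and the factor
  2^n pays for the choice of \<open>V\<close>.\<close>

lemma prob_dense_attachment:
  fixes p \<kappa> s :: real and n R :: nat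
  assumes p: "0 < p" "p \<le> 1" and n: "0 < n"
  defines "x \<equiv> real n * 2 ^ R * p powr \<kappa>"
  assumes x: "x \<le> 1"
  shows "measure_pmf.prob (gnp n p) {E. dense_attachment n R \<kappa> s E} \<le> 2 ^ n * x powr s"
proof -
  define \<V> where "\<V> = {V. V \<subseteq> {..<n} \<and> s \<le> real (card V)}"
  define \<S> where "\<S> V = {S. attachment n R V S \<and> \<kappa> * real (card V) \<le> real (\<Sum>v\<in>V. card (S v))}" for V
  have fin\<V>: "finite \<V>" unfolding \<V>_def by simp
  have fin\<S>: "finite (\<S> V)" "card (\<S> V) \<le> (n * 2 ^ R) ^ card V" if "V \<in> \<V>" for V
  proof -
    have V: "V \<subseteq> {..<n}" using that unfolding \<V>_def by blast
    have sub: "\<S> V \<subseteq> {S. attachment n R V S}" unfolding \<S>_def by blast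
    show "finite (\<S> V)" using card_attachments(1)[OF V] finite_subset[OF sub] by blast
    show "card (\<S> V) \<le> (n * 2 ^ R) ^ card V"
      using card_mono[OF card_attachments(1)[OF V] sub] card_attachments(2)[OF V, of R] by linarith
  qed
  have x0: "0 < x" unfolding x_def using p n by simp
  have "measure_pmf.prob (gnp n p) {E. dense_attachment n R \<kappa> s E}
      \<le> (\<Sum>(V,S)\<in>Sigma \<V> \<S>. measure_pmf.prob (rset (all_edges n) p) {E. attachment_edges V S \<subseteq> E})"
    unfolding gnp_eq_rset
  proof (rule order_trans[OF union_bound[where R="\<lambda>(V,S) E. attachment_edges V S \<subseteq> E"]])
    show "finite (Sigma \<V> \<S>)" using fin\<V> fin\<S> by (intro finite_SigmaI) auto
    fix E assume "dense_attachment n R \<kappa> s E"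
    then obtain V S where VS: "attachment n R V S" "attachment_edges V S \<subseteq> E"
      "s \<le> real (card V)" "\<kappa> * real (card V) \<le> real (\<Sum>v\<in>V. card (S v))"
      unfolding dense_attachment_def by blast
    then have "V \<in> \<V>" "S \<in> \<S> V" unfolding \<V>_def \<S>_def attachment_def by blast+
    then show "\<exists>i\<in>Sigma \<V> \<S>. (case i of (V, S) \<Rightarrow> \<lambda>E. attachment_edges V S \<subseteq> E) E"
      using VS(2) by (intro bexI[of _ "(V,S)"]) auto
  qed (use p finite_all_edges in \<open>auto simp: case_prod_unfold\<close>)
  also have "\<dots> = (\<Sum>V\<in>\<V>. \<Sum>S\<in>\<S> V. p ^ card (attachment_edges V S))"
  proof -
    have "measure_pmf.prob (rset (all_edges n) p) {E. attachment_edges V S \<subseteq> E} = p ^ card (attachment_edges V S)"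
      if "S \<in> \<S> V" for V S
    proof -
      have "attachment_edges V S \<subseteq> all_edges n" using that attachment_edges_subset unfolding \<S>_def by blast
      then show ?thesis
        using p by (simp add: prob_rset[OF finite_all_edges] expct_superset_prob[OF finite_all_edges])
    qed
    then have "(\<Sum>V\<in>\<V>. \<Sum>S\<in>\<S> V. p ^ card (attachment_edges V S)) = (\<Sum>V\<in>\<V>. \<Sum>S\<in>\<S> V.
        measure_pmf.prob (rset (all_edges n) p) {E. attachment_edges V S \<subseteq> E})"
      by (intro sum.cong refl) simp
    also have "\<dots> = (\<Sum>(V,S)\<in>Sigma \<V> \<S>. measure_pmf.prob (rset (all_edges n) p) {E. attachment_edges V S \<subseteq> E})"
      using fin\<V> fin\<S>(1) by (intro sum.Sigma) auto
    finally show ?thesis by simp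
  qed
  also have "\<dots> \<le> (\<Sum>V\<in>\<V>. x powr s)"
  proof (intro sum_mono)
    fix V assume V: "V \<in> \<V>"
    have "(\<Sum>S\<in>\<S> V. p ^ card (attachment_edges V S)) \<le> (\<Sum>S\<in>\<S> V. (p powr \<kappa>) ^ card V)"
    proof (intro sum_mono)
      fix S assume S: "S \<in> \<S> V"
      then have "p ^ card (attachment_edges V S) = p powr (real (\<Sum>v\<in>V. card (S v)))"
        using card_attachment_edges[of n R V S] p unfolding \<S>_def by (simp add: powr_realpow del: of_nat_sum)
      also have "\<dots> \<le> p powr (\<kappa> * real (card V))"
        using S p unfolding \<S>_def by (intro powr_mono') auto
      also have "\<dots> = (p powr \<kappa>) ^ card V" using p by (simp add: powr_powr[symmetric] powr_realpow)
      finally show "p ^ card (attachment_edges V S) \<le> (p powr \<kappa>) ^ card V" .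
    qed
    also have "\<dots> \<le> (real n * 2 ^ R) ^ card V * (p powr \<kappa>) ^ card V"
    proof -
      have "real (card (\<S> V)) \<le> real ((n * 2 ^ R) ^ card V)" using fin\<S>(2)[OF V] by (rule of_nat_mono)
      then have "real (card (\<S> V)) \<le> (real n * 2 ^ R) ^ card V" by simp
      then show ?thesis by (simp add: mult_right_mono)
    qed
    also have "\<dots> = x powr real (card V)" using x0 unfolding x_def by (simp add: powr_realpow power_mult_distrib)
    also have "\<dots> \<le> x powr s" using V x0 x unfolding \<V>_def by (intro powr_mono') auto
    finally show "(\<Sum>S\<in>\<S> V. p ^ card (attachment_edges V S)) \<le> x powr s" .
  qed
  also have "\<dots> = card \<V> * x powr s" by simp
  also have "\<dots> \<le> 2 ^ n * x powr s"
  proof -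
    have "card \<V> \<le> card (Pow {..<n})" unfolding \<V>_def by (intro card_mono) auto
    then have "card \<V> \<le> 2 ^ n" by (simp add: card_Pow)
    then have "real (card \<V>) \<le> real (2 ^ n)" by (rule of_nat_mono)
    then show ?thesis by (intro mult_right_mono) auto
  qed
  finally show ?thesis .
qed

section \<open>Dense attachments inside chordal graphs\<close>

text \<open>\<open>S v\<close> stands for the earlier neighbours of \<open>v\<close> in the rank
  \<open>r\<close>, and \<open>f v\<close> for the latest of them, the parent.\<close>

definition elimination :: "nat \<Rightarrow> nat set set \<Rightarrow> (nat \<Rightarrow> nat set) \<Rightarrow> (nat \<Rightarrow> nat) \<Rightarrow> (nat \<Rightarrow> nat) \<Rightarrow> bool" where
  "elimination n F S r f \<longleftrightarrow> (\<forall>v. S v \<subseteq> {..<n}) \<and>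
     (\<forall>v. \<forall>u\<in>S v. {v, u} \<in> F \<and> r u < r v) \<and>
     (\<forall>v. \<forall>u\<in>S v. \<forall>w\<in>S v. u \<noteq> w \<longrightarrow> {u, w} \<in> F) \<and>
     (\<forall>v. S v \<noteq> {} \<longrightarrow> v < n \<and> f v \<in> S v \<and> S v \<subseteq> insert (f v) (S (f v))) \<and>
     card F = (\<Sum>v<n. card (S v))"

lemma eliminationD:
  assumes "elimination n F S r f"
  shows "\<And>v. S v \<subseteq> {..<n}" "\<And>u v. u \<in> S v \<Longrightarrow> {v, u} \<in> F \<and> r u < r v"
    "\<And>u v w. u \<in> S v \<Longrightarrow> w \<in> S v \<Longrightarrow> u \<noteq> w \<Longrightarrow> {u, w} \<in> F"
    "\<And>v. S v \<noteq> {} \<Longrightarrow> v < n \<and> f v \<in> S v \<and> S v \<subseteq> insert (f v) (S (f v))"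
    "card F = (\<Sum>v<n. card (S v))"
  using assms unfolding elimination_def by blast+

lemma chordal_elimination:
  assumes F: "F \<subseteq> all_edges n" "chordal F"
  shows "\<exists>S r f. elimination n F S r f"
proof -
  have irr: "\<not> adj F x x" for x using F(1) unfolding adj_def all_edges_def by auto
  obtain r :: "nat \<Rightarrow> nat" where inj: "inj_on r {..<n}" and r: "\<forall>v\<in>{..<n}. \<forall>x\<in>{..<n}. \<forall>y\<in>{..<n}.
      adj F v x \<and> adj F v y \<and> x \<noteq> y \<and> r x < r v \<and> r y < r v \<longrightarrow> adj F x y"
    using chordal_elimination_rank[OF F(2) irr, of "{..<n}"] by blast
  define S where "S v = {u. {v, u} \<in> F \<and> r u < r v}" for v
  define f where "f v = (ARG_MAX r u. u \<in> S v)" for v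
  have bd: "v < n \<and> u < n" if "{v, u} \<in> F" for u v
    using that F(1) unfolding all_edges_def by (auto simp: doubleton_eq_iff)
  have S1: "S v \<subseteq> {..<n}" for v unfolding S_def using bd by blast
  have S3: "{u, w} \<in> F" if "u \<in> S v" "w \<in> S v" "u \<noteq> w" for u v w
    using that r bd[of v u] bd[of v w] unfolding S_def adj_def by blast
  have f: "f v \<in> S v" "\<And>u. u \<in> S v \<Longrightarrow> r u \<le> r (f v)" if ne: "S v \<noteq> {}" for v
  proof -
    obtain u where "u \<in> S v" using ne by blast
    moreover have "\<forall>y. y \<in> S v \<longrightarrow> r y < r v" unfolding S_def by blast
    ultimately show "f v \<in> S v" "\<And>u. u \<in> S v \<Longrightarrow> r u \<le> r (f v)"
      using arg_max_nat_lemma[of "\<lambda>u. u \<in> S v" u r "r v"] unfolding f_def by blast+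
  qed
  \<comment> \<open>The earlier neighbours of \<open>v\<close> are pairwise adjacent and ranks are
    distinct, so all of them except \<open>f v\<close> are earlier neighbours of
    \<open>f v\<close>.\<close>
  have S4: "S v \<subseteq> insert (f v) (S (f v))" if ne: "S v \<noteq> {}" for v
  proof
    fix u assume u: "u \<in> S v"
    show "u \<in> insert (f v) (S (f v))"
    proof (cases "u = f v")
      case False
      have e: "{f v, u} \<in> F" using S3[OF f(1)[OF ne] u] False by blast
      have "r u \<noteq> r (f v)" using inj False bd[OF e] unfolding inj_on_def by blast
      then have "r u < r (f v)" using f(2)[OF ne u] by linarith
      then show ?thesis using e unfolding S_def by blast
    qed simp
  qed
  have "F = (\<Union>v\<in>{..<n}. (\<lambda>u. {v, u}) ` S v)"
  proof (intro equalityI subsetI)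
    fix e assume e: "e \<in> F"
    then obtain u v where uv: "e = {u, v}" "u < n" "v < n" "u \<noteq> v" using F(1) unfolding all_edges_def by blast
    then have "r u \<noteq> r v" using inj unfolding inj_on_def by blast
    then have "v \<in> S u \<or> u \<in> S v" using e unfolding S_def uv(1) by (auto simp: insert_commute)
    then show "e \<in> (\<Union>v\<in>{..<n}. (\<lambda>u. {v, u}) ` S v)" using uv by (auto simp: insert_commute)
  next
    fix e assume "e \<in> (\<Union>v\<in>{..<n}. (\<lambda>u. {v, u}) ` S v)"
    then show "e \<in> F" unfolding S_def by auto
  qed
  moreover have "card (\<Union>v\<in>{..<n}. (\<lambda>u. {v, u}) ` S v) = (\<Sum>v<n. card (S v))"
  proof (rule card_ranked_edges)
    show "finite (S v)" for v using finite_subset[OF S1] by simp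
    show "r u < r v" if "u \<in> S v" for u v using that unfolding S_def by simp
  qed simp
  ultimately have S5: "card F = (\<Sum>v<n. card (S v))" by simp
  have S6: "v < n" if ne: "S v \<noteq> {}" for v
  proof -
    have "{v, f v} \<in> F" using f(1)[OF ne] unfolding S_def by blast
    then show ?thesis using bd by blast
  qed
  have "elimination n F S r f"
    unfolding elimination_def
  proof (intro conjI allI ballI impI)
    fix v u assume "u \<in> S v"
    then show "{v, u} \<in> F" "r u < r v" unfolding S_def by blast+
  qed (fact S1 S3 S4 S5 S6 f(1))+
  then show ?thesis by blast
qed

definition has_clique :: "nat \<Rightarrow> nat \<Rightarrow> nat set set \<Rightarrow> bool" where
  "has_clique n q E \<longleftrightarrow> (\<exists>K\<subseteq>{..<n}. card K = q \<and> {e. e \<subseteq> K \<and> card e = 2} \<subseteq> E)"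

text \<open>A vertex and its earlier neighbours form a clique, so excluding cliques of size R bounds
  every \<open>card (S v)\<close>, as attachments demand.\<close>

lemma clique_if_attached:
  assumes "S \<subseteq> {..<n}" "v < n" "\<And>u. u \<in> S \<Longrightarrow> {v, u} \<in> F \<and> u \<noteq> v"
    and "\<And>u w. u \<in> S \<Longrightarrow> w \<in> S \<Longrightarrow> u \<noteq> w \<Longrightarrow> {u, w} \<in> F" and "q \<le> Suc (card S)"
  shows "has_clique n q F"
proof -
  have fin: "finite S" using assms(1) finite_subset by blast
  have "q \<le> card (insert v S)" using assms(3,5) fin by (subst card_insert_disjoint) auto
  then obtain K where K: "K \<subseteq> insert v S" "card K = q" using obtain_subset_with_card_n by metis
  have "{e. e \<subseteq> K \<and> card e = 2} \<subseteq> F"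
  proof
    fix e assume "e \<in> {e. e \<subseteq> K \<and> card e = 2}"
    then obtain x y where e: "e = {x, y}" "x \<noteq> y" "x \<in> insert v S" "y \<in> insert v S"
      using K(1) by (auto simp: card_2_iff)
    then consider "x = v" "y \<in> S" | "y = v" "x \<in> S" | "x \<in> S" "y \<in> S" by blast
    then show "e \<in> F"
    proof cases
      case 1 then show ?thesis using assms(3)[of y] e(1) by simp
    next
      case 2 then show ?thesis using assms(3)[of x] e(1) by (simp add: insert_commute)
    next
      case 3 then show ?thesis using assms(4)[of x y] e(1,2) by simp
    qed
  qed
  then show ?thesis unfolding has_clique_def using K assms(1,2) by blast
qed

text \<open>Emptying \<open>S\<close> outside \<open>V\<close> is harmless: a vertex with several
  earlier neighbours keeps its parent in \<open>V\<close>, and one with a single earlier neighbour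
  asks nothing of the set at its parent.\<close>

lemma restricted_attachment:
  assumes S: "\<And>v. S v \<subseteq> {..<n}" "\<And>u v. u \<in> S v \<Longrightarrow> {v, u} \<in> F \<and> (r u :: nat) < r v"
    "\<And>v. S v \<noteq> {} \<Longrightarrow> v < n \<and> f v \<in> S v \<and> S v \<subseteq> insert (f v) (S (f v))"
    and R: "\<And>v. card (S v) \<le> R"
    and V: "V \<subseteq> {v. S v \<noteq> {}}" "\<And>v. v \<in> V \<Longrightarrow> card (S v) \<noteq> 1 \<Longrightarrow> f v \<in> V"
    and d: "s \<le> real (card V)" "\<kappa> * real (card V) \<le> real (\<Sum>v\<in>V. card (S v))"
  shows "dense_attachment n R \<kappa> s F"
proof -
  define S' where "S' v = (if v \<in> V then S v else {})" for v
  have ex: "\<exists>f\<in>S' v. S' v \<subseteq> insert f (S' f)" if v: "v \<in> V" for v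
  proof (cases "card (S v) = 1")
    case True
    then obtain u where "S v = {u}" using card_1_singletonE by blast
    then show ?thesis unfolding S'_def using v by auto
  next
    case False
    then have "f v \<in> V" using V v by blast
    then show ?thesis using S(3)[of v] V(1) v unfolding S'_def by auto
  qed
  have "attachment n R V S'"
    unfolding attachment_def
  proof (intro conjI ballI)
    show "V \<subseteq> {..<n}"
    proof
      fix v assume "v \<in> V"
      then show "v \<in> {..<n}" using V(1) S(3)[of v] by blast
    qed
    show "\<exists>r::nat \<Rightarrow> nat. \<forall>v\<in>V. \<forall>u\<in>S' v. r u < r v"
      using S(2) unfolding S'_def by (intro exI[of _ r]) simp
  qed (use S(1) R ex in \<open>auto simp: S'_def\<close>)
  moreover have "attachment_edges V S' \<subseteq> F"
    unfolding attachment_edges_def S'_def using S(2) by auto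
  moreover have "(\<Sum>v\<in>V. card (S' v)) = (\<Sum>v\<in>V. card (S v))"
    unfolding S'_def by simp
  ultimately show ?thesis unfolding dense_attachment_def using d by metis
qed

text \<open>Here \<open>V\<close> consists of all vertices with an earlier neighbour. As each has at
  most R of them, \<kappa> n edges need at least \<kappa> n / R such vertices.\<close>

lemma chordal_dense_attachment:
  fixes \<kappa> :: real
  assumes F: "F \<subseteq> all_edges n" "chordal F" and cl: "\<not> has_clique n R F"
    and dense: "\<kappa> * real n \<le> real (card F)" and \<kappa>: "0 \<le> \<kappa>" and R: "0 < R"
  shows "dense_attachment n R \<kappa> (\<kappa> / real R * real n) F"
proof -
  obtain S r f where "elimination n F S r f" using chordal_elimination[OF F] by blast
  note S = eliminationD[OF this]
  have cR: "card (S v) \<le> R" for v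
  proof (rule ccontr)
    assume a: "\<not> card (S v) \<le> R"
    then have "v < n" using S(4)[of v] by (cases "S v = {}") auto
    then have "has_clique n R F"
    proof (rule clique_if_attached[OF S(1)])
      show "{v, u} \<in> F \<and> u \<noteq> v" if "u \<in> S v" for u using S(2)[OF that] by auto
      show "R \<le> Suc (card (S v))" using a by simp
    qed (rule S(3))
    then show False using cl by blast
  qed
  define V where "V = {v. S v \<noteq> {}}"
  have V: "V \<subseteq> {..<n}"
  proof
    fix v assume "v \<in> V"
    then show "v \<in> {..<n}" using S(4)[of v] unfolding V_def by simp
  qed
  then have finV: "finite V" and cV: "card V \<le> n" using finite_subset card_mono[of "{..<n}" V] by auto
  have sum: "card F = (\<Sum>v\<in>V. card (S v))"
    unfolding S(5) using V by (intro sum.mono_neutral_right) (auto simp: V_def)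
  have "card F \<le> R * card V"
    unfolding sum using sum_bounded_above[of V "\<lambda>v. card (S v)" R] cR by (simp add: mult.commute)
  then have "real (card F) \<le> real R * real (card V)" by (metis of_nat_le_iff of_nat_mult)
  then have "\<kappa> * real n \<le> real R * real (card V)" using dense by linarith
  then have 1: "\<kappa> / real R * real n \<le> real (card V)" using R by (simp add: field_simps)
  have "\<kappa> * real (card V) \<le> \<kappa> * real n" using cV \<kappa> by (intro mult_left_mono) auto
  then have 2: "\<kappa> * real (card V) \<le> real (\<Sum>v\<in>V. card (S v))" using dense sum by linarith
  have cl: "f v \<in> V" if v: "v \<in> V" "card (S v) \<noteq> 1" for v
  proof -
    have fv: "f v \<in> S v" "S v \<subseteq> insert (f v) (S (f v))" using S(4)[of v] v unfolding V_def by blast+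
    have "S v \<noteq> {f v}" using v by auto
    then show ?thesis using fv unfolding V_def by blast
  qed
  show ?thesis
    by (rule restricted_attachment[OF S(1) S(2) S(4) cR _ cl 1 2]) (auto simp: V_def)
qed

text \<open>A class with s vertices and e edges has e \<ge> 2 s - 1. If its density is below
  \<kappa> = 2 - 1 / (k + 2), then 2 s - 1 \<le> e < 2 s - s / (k + 2), so s \<le> k + 1 and e = 2 s
  - 1, a density of 2 - 1 / s \<le> 2 - 1 / (k + 1). Such classes hold at most (2 - 1 / (k + 1)) n
  edges, which leaves \<epsilon> n edges, and hence \<epsilon> n / R vertices, to the union
  \<open>V'\<close> of the denser ones. The value 1 / \<kappa> = (2 + k) / (3 + 2 k) is the
  threshold next below (1 + k) / (1 + 2 k).\<close>

lemma chordal_dense_attachment_sparse: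
  fixes k :: nat and \<epsilon> :: real
  assumes F: "F \<subseteq> all_edges n" "chordal F" and cl: "\<not> has_clique n R F" and R: "0 < R"
    and dense: "(2 - 1 / (real k + 1) + \<epsilon>) * real n \<le> real (card F)"
  shows "dense_attachment n R (2 - 1 / (real k + 2)) (\<epsilon> / real R * real n) F"
proof -
  obtain S r f where "elimination n F S r f" using chordal_elimination[OF F] by blast
  note S = eliminationD[OF this]
  have finS: "finite (S v)" for v using S(1) finite_subset by blast
  have cR: "card (S v) \<le> R" for v
  proof (rule ccontr)
    assume a: "\<not> card (S v) \<le> R"
    then have "v < n" using S(4)[of v] by (cases "S v = {}") auto
    then have "has_clique n R F"
    proof (rule clique_if_attached[OF S(1)])
      show "{v, u} \<in> F \<and> u \<noteq> v" if "u \<in> S v" for u using S(2)[OF that] by auto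
      show "R \<le> Suc (card (S v))" using a by simp
    qed (rule S(3))
    then show False using cl by blast
  qed
  define V where "V = {v. S v \<noteq> {}}"
  have V: "V \<subseteq> {..<n}"
  proof
    fix v assume "v \<in> V"
    then show "v \<in> {..<n}" using S(4)[of v] unfolding V_def by simp
  qed
  then have finV: "finite V" and cV: "card V \<le> n" using finite_subset card_mono[of "{..<n}" V] by auto
  have sum: "card F = (\<Sum>v\<in>V. card (S v))"
    unfolding S(5) using V by (intro sum.mono_neutral_right) (auto simp: V_def)
  have fV: "f v \<in> V" if v: "v \<in> V" "card (S v) \<noteq> 1" for v
  proof -
    have fv: "f v \<in> S v" "S v \<subseteq> insert (f v) (S (f v))" using S(4)[of v] v unfolding V_def by blast+
    have "S v \<noteq> {f v}" using v by auto
    then show ?thesis using fv unfolding V_def by blast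
  qed
  \<comment> \<open>A vertex with a single earlier neighbour opens a new class, all others join the class of their parent.
    The classes are the blocks of F minus one vertex; a class of size s carries at least 2s - 1 edges.\<close>
  define b where "b v = (f ^^ (LEAST k. card (S ((f ^^ k) v)) = 1)) v" for v
  have ex: "\<exists>k. card (S ((f ^^ k) v)) = 1" if "v \<in> V" for v
    using that
  proof (induction v rule: measure_induct_rule[where f=r])
    case (less v)
    show ?case
    proof (cases "card (S v) = 1")
      case True then show ?thesis by (intro exI[of _ 0]) simp
    next
      case False
      have "f v \<in> S v" using S(4)[of v] less.prems unfolding V_def by simp
      then have "r (f v) < r v" using S(2) by simp
      from less.IH[OF this fV[OF less.prems False]]
      obtain k where "card (S ((f ^^ k) (f v))) = 1" by blast
      then show ?thesis by (intro exI[of _ "Suc k"]) (simp add: funpow_swap1)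
    qed
  qed
  have b1: "b v = v" if "card (S v) = 1" for v
  proof -
    have "(LEAST k. card (S ((f ^^ k) v)) = 1) = 0" using that by (intro Least_eq_0) simp
    then show ?thesis unfolding b_def by simp
  qed
  have b2: "b v = b (f v)" if v: "v \<in> V" "card (S v) \<noteq> 1" for v
  proof -
    obtain k where k: "card (S ((f ^^ k) v)) = 1" using ex v by blast
    have "(LEAST k. card (S ((f ^^ k) v)) = 1) = Suc (LEAST k. card (S ((f ^^ Suc k) v)) = 1)"
      using Least_Suc[of "\<lambda>k. card (S ((f ^^ k) v)) = 1" k] k v by simp
    then show ?thesis unfolding b_def by (simp add: funpow_swap1)
  qed
  define C where "C c = {v\<in>V. b v = c}" for c
  define e where "e c = (\<Sum>v\<in>C c. card (S v))" for c
  have finC: "finite (C c)" for c unfolding C_def using finV by simp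
  have eC: "2 * card (C c) \<le> e c + 1" for c
  \<comment> \<open>Only the opener \<open>c\<close> can have a single earlier neighbour; every
    other member counts at least 2.\<close>
  proof -
    define D where "D = C c - {c}"
    have "card (C c) \<le> card D + 1" unfolding D_def using finC[of c] by (auto simp: card_Diff_singleton_if)
    moreover have ge: "1 \<le> card (S v)" if "v \<in> V" for v
      using that finS unfolding V_def by (simp add: Suc_leI card_gt_0_iff)
    have "(\<Sum>v\<in>D. 2) \<le> (\<Sum>v\<in>D. card (S v))"
    proof (rule sum_mono)
      fix v assume "v \<in> D"
      then have v: "v \<in> V" "b v = c" "v \<noteq> c" unfolding D_def C_def by auto
      then have "card (S v) \<noteq> 1" using b1[of v] by metis
      then show "2 \<le> card (S v)" using ge[OF v(1)] by linarith
    qed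
    then have "2 * card D \<le> (\<Sum>v\<in>D. card (S v))" by simp
    moreover have "c \<in> C c \<Longrightarrow> e c = card (S c) + (\<Sum>v\<in>D. card (S v)) \<and> 1 \<le> card (S c)"
      unfolding e_def D_def using finC ge by (auto simp: sum.remove C_def)
    moreover have "c \<notin> C c \<Longrightarrow> D = C c" unfolding D_def by blast
    ultimately show ?thesis unfolding e_def
      by (cases "c \<in> C c") (use finC in \<open>auto simp: D_def card_Diff_singleton_if e_def\<close>)
  qed
  define \<kappa> where "\<kappa> = 2 - 1 / (real k + 2)"
  define \<B> where "\<B> = {c \<in> b ` V. \<kappa> * real (card (C c)) \<le> real (e c)}"
  have small: "real (e c) \<le> (2 - 1 / (real k + 1)) * real (card (C c))" if "c \<in> b ` V - \<B>" for c
  proof -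
    let ?s = "card (C c)"
    have lt: "real (e c) < \<kappa> * real ?s" using that unfolding \<B>_def by auto
    have s0: "0 < ?s" using that finC unfolding C_def by (auto simp: card_gt_0_iff)
    have "2 * real ?s \<le> real (e c) + 1" using eC[of c] by linarith
    moreover have \<kappa>s: "\<kappa> * real ?s = 2 * real ?s - real ?s / (real k + 2)" unfolding \<kappa>_def by (simp add: algebra_simps)
    ultimately have "real ?s / (real k + 2) < 1" using lt by linarith
    then have "real ?s < real (k + 2)" by simp
    then have "?s \<le> k + 1" by (simp only: of_nat_less_iff)
    then have "real ?s \<le> real (k + 1)" by (rule of_nat_mono)
    then have sk: "real ?s \<le> real k + 1" by simp
    have "0 \<le> real ?s / (real k + 2)" by simp
    then have "real (e c) < real (2 * ?s)" using lt \<kappa>s by linarith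
    then have "e c < 2 * ?s" by (simp only: of_nat_less_iff)
    then have "e c + 1 \<le> 2 * ?s" by linarith
    then have "real (e c) \<le> 2 * real ?s - 1" by linarith
    also have "\<dots> \<le> 2 * real ?s - real ?s / (real k + 1)" using sk by simp
    finally show ?thesis by (simp add: algebra_simps)
  qed
  define V' where "V' = {v\<in>V. b v \<in> \<B>}"
  have sum_classes: "(\<Sum>v\<in>{v\<in>V. b v \<in> A}. g v) = (\<Sum>c\<in>A. \<Sum>v\<in>C c. g v)" if "A \<subseteq> b ` V"
    for g :: "nat \<Rightarrow> real" and A
  proof -
    have "finite A" using that finV finite_subset by blast
    then have "(\<Sum>v\<in>{v\<in>V. b v \<in> A}. g v) = (\<Sum>c\<in>A. \<Sum>v\<in>{v\<in>{v\<in>V. b v \<in> A}. b v = c}. g v)"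
      using finV by (intro sum.group[symmetric]) auto
    also have "\<dots> = (\<Sum>c\<in>A. \<Sum>v\<in>C c. g v)"
      unfolding C_def by (intro sum.cong refl) auto
    finally show ?thesis .
  qed
  have VV': "V - V' = {v\<in>V. b v \<in> b ` V - \<B>}" unfolding V'_def by auto
  have 2: "\<kappa> * real (card V') \<le> real (\<Sum>v\<in>V'. card (S v))"
  proof -
    have B: "\<B> \<subseteq> b ` V" unfolding \<B>_def by blast
    have "\<kappa> * real (card V') = (\<Sum>c\<in>\<B>. \<kappa> * real (card (C c)))"
      using sum_classes[OF B, of "\<lambda>_. 1"] unfolding V'_def by (simp add: sum_distrib_left)
    also have "\<dots> \<le> (\<Sum>c\<in>\<B>. real (e c))" unfolding \<B>_def by (intro sum_mono) auto
    also have "\<dots> = real (\<Sum>v\<in>V'. card (S v))"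
      using sum_classes[OF B, of "\<lambda>v. real (card (S v))"] unfolding V'_def e_def by simp
    finally show ?thesis .
  qed
  have "real (\<Sum>v\<in>V-V'. card (S v)) \<le> (2 - 1 / (real k + 1)) * real n"
  proof -
    have "real (\<Sum>v\<in>V-V'. card (S v)) = (\<Sum>c\<in>b ` V - \<B>. real (e c))"
      using sum_classes[of "b ` V - \<B>" "\<lambda>v. real (card (S v))"] unfolding VV' e_def by simp
    also have "\<dots> \<le> (\<Sum>c\<in>b ` V - \<B>. (2 - 1 / (real k + 1)) * real (card (C c)))"
      using small by (intro sum_mono)
    also have "\<dots> = (2 - 1 / (real k + 1)) * real (card (V - V'))"
      using sum_classes[of "b ` V - \<B>" "\<lambda>_. 1"] unfolding VV' by (simp add: sum_distrib_left)
    also have "\<dots> \<le> (2 - 1 / (real k + 1)) * real n"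
    proof (intro mult_left_mono)
      show "real (card (V - V')) \<le> real n" using cV card_mono[OF finV, of "V - V'"] by auto
      have "1 / (real k + 1) \<le> 1" by simp
      then show "0 \<le> 2 - 1 / (real k + 1)" by linarith
    qed
    finally show ?thesis .
  qed
  moreover have "card F = (\<Sum>v\<in>V-V'. card (S v)) + (\<Sum>v\<in>V'. card (S v))"
    unfolding sum using finV by (intro sum.subset_diff) (auto simp: V'_def)
  ultimately have "\<epsilon> * real n \<le> real (\<Sum>v\<in>V'. card (S v))" using dense by (simp add: algebra_simps)
  also have "\<dots> \<le> real (R * card V')"
    using sum_bounded_above[of V' "\<lambda>v. card (S v)" R] cR by (simp only: of_nat_le_iff) (simp add: mult.commute)
  finally have 1: "\<epsilon> / real R * real n \<le> real (card V')" using R by (simp add: field_simps)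
  \<comment> \<open>A vertex that opens no class shares the class of its parent, so a union of
    classes contains the parents it needs.\<close>
  have closed: "f v \<in> V'" if "v \<in> V'" "card (S v) \<noteq> 1" for v
    using that b2[of v] fV[of v] unfolding V'_def by simp
  show ?thesis
    unfolding \<kappa>_def[symmetric]
    by (rule restricted_attachment[OF S(1) S(2) S(4) cR _ closed 1 2]) (auto simp: V'_def V_def)
qed

section \<open>Packing partite copies of a pattern\<close>

text \<open>This is e(T), the number of pattern edges inside T, counted at their later ends.\<close>

definition back_edges :: "(nat \<Rightarrow> nat set) \<Rightarrow> nat set \<Rightarrow> nat" where
  "back_edges S T = (\<Sum>t\<in>T. card (S t \<inter> T))"

definition copy_edges :: "nat \<Rightarrow> (nat \<Rightarrow> nat set) \<Rightarrow> (nat \<Rightarrow> nat) \<Rightarrow> nat set set" where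
  "copy_edges N S \<phi> = (\<Union>t\<le>N. (\<lambda>s. {\<phi> t, \<phi> s}) ` S t)"

definition level :: "nat \<Rightarrow> (nat \<Rightarrow> nat) \<Rightarrow> nat \<Rightarrow> nat set" where
  "level n lev t = {x. x < n \<and> lev x = t}"

text \<open>The quantifier over W makes this one event that serves all rounds of a greedy choice.
  Sending vertex t of the pattern into level t makes copies injective and lets \<open>lev\<close>
  act as an elimination rank on a union of copies.\<close>

definition partite_rich :: "nat \<Rightarrow> nat \<Rightarrow> (nat \<Rightarrow> nat set) \<Rightarrow> (nat \<Rightarrow> nat) \<Rightarrow> nat \<Rightarrow> nat set set \<Rightarrow> bool" where
  "partite_rich n N S lev m E \<longleftrightarrow> (\<forall>W\<subseteq>{..<n}. (\<forall>t\<le>N. m \<le> card (W \<inter> level n lev t)) \<longrightarrow>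
     (\<exists>\<phi>. (\<forall>t\<le>N. \<phi> t \<in> W \<inter> level n lev t) \<and> copy_edges N S \<phi> \<subseteq> E))"

lemma doubleton_lev:
  fixes lev :: "'a \<Rightarrow> nat"
  assumes "{a, b} = {c, d}" "lev b < lev a" "lev d < lev c"
  shows "a = c" "b = d"
  using assms by (auto simp: doubleton_eq_iff)

text \<open>Each copy takes one vertex from each of the levels 1 to N, so before L - m copies are
  reached every level still has m free vertices. Level 0 is never depleted, which permits copies to
  share roots.\<close>

lemma disjoint_copies_exist:
  assumes rich: "partite_rich n N S lev m E" and N: "1 \<le> N"
    and L: "\<And>t. t \<in> {1..N} \<Longrightarrow> card (level n lev t) = L" and L0: "m \<le> card (level n lev 0)"
  shows "c \<le> L - m \<Longrightarrow> \<exists>\<Phi>. finite \<Phi> \<and> card \<Phi> = c \<and>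
    (\<forall>\<phi>\<in>\<Phi>. (\<forall>t\<le>N. \<phi> t \<in> level n lev t) \<and> copy_edges N S \<phi> \<subseteq> E) \<and>
    (\<forall>\<phi>\<in>\<Phi>. \<forall>\<psi>\<in>\<Phi>. \<forall>t\<in>{1..N}. \<phi> t = \<psi> t \<longrightarrow> \<phi> = \<psi>)"
proof (induction c)
  case 0
  show ?case by (rule exI[of _ "{}"]) simp
next
  case (Suc c)
  then obtain \<Phi> where \<Phi>: "finite \<Phi>" "card \<Phi> = c"
    "\<forall>\<phi>\<in>\<Phi>. (\<forall>t\<le>N. \<phi> t \<in> level n lev t) \<and> copy_edges N S \<phi> \<subseteq> E"
    "\<forall>\<phi>\<in>\<Phi>. \<forall>\<psi>\<in>\<Phi>. \<forall>t\<in>{1..N}. \<phi> t = \<psi> t \<longrightarrow> \<phi> = \<psi>" by auto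
  define W where "W = {..<n} - {\<phi> t |\<phi> t. \<phi> \<in> \<Phi> \<and> t \<in> {1..N}}"
  have "m \<le> card (W \<inter> level n lev t)" if t: "t \<le> N" for t
  proof (cases "t = 0")
    case True
    have "W \<inter> level n lev 0 = level n lev 0"
      using \<Phi>(3) unfolding W_def level_def by auto
    then show ?thesis using True L0 by simp
  next
    case False
    have fin: "finite (level n lev t)" unfolding level_def by simp
    have "level n lev t - (\<lambda>\<phi>. \<phi> t) ` \<Phi> \<subseteq> W \<inter> level n lev t"
      using \<Phi>(3) unfolding W_def level_def by auto
    then have "card (level n lev t - (\<lambda>\<phi>. \<phi> t) ` \<Phi>) \<le> card (W \<inter> level n lev t)"
      using fin by (intro card_mono) auto
    moreover have "card (level n lev t) - card ((\<lambda>\<phi>. \<phi> t) ` \<Phi>) \<le> card (level n lev t - (\<lambda>\<phi>. \<phi> t) ` \<Phi>)"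
      using \<Phi>(1) by (intro diff_card_le_card_Diff) simp
    moreover have "card ((\<lambda>\<phi>. \<phi> t) ` \<Phi>) \<le> c" using card_image_le[OF \<Phi>(1)] \<Phi>(2) by simp
    moreover have "card (level n lev t) = L" using L t False by simp
    ultimately show ?thesis using Suc.prems by linarith
  qed
  moreover have "W \<subseteq> {..<n}" unfolding W_def by blast
  ultimately obtain \<phi> where \<phi>: "\<forall>t\<le>N. \<phi> t \<in> W \<inter> level n lev t" "copy_edges N S \<phi> \<subseteq> E"
    using rich unfolding partite_rich_def by metis
  have new: "\<phi> t \<noteq> \<psi> t" if "\<psi> \<in> \<Phi>" "t \<in> {1..N}" for \<psi> t
  proof
    assume "\<phi> t = \<psi> t"
    then have "\<phi> t \<notin> W" unfolding W_def using that by blast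
    then show False using \<phi>(1) that by simp
  qed
  have "\<phi> \<notin> \<Phi>" using new[of \<phi> 1] N by auto
  then have "card (insert \<phi> \<Phi>) = Suc c" using \<Phi> by simp
  moreover have "\<forall>\<alpha>\<in>insert \<phi> \<Phi>. \<forall>\<psi>\<in>insert \<phi> \<Phi>. \<forall>t\<in>{1..N}. \<alpha> t = \<psi> t \<longrightarrow> \<alpha> = \<psi>"
  proof (intro ballI impI)
    fix \<alpha> \<psi> t assume a: "\<alpha> \<in> insert \<phi> \<Phi>" "\<psi> \<in> insert \<phi> \<Phi>" "t \<in> {1..N}" "\<alpha> t = \<psi> t"
    show "\<alpha> = \<psi>"
    proof (cases "\<alpha> = \<phi>"; cases "\<psi> = \<phi>")
      assume "\<alpha> = \<phi>" "\<psi> \<noteq> \<phi>"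
      then show ?thesis using a new[of \<psi> t] by auto
    next
      assume "\<alpha> \<noteq> \<phi>" "\<psi> = \<phi>"
      then show ?thesis using a new[of \<alpha> t] by auto
    next
      assume "\<alpha> \<noteq> \<phi>" "\<psi> \<noteq> \<phi>"
      then show ?thesis using a \<Phi>(4) by blast
    qed simp
  qed
  ultimately show ?case
    using \<Phi>(1,3) \<phi> by (intro exI[of _ "insert \<phi> \<Phi>"]) simp
qed

text \<open>Copies meet only in level 0, where no vertex has earlier neighbours. Hence a vertex with
  earlier neighbours lies in a single copy, which contains them all, and there \<open>cl\<close>
  makes them pairwise adjacent.\<close>

lemma chordal_packing:
  assumes rich: "partite_rich n N S lev m E" and N: "1 \<le> N"
    and L: "\<And>t. t \<in> {1..N} \<Longrightarrow> card (level n lev t) = L" and L0: "m \<le> card (level n lev 0)"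
    and S: "\<And>t. S t \<subseteq> {..<t}" and cl: "\<And>t s s'. s \<in> S t \<Longrightarrow> s' \<in> S t \<Longrightarrow> s < s' \<Longrightarrow> s \<in> S s'"
  shows "\<exists>F\<subseteq>E. chordal F \<and> card F = (L - m) * (\<Sum>t\<le>N. card (S t))"
proof -
  obtain \<Phi> where \<Phi>: "finite \<Phi>" "card \<Phi> = L - m"
    "\<forall>\<phi>\<in>\<Phi>. (\<forall>t\<le>N. \<phi> t \<in> level n lev t) \<and> copy_edges N S \<phi> \<subseteq> E"
    "\<forall>\<phi>\<in>\<Phi>. \<forall>\<psi>\<in>\<Phi>. \<forall>t\<in>{1..N}. \<phi> t = \<psi> t \<longrightarrow> \<phi> = \<psi>"
    using disjoint_copies_exist[OF rich N L L0 order_refl] by auto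
  have lev: "lev (\<phi> t) = t" if "\<phi> \<in> \<Phi>" "t \<le> N" for \<phi> t
    using \<Phi>(3) that unfolding level_def by auto
  define G where "G x = (\<lambda>s. {fst x (snd x), fst x s}) ` S (snd x)" for x :: "(nat \<Rightarrow> nat) \<times> nat"
  define F where "F = (\<Union>x\<in>\<Phi> \<times> {..N}. G x)"
  have lt: "s < t" if "s \<in> S t" for s t using S that by blast
  have uniq: "\<phi> = \<psi> \<and> t = t'" if "\<phi> \<in> \<Phi>" "\<psi> \<in> \<Phi>" "t \<le> N" "t' \<le> N" "s \<in> S t" "\<phi> t = \<psi> t'" for \<phi> \<psi> t t' s
  proof -
    have "t = t'" using lev[OF that(1,3)] lev[OF that(2,4)] that(6) by simp
    moreover have "t \<in> {1..N}" using lt[OF that(5)] that(3) by simp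
    ultimately show ?thesis using \<Phi>(4) that by blast
  qed
  have memF: "\<exists>\<phi>\<in>\<Phi>. \<exists>t\<le>N. \<exists>s\<in>S t. e = {\<phi> t, \<phi> s}" if "e \<in> F" for e
  proof -
    obtain x s where "x \<in> \<Phi> \<times> {..N}" "s \<in> S (snd x)" "e = {fst x (snd x), fst x s}"
      using \<open>e \<in> F\<close> unfolding F_def G_def by blast
    then show ?thesis by (intro bexI[of _ "fst x"] exI[of _ "snd x"] conjI bexI[of _ s]) auto
  qed
  have repr: "\<exists>\<phi>\<in>\<Phi>. \<exists>t\<le>N. \<exists>s\<in>S t. v = \<phi> t \<and> x = \<phi> s" if "{v, x} \<in> F" "lev x < lev v" for v x
  proof -
    obtain \<phi> t s where *: "\<phi> \<in> \<Phi>" "t \<le> N" "s \<in> S t" "{v, x} = {\<phi> t, \<phi> s}"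
      using memF[OF \<open>{v, x} \<in> F\<close>] by blast
    have "lev (\<phi> s) < lev (\<phi> t)" using lev[OF *(1)] lt[OF *(3)] *(2) by simp
    from doubleton_lev[OF *(4) that(2) this] show ?thesis using * by blast
  qed
  have inF: "{\<phi> t, \<phi> s} \<in> F" if "\<phi> \<in> \<Phi>" "t \<le> N" "s \<in> S t" for \<phi> t s
    unfolding F_def G_def using that by (intro UN_I[of "(\<phi>, t)"]) auto
  have "F \<subseteq> E"
  proof
    fix e assume "e \<in> F"
    then obtain \<phi> t s where *: "\<phi> \<in> \<Phi>" "t \<le> N" "s \<in> S t" "e = {\<phi> t, \<phi> s}"
      using memF[of e] by blast
    then have "e \<in> copy_edges N S \<phi>" unfolding copy_edges_def by blast
    then show "e \<in> E" using \<Phi>(3) *(1) by blast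
  qed
  moreover have "chordal F"
  proof (rule chordal_if_elimination_rank[where r = lev])
    fix x y assume "adj F x y"
    then obtain \<phi> t s where *: "\<phi> \<in> \<Phi>" "t \<le> N" "s \<in> S t" "{x, y} = {\<phi> t, \<phi> s}"
      using memF[of "{x, y}"] unfolding adj_def by blast
    then have "lev (\<phi> t) \<noteq> lev (\<phi> s)" using lev[OF *(1)] lt[OF *(3)] by simp
    then show "lev x \<noteq> lev y" using *(4) by (auto simp: doubleton_eq_iff)
  next
    fix v x y assume a: "adj F v x" "adj F v y" "x \<noteq> y" "lev x < lev v" "lev y < lev v"
    obtain \<phi> t s where 1: "\<phi> \<in> \<Phi>" "t \<le> N" "s \<in> S t" "v = \<phi> t" "x = \<phi> s"
      using repr[of v x] a unfolding adj_def by blast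
    obtain \<psi> t' s' where 2: "\<psi> \<in> \<Phi>" "t' \<le> N" "s' \<in> S t'" "v = \<psi> t'" "y = \<psi> s'"
      using repr[of v y] a unfolding adj_def by blast
    have eq: "\<psi> = \<phi>" "t' = t" using uniq[OF 1(1) 2(1) 1(2) 2(2) 1(3)] 1(4) 2(4) by auto
    have "s \<noteq> s'" using a(3) 1(5) 2(5) eq by auto
    then consider "s < s'" | "s' < s" by linarith
    then show "adj F x y"
    proof cases
      case 1
      then have "s \<in> S s'" "s' \<le> N" using cl[of s t s'] \<open>s \<in> S t\<close> 2 eq lt[of s' t] by auto
      then have "{y, x} \<in> F" using inF[of \<phi> s' s] \<open>\<phi> \<in> \<Phi>\<close> \<open>x = \<phi> s\<close> 2(5) eq by simp
      then show ?thesis unfolding adj_def by (simp add: insert_commute)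
    next
      case 2
      then have "s' \<in> S s" "s \<le> N" using cl[of s' t s] 1(2,3) \<open>s' \<in> S t'\<close> eq lt[of s t] by auto
      then show ?thesis using inF[of \<phi> s s'] 1 \<open>y = \<psi> s'\<close> eq unfolding adj_def by simp
    qed
  qed
  moreover have "card F = (L - m) * (\<Sum>t\<le>N. card (S t))"
  proof -
    have "card F = (\<Sum>x\<in>\<Phi> \<times> {..N}. card (G x))"
      unfolding F_def
    proof (rule card_UN_disjoint)
      show "finite (\<Phi> \<times> {..N})" using \<Phi>(1) by simp
      show "\<forall>x\<in>\<Phi> \<times> {..N}. finite (G x)" unfolding G_def using S finite_subset by blast
      show "\<forall>x\<in>\<Phi> \<times> {..N}. \<forall>y\<in>\<Phi> \<times> {..N}. x \<noteq> y \<longrightarrow> G x \<inter> G y = {}"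
      proof (intro ballI impI, rule ccontr)
        fix x y assume xy: "x \<in> \<Phi> \<times> {..N}" "y \<in> \<Phi> \<times> {..N}" "x \<noteq> y" "G x \<inter> G y \<noteq> {}"
        obtain \<phi> t \<psi> t' where x: "x = (\<phi>, t)" "y = (\<psi>, t')" by (metis surj_pair)
        have m: "\<phi> \<in> \<Phi>" "\<psi> \<in> \<Phi>" "t \<le> N" "t' \<le> N" using xy unfolding x by auto
        obtain s s' where s: "s \<in> S t" "s' \<in> S t'" "{\<phi> t, \<phi> s} = {\<psi> t', \<psi> s'}"
          using xy(4) unfolding G_def x by auto
        have "lev (\<phi> s) < lev (\<phi> t)" "lev (\<psi> s') < lev (\<psi> t')"
          using lev m lt[OF s(1)] lt[OF s(2)] by simp_all
        then have "\<phi> t = \<psi> t'" using doubleton_lev[OF s(3)] by blast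
        then show False using uniq[OF m s(1)] xy(3) unfolding x by blast
      qed
    qed
    also have "\<dots> = (\<Sum>x\<in>\<Phi> \<times> {..N}. card (S (snd x)))"
    proof (intro sum.cong refl)
      fix x assume x: "x \<in> \<Phi> \<times> {..N}"
      have "inj_on (\<lambda>s. {fst x (snd x), fst x s}) (S (snd x))"
      proof (rule inj_onI)
        fix s s' assume s: "s \<in> S (snd x)" "s' \<in> S (snd x)" "{fst x (snd x), fst x s} = {fst x (snd x), fst x s'}"
        then have "fst x s = fst x s'" by (auto simp: doubleton_eq_iff)
        moreover have "lev (fst x s) = s" "lev (fst x s') = s'"
          using lt[OF s(1)] lt[OF s(2)] x by (auto intro!: lev)
        ultimately show "s = s'" by metis
      qed
      then show "card (G x) = card (S (snd x))" unfolding G_def by (rule card_image)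
    qed
    also have "\<dots> = (\<Sum>\<phi>\<in>\<Phi>. \<Sum>t\<le>N. card (S t))"
      unfolding sum.cartesian_product by (intro sum.cong) auto
    finally show ?thesis using \<Phi>(2) by simp
  qed
  ultimately show ?thesis by blast
qed

section \<open>The probability that large vertex sets contain no copy\<close>

lemma card_copy_edges:
  assumes S: "\<And>t. S t \<subseteq> {..<t}" and \<phi>: "\<And>t. t \<le> N \<Longrightarrow> lev (\<phi> t) = t"
  shows "card (copy_edges N S \<phi>) = back_edges S {..N}"
proof -
  have lt: "s < t" if "s \<in> S t" for s t using S that by blast
  have "card (copy_edges N S \<phi>) = (\<Sum>t\<le>N. card ((\<lambda>s. {\<phi> t, \<phi> s}) ` S t))"
    unfolding copy_edges_def
  proof (rule card_UN_disjoint)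
    show "\<forall>t\<in>{..N}. finite ((\<lambda>s. {\<phi> t, \<phi> s}) ` S t)" using S finite_subset by blast
    show "\<forall>t\<in>{..N}. \<forall>t'\<in>{..N}. t \<noteq> t' \<longrightarrow> (\<lambda>s. {\<phi> t, \<phi> s}) ` S t \<inter> (\<lambda>s. {\<phi> t', \<phi> s}) ` S t' = {}"
    proof (intro ballI impI, rule ccontr)
      fix t t' assume t: "t \<in> {..N}" "t' \<in> {..N}" "t \<noteq> t'"
        "(\<lambda>s. {\<phi> t, \<phi> s}) ` S t \<inter> (\<lambda>s. {\<phi> t', \<phi> s}) ` S t' \<noteq> {}"
      then obtain s s' where s: "s \<in> S t" "s' \<in> S t'" "{\<phi> t, \<phi> s} = {\<phi> t', \<phi> s'}" by auto
      have "lev (\<phi> s) < lev (\<phi> t)" "lev (\<phi> s') < lev (\<phi> t')"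
        using \<phi> t lt[OF s(1)] lt[OF s(2)] by simp_all
      then have "\<phi> t = \<phi> t'" using doubleton_lev[OF s(3)] by blast
      then show False using \<phi>[of t] \<phi>[of t'] t by simp
    qed
  qed simp
  also have "\<dots> = (\<Sum>t\<le>N. card (S t))"
  proof (intro sum.cong refl card_image inj_onI)
    fix t s s' assume s: "t \<in> {..N}" "s \<in> S t" "s' \<in> S t" "{\<phi> t, \<phi> s} = {\<phi> t, \<phi> s'}"
    then have "\<phi> s = \<phi> s'" by (auto simp: doubleton_eq_iff)
    moreover have "lev (\<phi> s) = s" "lev (\<phi> s') = s'"
      using lt[OF s(2)] lt[OF s(3)] s(1) by (auto intro!: \<phi>)
    ultimately show "s = s'" by metis
  qed
  also have "\<dots> = back_edges S {..N}"
    unfolding back_edges_def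
  proof (intro sum.cong refl)
    fix t assume "t \<in> {..N}"
    then have "S t \<inter> {..N} = S t" using S[of t] by auto
    then show "card (S t) = card (S t \<inter> {..N})" by simp
  qed
  finally show ?thesis .
qed

text \<open>Levels tell which pattern vertex an image belongs to, so a common edge joins two places
  where the copies agree.\<close>

lemma card_copy_edges_Int:
  assumes S: "\<And>t. S t \<subseteq> {..<t}" and \<phi>: "\<And>t. t \<le> N \<Longrightarrow> lev (\<phi> t) = t" and \<psi>: "\<And>t. t \<le> N \<Longrightarrow> lev (\<psi> t) = t"
  shows "card (copy_edges N S \<phi> \<inter> copy_edges N S \<psi>) \<le> back_edges S {t. t \<le> N \<and> \<phi> t = \<psi> t}"
proof -
  define T where "T = {t. t \<le> N \<and> \<phi> t = \<psi> t}"
  have fin: "finite T" "\<And>t. finite (S t)"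
    unfolding T_def using finite_subset[OF S] by simp_all
  have lt: "s < t" if "s \<in> S t" for s t using S that by blast
  have "copy_edges N S \<phi> \<inter> copy_edges N S \<psi> \<subseteq> (\<Union>t\<in>T. (\<lambda>s. {\<phi> t, \<phi> s}) ` (S t \<inter> T))"
  proof
    fix e assume e: "e \<in> copy_edges N S \<phi> \<inter> copy_edges N S \<psi>"
    obtain t s where 1: "t \<le> N" "s \<in> S t" "e = {\<phi> t, \<phi> s}" using e unfolding copy_edges_def by auto
    obtain t' s' where 2: "t' \<le> N" "s' \<in> S t'" "e = {\<psi> t', \<psi> s'}" using e unfolding copy_edges_def by auto
    have eq: "{\<phi> t, \<phi> s} = {\<psi> t', \<psi> s'}" using 1 2 by simp
    have l: "lev (\<phi> s) < lev (\<phi> t)" "lev (\<psi> s') < lev (\<psi> t')"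
      using \<phi> \<psi> 1 2 lt[OF 1(2)] lt[OF 2(2)] by simp_all
    have p: "\<phi> t = \<psi> t'" "\<phi> s = \<psi> s'" using doubleton_lev[OF eq l] by blast+
    have "t = t'" "s = s'"
      using p \<phi>[of t] \<psi>[of t'] \<phi>[of s] \<psi>[of s'] 1 2 lt[OF 1(2)] lt[OF 2(2)] by auto
    then have "t \<in> T" "s \<in> T" using p 1 lt[OF 1(2)] unfolding T_def by auto
    then show "e \<in> (\<Union>t\<in>T. (\<lambda>s. {\<phi> t, \<phi> s}) ` (S t \<inter> T))" using 1 by blast
  qed
  then have "card (copy_edges N S \<phi> \<inter> copy_edges N S \<psi>) \<le> card (\<Union>t\<in>T. (\<lambda>s. {\<phi> t, \<phi> s}) ` (S t \<inter> T))"
    using fin by (intro card_mono) auto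
  also have "\<dots> \<le> (\<Sum>t\<in>T. card ((\<lambda>s. {\<phi> t, \<phi> s}) ` (S t \<inter> T)))"
    by (rule card_UN_le[OF fin(1)])
  also have "\<dots> \<le> back_edges S T"
    unfolding back_edges_def using fin by (intro sum_mono card_image_le) auto
  finally show ?thesis unfolding T_def .
qed

text \<open>With M placements and h edges, the expected number of copies is \<mu> = M p^h. Given
  \<phi>, at most M / m^|U| placements agree with it exactly on U, and a pair of this kind shares at
  most \<open>back_edges S U\<close> edges. By \<open>bal\<close> each U then contributes at most M
  p^(2 h) / y, which bounds the pair sum of \<open>janson\<close> by 2^(N + 1) \<mu>^2 / y.\<close>

lemma prob_no_copy:
  fixes p y :: real
  assumes p: "0 < p" "p \<le> 1" and m: "0 < m" and y: "0 < y"
    and S: "\<And>t. S t \<subseteq> {..<t}" and e: "1 \<le> back_edges S {..N}"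
    and bal: "\<And>T. T \<subseteq> {..N} \<Longrightarrow> 1 \<le> back_edges S T \<Longrightarrow> y \<le> real m ^ card T * p ^ back_edges S T"
    and W: "\<And>t. t \<le> N \<Longrightarrow> m \<le> card (W \<inter> level n lev t)"
  shows "measure_pmf.prob (gnp n p) {E. \<not> (\<exists>\<phi>. (\<forall>t\<le>N. \<phi> t \<in> W \<inter> level n lev t) \<and> copy_edges N S \<phi> \<subseteq> E)}
    \<le> exp (- (y / 2 ^ (N + 3)))"
proof -
  define A where "A t = W \<inter> level n lev t" for t
  define I where "I = PiE {..N} A"
  define M where "M = real (card I)"
  define h where "h = back_edges S {..N}"
  define \<mu> where "\<mu> = M * p ^ h"
  define B where "B = copy_edges N S"
  have finA: "finite (A t)" for t unfolding A_def level_def by simp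
  have finI: "finite I" unfolding I_def using finA by (intro finite_PiE) auto
  have cardI: "M = (\<Prod>t\<le>N. real (card (A t)))" unfolding M_def I_def by (simp add: card_PiE)
  have mA: "m \<le> card (A t)" if "t \<le> N" for t using W that unfolding A_def by simp
  have lev: "lev (\<phi> t) = t" if "\<phi> \<in> I" "t \<le> N" for \<phi> t
    using that unfolding I_def A_def level_def by auto
  have lt: "s < t" if "s \<in> S t" for s t using S that by blast
  have BA: "B \<phi> \<subseteq> all_edges n" if \<phi>: "\<phi> \<in> I" for \<phi>
  proof
    fix x assume "x \<in> B \<phi>"
    then obtain t s where ts: "t \<le> N" "s \<in> S t" "x = {\<phi> t, \<phi> s}" unfolding B_def copy_edges_def by auto
    then have "\<phi> t \<in> A t" "\<phi> s \<in> A s" using \<phi> lt[OF ts(2)] unfolding I_def by auto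
    then have "\<phi> t < n" "\<phi> s < n" "\<phi> t \<noteq> \<phi> s" using lt[OF ts(2)] unfolding A_def level_def by auto
    then show "x \<in> all_edges n" unfolding all_edges_def ts(3) by blast
  qed
  have finB: "finite (B \<phi>)" if "\<phi> \<in> I" for \<phi> using BA[OF that] finite_subset[OF _ finite_all_edges] by blast
  have cB: "card (B \<phi>) = h" if "\<phi> \<in> I" for \<phi>
    unfolding B_def h_def by (rule card_copy_edges[OF S]) (rule lev[OF that])
  define T where "T \<phi> \<psi> = {t. t \<le> N \<and> \<phi> t = \<psi> t}" for \<phi> \<psi> :: "nat \<Rightarrow> nat"
  \<comment> \<open>Bounds the weight of a pair by its agreement set alone: the union has 2 h edges
    less the shared ones.\<close>
  define g where "g T = of_bool (1 \<le> back_edges S T) * (p ^ (2 * h) / p ^ back_edges S T)" for T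
  have g0: "0 \<le> g T" for T unfolding g_def using p by simp
  have pair: "of_bool (B \<phi> \<inter> B \<psi> \<noteq> {}) * p ^ card (B \<phi> \<union> B \<psi>) \<le> g (T \<phi> \<psi>)" if "\<phi> \<in> I" "\<psi> \<in> I" for \<phi> \<psi>
  proof (cases "B \<phi> \<inter> B \<psi> = {}")
    case False
    have le: "card (B \<phi> \<inter> B \<psi>) \<le> back_edges S (T \<phi> \<psi>)"
      unfolding B_def T_def by (rule card_copy_edges_Int[OF S]) (use that in \<open>auto intro!: lev\<close>)
    have "1 \<le> card (B \<phi> \<inter> B \<psi>)" using False finB[OF that(1)] by (simp add: Suc_leI card_gt_0_iff)
    then have one: "1 \<le> back_edges S (T \<phi> \<psi>)" using le by linarith
    have "card (B \<phi> \<union> B \<psi>) + card (B \<phi> \<inter> B \<psi>) = 2 * h"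
      using card_Un_Int[OF finB[OF that(1)] finB[OF that(2)]] cB that by simp
    then have "p ^ (2 * h) = p ^ card (B \<phi> \<union> B \<psi>) * p ^ card (B \<phi> \<inter> B \<psi>)" by (simp add: power_add[symmetric])
    also have "\<dots> \<ge> p ^ card (B \<phi> \<union> B \<psi>) * p ^ back_edges S (T \<phi> \<psi>)"
      using p le by (intro mult_left_mono power_decreasing) auto
    finally have "p ^ card (B \<phi> \<union> B \<psi>) \<le> p ^ (2 * h) / p ^ back_edges S (T \<phi> \<psi>)"
      using p by (simp add: pos_le_divide_eq)
    then show ?thesis using False one unfolding g_def by simp
  qed (simp add: g0)
  have M0: "0 < M" unfolding cardI using mA m by (intro prod_pos) (meson atMost_iff less_le_trans of_nat_0_less_iff)
  \<comment> \<open>A level where \<psi> is prescribed costs a factor of at least m, the least size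
    of a level.\<close>
  have agree: "real (card {\<psi>\<in>I. T \<phi> \<psi> = U}) \<le> M / real m ^ card U" if \<phi>: "\<phi> \<in> I" and U: "U \<subseteq> {..N}" for \<phi> U
  proof -
    define A' where "A' t = (if t \<in> U then {\<phi> t} else A t)" for t
    have fA': "finite (PiE {..N} A')" using finA by (intro finite_PiE) (auto simp: A'_def)
    have "{\<psi>\<in>I. T \<phi> \<psi> = U} \<subseteq> PiE {..N} A'"
      using U unfolding I_def T_def A'_def by (auto simp: PiE_iff extensional_def)
    then have "real (card {\<psi>\<in>I. T \<phi> \<psi> = U}) \<le> real (card (PiE {..N} A'))"
      using fA' by (intro of_nat_mono card_mono)
    also have "\<dots> = (\<Prod>t\<le>N. real (card (A' t)))" by (simp add: card_PiE)
    also have "\<dots> \<le> (\<Prod>t\<le>N. real (card (A t)) / (if t \<in> U then real m else 1))"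
    proof (intro prod_mono conjI)
      fix t assume "t \<in> {..N}"
      then have "1 \<le> real (card (A t)) / real m" using mA[of t] m by simp
      then show "real (card (A' t)) \<le> real (card (A t)) / (if t \<in> U then real m else 1)"
        unfolding A'_def by simp
    qed simp
    also have "\<dots> = M / (\<Prod>t\<le>N. if t \<in> U then real m else 1)"
      unfolding cardI by (simp add: prod_dividef)
    also have "(\<Prod>t\<le>N. if t \<in> U then real m else 1) = real m ^ card U"
      using U by (simp add: prod.If_cases Int_absorb1)
    finally show ?thesis .
  qed
  \<comment> \<open>The factor 2^(N + 1) counts the possible agreement sets U \<subseteq>
    {0..N}.\<close>
  define y' where "y' = y / 2 ^ (N + 1)"
  have y'0: "0 < y'" unfolding y'_def using y by simp
  have gy: "M / real m ^ card U * g U \<le> M * p ^ (2 * h) / y" if U: "U \<subseteq> {..N}" for U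
  proof (cases "1 \<le> back_edges S U")
    case True
    have "M / real m ^ card U * g U = M * p ^ (2 * h) / (real m ^ card U * p ^ back_edges S U)"
      unfolding g_def using True by simp
    also have "\<dots> \<le> M * p ^ (2 * h) / y"
      using bal[OF U True] y M0 p by (intro divide_left_mono mult_nonneg_nonneg mult_pos_pos) (use m in auto)
    finally show ?thesis .
  next
    case False
    then show ?thesis unfolding g_def using M0 p y by simp
  qed
  define \<Delta> where "\<Delta> = (\<Sum>\<phi>\<in>I. \<Sum>\<psi>\<in>I. of_bool (B \<phi> \<inter> B \<psi> \<noteq> {}) * p ^ card (B \<phi> \<union> B \<psi>))"
  have "\<Delta> \<le> (\<Sum>\<phi>\<in>I. \<Sum>\<psi>\<in>I. g (T \<phi> \<psi>))"
    unfolding \<Delta>_def using pair by (intro sum_mono)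
  also have "\<dots> \<le> (\<Sum>\<phi>\<in>I. 2 ^ (N + 1) * (M * p ^ (2 * h) / y))"
  proof (intro sum_mono)
    fix \<phi> assume \<phi>: "\<phi> \<in> I"
    have "(\<Sum>\<psi>\<in>I. g (T \<phi> \<psi>)) = (\<Sum>U\<in>Pow {..N}. \<Sum>\<psi>\<in>{\<psi>\<in>I. T \<phi> \<psi> = U}. g (T \<phi> \<psi>))"
      using finI by (intro sum.group[symmetric]) (auto simp: T_def)
    also have "\<dots> = (\<Sum>U\<in>Pow {..N}. real (card {\<psi>\<in>I. T \<phi> \<psi> = U}) * g U)"
      by (intro sum.cong refl) simp
    also have "\<dots> \<le> (\<Sum>U\<in>Pow {..N}. M * p ^ (2 * h) / y)"
    proof (intro sum_mono)
      fix U assume U: "U \<in> Pow {..N}"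
      then have "real (card {\<psi>\<in>I. T \<phi> \<psi> = U}) * g U \<le> M / real m ^ card U * g U"
        using agree[OF \<phi>, of U] g0 by (intro mult_right_mono) auto
      then show "real (card {\<psi>\<in>I. T \<phi> \<psi> = U}) * g U \<le> M * p ^ (2 * h) / y" using gy[of U] U by simp
    qed
    also have "\<dots> = 2 ^ (N + 1) * (M * p ^ (2 * h) / y)" by (simp add: card_Pow)
    finally show "(\<Sum>\<psi>\<in>I. g (T \<phi> \<psi>)) \<le> 2 ^ (N + 1) * (M * p ^ (2 * h) / y)" .
  qed
  also have "\<dots> = \<mu>\<^sup>2 / y'"
  proof -
    have "(\<Sum>\<phi>\<in>I. 2 ^ (N + 1) * (M * p ^ (2 * h) / y)) = M * (2 ^ (N + 1) * (M * p ^ (2 * h) / y))"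
      unfolding M_def by simp
    also have "\<dots> = \<mu>\<^sup>2 / y'"
    proof -
      have "p ^ (2 * h) = p ^ h * p ^ h" by (simp add: mult_2 power_add)
      then show ?thesis unfolding \<mu>_def y'_def by (simp add: power2_eq_square ac_simps)
    qed
    finally show ?thesis .
  qed
  finally have \<Delta>: "\<Delta> \<le> \<mu>\<^sup>2 / y'" .
  have "y \<le> real m ^ card {..N} * p ^ h" using bal[OF order_refl] e unfolding h_def by simp
  also have "\<dots> \<le> M * p ^ h"
  proof (intro mult_right_mono)
    have "real m ^ card {..N} = (\<Prod>t\<le>N. real m)" by simp
    also have "\<dots> \<le> M" unfolding cardI using mA by (intro prod_mono) auto
    finally show "real m ^ card {..N} \<le> M" .
  qed (use p in simp)
  finally have y\<mu>: "y \<le> \<mu>" unfolding \<mu>_def .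
  have y'y: "y' \<le> y"
  proof -
    have "1 \<le> (2::real) ^ (N + 1)" by (rule one_le_power) simp
    then show ?thesis unfolding y'_def using y by (subst pos_divide_le_eq) (auto simp: mult_le_cancel_left1)
  qed
  have \<mu>0: "0 < \<mu>" using y\<mu> y by linarith
  \<comment> \<open>This q minimises - q \<mu> + q^2 \<mu>^2 / y', with value - y' / 4 = - y / 2^(N
    + 3). It is at most 1 because y' \<le> y \<le> \<mu>.\<close>
  define q where "q = y' / (2 * \<mu>)"
  have q: "0 \<le> q" "q \<le> 1" unfolding q_def using y'0 \<mu>0 y'y y\<mu> by (simp_all add: pos_divide_le_eq)
  have "measure_pmf.prob (gnp n p) {E. \<not> (\<exists>\<phi>. (\<forall>t\<le>N. \<phi> t \<in> W \<inter> level n lev t) \<and> copy_edges N S \<phi> \<subseteq> E)}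
     \<le> measure_pmf.prob (rset (all_edges n) p) {E. \<forall>\<phi>\<in>I. \<not> B \<phi> \<subseteq> E}"
    unfolding gnp_eq_rset
  proof (intro measure_pmf.finite_measure_mono subsetI CollectI ballI notI)
    fix E \<phi> assume E: "E \<in> {E. \<not> (\<exists>\<phi>. (\<forall>t\<le>N. \<phi> t \<in> W \<inter> level n lev t) \<and> copy_edges N S \<phi> \<subseteq> E)}"
      and \<phi>: "\<phi> \<in> I" "B \<phi> \<subseteq> E"
    have "\<forall>t\<le>N. \<phi> t \<in> W \<inter> level n lev t" using \<phi>(1) unfolding I_def A_def by auto
    then show False using E \<phi>(2) unfolding B_def by blast
  qed simp
  also have "\<dots> \<le> exp (- q * (\<Sum>\<phi>\<in>I. p ^ card (B \<phi>)) + q\<^sup>2 * \<Delta>)"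
    unfolding \<Delta>_def using p q finI BA by (intro janson finite_all_edges) auto
  also have "(\<Sum>\<phi>\<in>I. p ^ card (B \<phi>)) = \<mu>" unfolding \<mu>_def M_def using cB by simp
  also have "exp (- q * \<mu> + q\<^sup>2 * \<Delta>) \<le> exp (- q * \<mu> + q\<^sup>2 * (\<mu>\<^sup>2 / y'))"
    unfolding exp_le_cancel_iff using mult_left_mono[OF \<Delta>, of "q\<^sup>2"] by simp
  also have "- q * \<mu> + q\<^sup>2 * (\<mu>\<^sup>2 / y') = - (y / 2 ^ (N + 3))"
  proof -
    have "q * \<mu> = y' / 2" "q\<^sup>2 * (\<mu>\<^sup>2 / y') = y' / 4"
      unfolding q_def using \<mu>0 y'0 by (simp_all add: power2_eq_square field_simps)
    then show ?thesis unfolding y'_def by (simp add: power_add)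
  qed
  finally show ?thesis .
qed

text \<open>The union bound over W costs a factor 2^n, so this is of use once y is much larger than
  n.\<close>

lemma prob_not_partite_rich:
  fixes p y :: real
  assumes p: "0 < p" "p \<le> 1" and m: "0 < m" and y: "0 < y"
    and S: "\<And>t. S t \<subseteq> {..<t}" and e: "1 \<le> back_edges S {..N}"
    and bal: "\<And>T. T \<subseteq> {..N} \<Longrightarrow> 1 \<le> back_edges S T \<Longrightarrow> y \<le> real m ^ card T * p ^ back_edges S T"
  shows "measure_pmf.prob (gnp n p) {E. \<not> partite_rich n N S lev m E} \<le> 2 ^ n * exp (- (y / 2 ^ (N + 3)))"
proof -
  define R where "R W E \<longleftrightarrow> \<not> (\<exists>\<phi>. (\<forall>t\<le>N. \<phi> t \<in> W \<inter> level n lev t) \<and> copy_edges N S \<phi> \<subseteq> E)" for W E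
  define \<W> where "\<W> = {W. W \<subseteq> {..<n} \<and> (\<forall>t\<le>N. m \<le> card (W \<inter> level n lev t))}"
  have "measure_pmf.prob (gnp n p) {E. \<not> partite_rich n N S lev m E}
      \<le> (\<Sum>W\<in>\<W>. measure_pmf.prob (gnp n p) {E. R W E})"
    unfolding gnp_eq_rset
  proof (rule union_bound)
    show "finite \<W>" unfolding \<W>_def by simp
    show "\<exists>W\<in>\<W>. R W E" if "\<not> partite_rich n N S lev m E" for E
      using that unfolding partite_rich_def \<W>_def R_def by auto
  qed (use p finite_all_edges in auto)
  also have "\<dots> \<le> (\<Sum>W\<in>\<W>. exp (- (y / 2 ^ (N + 3))))"
  proof (intro sum_mono)
    fix W assume "W \<in> \<W>"
    then have W: "m \<le> card (W \<inter> level n lev t)" if "t \<le> N" for t using that unfolding \<W>_def by blast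
    show "measure_pmf.prob (gnp n p) {E. R W E} \<le> exp (- (y / 2 ^ (N + 3)))"
      unfolding R_def by (rule prob_no_copy[OF p m y S e bal W])
  qed
  also have "\<dots> = real (card \<W>) * exp (- (y / 2 ^ (N + 3)))" by simp
  also have "\<dots> \<le> 2 ^ n * exp (- (y / 2 ^ (N + 3)))"
  proof (intro mult_right_mono)
    have "card \<W> \<le> card (Pow {..<n})" unfolding \<W>_def by (intro card_mono) auto
    then have "card \<W> \<le> 2 ^ n" by (simp add: card_Pow)
    then have "real (card \<W>) \<le> real (2 ^ n)" by (rule of_nat_mono)
    then show "real (card \<W>) \<le> 2 ^ n" by simp
  qed simp
  finally show ?thesis .
qed

section \<open>Patterns and asymptotics\<close>

text \<open>Joining each t to the preceding width t vertices, where the partial sums of the widths track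
  \<beta> t, gives a chordal graph of density about \<beta> no part of which is denser.\<close>

definition width :: "real \<Rightarrow> nat \<Rightarrow> nat" where
  "width \<beta> t = nat (\<lfloor>\<beta> * real t\<rfloor> - \<lfloor>\<beta> * (real t - 1)\<rfloor>)"

definition window :: "real \<Rightarrow> nat \<Rightarrow> nat set" where
  "window \<beta> t = {s. s < t \<and> t \<le> s + width \<beta> t}"

lemma width_bounds:
  assumes "0 \<le> \<beta>"
  shows "int (width \<beta> t) = \<lfloor>\<beta> * real t\<rfloor> - \<lfloor>\<beta> * (real t - 1)\<rfloor>"
    "\<lfloor>\<beta>\<rfloor> \<le> int (width \<beta> t)" "int (width \<beta> t) \<le> \<lfloor>\<beta>\<rfloor> + 1"
proof -
  have e: "\<beta> * real t = \<beta> * (real t - 1) + \<beta>" by (simp add: algebra_simps)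
  have 1: "\<lfloor>\<beta>\<rfloor> \<le> \<lfloor>\<beta> * real t\<rfloor> - \<lfloor>\<beta> * (real t - 1)\<rfloor>" unfolding e by linarith
  have 2: "\<lfloor>\<beta> * real t\<rfloor> - \<lfloor>\<beta> * (real t - 1)\<rfloor> \<le> \<lfloor>\<beta>\<rfloor> + 1" unfolding e by linarith
  have "0 \<le> \<lfloor>\<beta>\<rfloor>" using assms by simp
  then show *: "int (width \<beta> t) = \<lfloor>\<beta> * real t\<rfloor> - \<lfloor>\<beta> * (real t - 1)\<rfloor>" unfolding width_def using 1 by linarith
  show "\<lfloor>\<beta>\<rfloor> \<le> int (width \<beta> t)" "int (width \<beta> t) \<le> \<lfloor>\<beta>\<rfloor> + 1" unfolding * using 1 2 by blast+
qed

lemma window_subset: "window \<beta> t \<subseteq> {..<t}"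
  unfolding window_def by auto

text \<open>Widths take only two consecutive values, and s' < t makes up for the possible loss of
  one.\<close>

lemma window_clique:
  assumes \<beta>: "0 \<le> \<beta>" and "s \<in> window \<beta> t" "s' \<in> window \<beta> t" "s < s'"
  shows "s \<in> window \<beta> s'"
  using assms(2-) width_bounds(2)[OF \<beta>, of s'] width_bounds(3)[OF \<beta>, of t] unfolding window_def by auto

lemma card_window: "card (window \<beta> t) = min t (width \<beta> t)"
proof -
  have "window \<beta> t = {t - width \<beta> t..<t}" unfolding window_def by auto
  then show ?thesis by simp
qed

text \<open>By \<open>eq\<close> the right side is the increase of \<lfloor>\<beta> x\<rfloor> from
  a to b, less \<beta> for each of the g skipped vertices. A gap of g vertices takes g places in the
  window of b, and \<lfloor>\<beta> x\<rfloor> grows by at least g (\<beta> - 1) across it; together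
  these pay for \<beta> g.\<close>

lemma window_below_max:
  assumes \<beta>: "2 \<le> \<beta>" and ab: "a < b"
  shows "real (card (window \<beta> b \<inter> {..a})) \<le> \<beta> - frac (\<beta> * real b) + frac (\<beta> * real a)"
proof -
  define g where "g = b - a - 1"
  have b: "b = a + g + 1" unfolding g_def using ab by simp
  have rb: "real b - 1 = real a + real g" unfolding b by simp
  have eq: "\<beta> - frac (\<beta> * real b) + frac (\<beta> * real a)
      = real_of_int (\<lfloor>\<beta> * real b\<rfloor> - \<lfloor>\<beta> * real a\<rfloor>) - \<beta> * real g"
    unfolding frac_def b by (simp add: algebra_simps)
  show ?thesis
  proof (cases "width \<beta> b \<le> g")
    case True
    have "window \<beta> b \<inter> {..a} = {}" using True b unfolding window_def by auto
    moreover have "frac (\<beta> * real b) < 1" "0 \<le> frac (\<beta> * real a)" by (simp_all add: frac_lt_1)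
    ultimately show ?thesis using \<beta> by simp
  next
    case False
    have "window \<beta> b \<inter> {..a} \<subseteq> {b - width \<beta> b..a}" unfolding window_def by auto
    then have "card (window \<beta> b \<inter> {..a}) \<le> card {b - width \<beta> b..a}" by (intro card_mono) auto
    also have "\<dots> \<le> width \<beta> b - g" using False b by simp
    finally have c: "real (card (window \<beta> b \<inter> {..a})) \<le> real (width \<beta> b) - real g" using False by linarith
    have w: "real (width \<beta> b) = real_of_int (\<lfloor>\<beta> * real b\<rfloor> - \<lfloor>\<beta> * (real a + real g)\<rfloor>)"
      using width_bounds(1)[of \<beta> b] \<beta> unfolding rb by linarith
    have "int g * \<lfloor>\<beta>\<rfloor> \<le> \<lfloor>\<beta> * real g\<rfloor>"
      using mult_left_mono[of "real_of_int \<lfloor>\<beta>\<rfloor>" \<beta> "real g"] by (simp add: le_floor_iff mult.commute)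
    moreover have "\<lfloor>\<beta> * real a\<rfloor> + \<lfloor>\<beta> * real g\<rfloor> \<le> \<lfloor>\<beta> * (real a + real g)\<rfloor>"
      unfolding distrib_left by (rule le_floor_add)
    ultimately have "int g * \<lfloor>\<beta>\<rfloor> \<le> \<lfloor>\<beta> * (real a + real g)\<rfloor> - \<lfloor>\<beta> * real a\<rfloor>" by linarith
    then have "real_of_int (int g * \<lfloor>\<beta>\<rfloor>) \<le> real_of_int (\<lfloor>\<beta> * (real a + real g)\<rfloor> - \<lfloor>\<beta> * real a\<rfloor>)"
      by (simp only: of_int_le_iff)
    moreover have "real g * (\<beta> - 1) \<le> real g * real_of_int \<lfloor>\<beta>\<rfloor>"
      by (intro mult_left_mono) linarith+
    ultimately have "real g * (\<beta> - 1) \<le> real_of_int (\<lfloor>\<beta> * (real a + real g)\<rfloor> - \<lfloor>\<beta> * real a\<rfloor>)" by simp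
    then show ?thesis using c w unfolding eq by (simp add: algebra_simps)
  qed
qed

text \<open>The fractional part measures how far the widths up to Max T lag behind; with it the induction over
  T is tight on intervals and loses at gaps. K = 1 is available for \<beta> = 2, where the bound 2 |T| - 3
  is the edge count of a 2-tree.\<close>

lemma window_back_edges:
  assumes \<beta>: "2 \<le> \<beta>" and K: "\<And>t::nat. K + frac (\<beta> * real t) \<le> \<beta> - 1"
  shows "finite T \<Longrightarrow> 2 \<le> card T \<Longrightarrow>
    real (back_edges (window \<beta>) T) \<le> \<beta> * (real (card T) - 1) - frac (\<beta> * real (Max T)) - K"
proof (induction T rule: finite_linorder_max_induct)
  case (insert b A)
  have ne: "A \<noteq> {}" using insert.prems by auto
  define a where "a = Max A"
  have a: "a \<in> A" "\<And>t. t \<in> A \<Longrightarrow> t \<le> a" unfolding a_def using insert.hyps ne by simp_all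
  have bA: "b \<notin> A" using insert.hyps by auto
  have "Max (insert b A) = b" using insert.hyps by (intro Max_eqI) (auto intro: less_imp_le)
  moreover have "back_edges (window \<beta>) (insert b A) = back_edges (window \<beta>) A + card (window \<beta> b \<inter> A)"
  proof -
    have "window \<beta> b \<inter> insert b A = window \<beta> b \<inter> A" unfolding window_def by auto
    moreover have "window \<beta> t \<inter> insert b A = window \<beta> t \<inter> A" if "t \<in> A" for t
      using insert.hyps that unfolding window_def by auto
    ultimately show ?thesis
      unfolding back_edges_def using insert.hyps bA by simp
  qed
  moreover have "real (card (window \<beta> b \<inter> A)) \<le> \<beta> - frac (\<beta> * real b) + frac (\<beta> * real a)"
  proof -
    have "card (window \<beta> b \<inter> A) \<le> card (window \<beta> b \<inter> {..a})" using a by (intro card_mono) auto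
    then show ?thesis using window_below_max[OF \<beta>, of a b] insert.hyps(2) a(1) by fastforce
  qed
  moreover have "card (insert b A) = Suc (card A)" using insert.hyps bA by simp
  moreover have "real (back_edges (window \<beta>) A) \<le> \<beta> * (real (card A) - 1) - frac (\<beta> * real a) - K" if "2 \<le> card A"
    using insert.IH that unfolding a_def by simp
  \<comment> \<open>Two vertices span at most one edge, and the hypothesis on K says just that 1 is
    within the bound.\<close>
  moreover have ?case if "\<not> 2 \<le> card A"
  proof -
    have "card A = 1" using that ne insert.hyps(1) by (metis One_nat_def card_gt_0_iff less_2_cases_iff not_le not_gr0)
    then obtain x where A: "A = {x}" using card_1_singletonE by blast
    have "back_edges (window \<beta>) A = 0" unfolding back_edges_def A window_def by auto
    moreover have "card (window \<beta> b \<inter> A) \<le> card A" unfolding A by (intro card_mono) auto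
    ultimately have "real (back_edges (window \<beta>) (insert b A)) \<le> 1"
      using \<open>back_edges (window \<beta>) (insert b A) = _\<close> \<open>card A = 1\<close> by simp
    then show ?thesis
      using K[of b] \<open>card A = 1\<close> \<open>Max (insert b A) = b\<close> \<open>card (insert b A) = Suc (card A)\<close> by simp
  qed
  ultimately show ?case by (cases "2 \<le> card A") (auto simp: algebra_simps)
qed simp

lemma window_back_edges_le:
  assumes "2 \<le> \<beta>" "\<And>t::nat. K + frac (\<beta> * real t) \<le> \<beta> - 1" "finite T" "1 \<le> back_edges (window \<beta>) T"
  shows "2 \<le> card T" "real (back_edges (window \<beta>) T) \<le> \<beta> * (real (card T) - 1) - K"
proof -
  show c: "2 \<le> card T"
  proof (rule ccontr)
    assume "\<not> 2 \<le> card T"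
    then have "card T = 0 \<or> card T = 1" by linarith
    then obtain x where "T \<subseteq> {x}" using assms(3) by (metis card_0_eq card_1_singletonE empty_subsetI order_refl)
    then have "window \<beta> t \<inter> T = {}" if "t \<in> T" for t using that unfolding window_def by auto
    then have "back_edges (window \<beta>) T = 0" unfolding back_edges_def by simp
    then show False using assms(4) by simp
  qed
  have "0 \<le> frac (\<beta> * real (Max T))" by simp
  then show "real (back_edges (window \<beta>) T) \<le> \<beta> * (real (card T) - 1) - K"
    using window_back_edges[OF assms(1,2,3) c] by linarith
qed

lemma back_edges_window_atMost: "back_edges (window \<beta>) {..N} = (\<Sum>t\<le>N. card (window \<beta> t))"
  unfolding back_edges_def
proof (intro sum.cong refl)
  fix t assume "t \<in> {..N}"
  then have "window \<beta> t \<inter> {..N} = window \<beta> t" using window_subset[of \<beta> t] by auto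
  then show "card (window \<beta> t \<inter> {..N}) = card (window \<beta> t)" by simp
qed

text \<open>The widths telescope to \<lfloor>\<beta> N\<rfloor>. Windows are cut off at 0 only for t
  < M, where M bounds all widths, so at most M^2 edges are lost.\<close>

lemma sum_card_window_ge:
  assumes \<beta>: "0 \<le> \<beta>"
  shows "\<beta> * real N - 1 - (\<beta> + 1)\<^sup>2 \<le> real (\<Sum>t\<le>N. card (window \<beta> t))"
proof -
  define M where "M = nat \<lfloor>\<beta>\<rfloor> + 1"
  have M: "real M \<le> \<beta> + 1" unfolding M_def using \<beta> by simp
  have "(\<Sum>t=1..k. int (width \<beta> t)) = \<lfloor>\<beta> * real k\<rfloor>" for k
  proof (induction k)
    case (Suc k)
    then show ?case using width_bounds(1)[OF \<beta>, of "Suc k"] by simp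
  qed simp
  then have "int (\<Sum>t=1..N. width \<beta> t) = \<lfloor>\<beta> * real N\<rfloor>" by simp
  then have 1: "\<beta> * real N - 1 \<le> real (\<Sum>t=1..N. width \<beta> t)" by linarith
  have "(\<Sum>t=1..N. width \<beta> t) \<le> (\<Sum>t=1..N. card (window \<beta> t) + (if t < M then M else 0))"
  proof (intro sum_mono)
    fix t
    have "width \<beta> t \<le> M" using width_bounds(3)[OF \<beta>, of t] \<beta> unfolding M_def by linarith
    then show "width \<beta> t \<le> card (window \<beta> t) + (if t < M then M else 0)" unfolding card_window by auto
  qed
  also have "\<dots> = (\<Sum>t=1..N. card (window \<beta> t)) + (\<Sum>t=1..N. if t < M then M else 0)" by (rule sum.distrib)
  also have "(\<Sum>t=1..N. if t < M then M else 0) \<le> M * M"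
  proof -
    have "(\<Sum>t=1..N. if t < M then M else 0) = (\<Sum>t\<in>{1..N} \<inter> {..<M}. M)"
      by (intro sum.mono_neutral_cong_right) auto
    also have "\<dots> = card ({1..N} \<inter> {..<M}) * M" by simp
    also have "\<dots> \<le> M * M"
      using card_mono[of "{..<M}" "{1..N} \<inter> {..<M}"] by (intro mult_right_mono) auto
    finally show ?thesis .
  qed
  also have "(\<Sum>t=1..N. card (window \<beta> t)) \<le> (\<Sum>t\<le>N. card (window \<beta> t))"
    by (intro sum_mono2) auto
  finally have "(\<Sum>t=1..N. width \<beta> t) \<le> (\<Sum>t\<le>N. card (window \<beta> t)) + M * M" by simp
  then have "real (\<Sum>t=1..N. width \<beta> t) \<le> real ((\<Sum>t\<le>N. card (window \<beta> t)) + M * M)" by (rule of_nat_mono)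
  then have "real (\<Sum>t=1..N. width \<beta> t) \<le> real (\<Sum>t\<le>N. card (window \<beta> t)) + real M * real M" by simp
  moreover have "real M * real M \<le> (\<beta> + 1)\<^sup>2" unfolding power2_eq_square using M by (intro mult_mono) auto
  ultimately show ?thesis using 1 by linarith
qed

text \<open>The pattern is the square of a path on k + 2 vertices: vertex 1 has one earlier
  neighbour, each later vertex has two.\<close>

lemma sum_card_window_2: "(\<Sum>t\<le>k + 1. card (window 2 t)) = 1 + 2 * k"
proof (induction k)
  case 0
  show ?case by (simp add: card_window width_def)
next
  case (Suc k)
  have "width 2 (k + 2) = 2"
  proof -
    have "\<lfloor>2 * real (k + 2)\<rfloor> = 2 * int (k + 2)" "\<lfloor>2 * (real (k + 2) - 1)\<rfloor> = 2 * int (k + 1)"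
      by (intro floor_unique; simp)+
    then show ?thesis unfolding width_def by simp
  qed
  then show ?case using Suc by (simp add: card_window)
qed

section \<open>Limits of powers of n and transfer between events\<close>

lemma tendsto_0_upper:
  fixes f g :: "nat \<Rightarrow> real"
  assumes "eventually (\<lambda>n. f n \<le> g n) sequentially" "g \<longlonglongrightarrow> 0" "\<And>n. 0 \<le> f n"
  shows "f \<longlonglongrightarrow> 0"
  by (rule tendsto_sandwich[OF always_eventually assms(1) tendsto_const assms(2)]) (simp add: assms(3))

lemma powr_tendsto_0:
  assumes g: "g \<longlonglongrightarrow> (L::real)" and L: "L < 0"
  shows "(\<lambda>n. real n powr g n) \<longlonglongrightarrow> 0"
proof (rule tendsto_0_upper)
  have "eventually (\<lambda>n. g n < L / 2) sequentially" using order_tendstoD(2)[OF g, of "L/2"] L by simp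
  then show "eventually (\<lambda>n. real n powr g n \<le> real n powr (L / 2)) sequentially"
    using eventually_ge_at_top[of 1]
    by eventually_elim (intro powr_mono, auto)
  show "(\<lambda>n. real n powr (L / 2)) \<longlonglongrightarrow> 0"
    using tendsto_neg_powr[of "L/2" "\<lambda>n. real n" sequentially] L filterlim_real_sequentially by simp
qed auto

lemma powr_eventually_ge:
  assumes g: "g \<longlonglongrightarrow> (L::real)" and c: "c < L" and C: "0 < C"
  shows "eventually (\<lambda>n. C * real n powr c \<le> real n powr g n) sequentially"
proof -
  have "(\<lambda>n. real n powr (c - g n)) \<longlonglongrightarrow> 0"
    using powr_tendsto_0[of "\<lambda>n. c - g n" "c - L"] g c by (simp add: tendsto_diff)
  then have "eventually (\<lambda>n. real n powr (c - g n) < 1 / C) sequentially"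
    using C by (intro order_tendstoD(2)) auto
  then show ?thesis
    using eventually_ge_at_top[of 1]
  proof eventually_elim
    case (elim n)
    have "C * real n powr c = C * (real n powr (c - g n) * real n powr g n)"
      using elim by (simp add: powr_add[symmetric])
    also have "\<dots> = (C * real n powr (c - g n)) * real n powr g n" by simp
    also have "\<dots> \<le> 1 * real n powr g n"
      using elim C by (intro mult_right_mono) (auto simp: field_simps)
    finally show ?case by simp
  qed
qed

text \<open>Only graphs on [n] are compared, so E is finite in the applications. A single
  exceptional event is passed twice or paired with \<open>False\<close>.\<close>

lemma prob_tendsto_0_mono:
  assumes "\<And>n. 0 \<le> p n \<and> p n \<le> (1::real)"
    and "eventually (\<lambda>n. \<forall>E\<subseteq>all_edges n. P n E \<longrightarrow> Q n E \<or> Q' n E) sequentially"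
    and "(\<lambda>n. measure_pmf.prob (gnp n (p n)) {E. Q n E}) \<longlonglongrightarrow> 0"
    and "(\<lambda>n. measure_pmf.prob (gnp n (p n)) {E. Q' n E}) \<longlonglongrightarrow> 0"
  shows "(\<lambda>n. measure_pmf.prob (gnp n (p n)) {E. P n E}) \<longlonglongrightarrow> 0"
proof (rule tendsto_0_upper)
  show "(\<lambda>n. measure_pmf.prob (gnp n (p n)) {E. Q n E} + measure_pmf.prob (gnp n (p n)) {E. Q' n E}) \<longlonglongrightarrow> 0"
    using tendsto_add[OF assms(3,4)] by simp
  show "eventually (\<lambda>n. measure_pmf.prob (gnp n (p n)) {E. P n E}
      \<le> measure_pmf.prob (gnp n (p n)) {E. Q n E} + measure_pmf.prob (gnp n (p n)) {E. Q' n E}) sequentially"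
    using assms(2)
  proof eventually_elim
    case (elim n)
    have "measure_pmf.prob (rset (all_edges n) (p n)) {E. P n E}
      \<le> (\<Sum>b\<in>UNIV. measure_pmf.prob (rset (all_edges n) (p n)) {E. if b then Q n E else Q' n E})"
      using elim assms(1) finite_all_edges by (intro union_bound) auto
    then show ?case unfolding gnp_eq_rset by (simp add: UNIV_bool add.commute)
  qed
qed auto

lemma max_chordal_edges_ge:
  assumes "finite E" "F \<subseteq> E" "chordal F"
  shows "card F \<le> max_chordal_edges E"
  unfolding max_chordal_edges_def using assms by (intro Max_ge) auto

lemma max_chordal_edges_attained:
  assumes "finite E"
  shows "\<exists>F\<subseteq>E. chordal F \<and> card F = max_chordal_edges E"
proof -
  have "chordal {}"
    by (rule chordal_if_elimination_rank[where r="\<lambda>_. 0"]) (simp_all add: adj_def)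
  then have "card ` {F. F \<subseteq> E \<and> chordal F} \<noteq> {}" by blast
  moreover have "finite (card ` {F. F \<subseteq> E \<and> chordal F})" using assms by simp
  ultimately have "max_chordal_edges E \<in> card ` {F. F \<subseteq> E \<and> chordal F}"
    unfolding max_chordal_edges_def by (rule Max_in[rotated])
  then show ?thesis by auto
qed

lemma prob_has_clique:
  fixes p :: real
  assumes p: "0 \<le> p" "p \<le> 1"
  shows "measure_pmf.prob (gnp n p) {E. has_clique n q E} \<le> real n ^ q * p ^ (q choose 2)"
proof -
  define \<K> where "\<K> = {K. K \<subseteq> {..<n} \<and> card K = q}"
  have "measure_pmf.prob (gnp n p) {E. has_clique n q E}
      \<le> (\<Sum>K\<in>\<K>. measure_pmf.prob (rset (all_edges n) p) {E. {e. e \<subseteq> K \<and> card e = 2} \<subseteq> E})"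
    unfolding gnp_eq_rset
    by (rule union_bound) (use p finite_all_edges in \<open>auto simp: \<K>_def has_clique_def\<close>)
  also have "\<dots> = (\<Sum>K\<in>\<K>. p ^ (q choose 2))"
  proof (intro sum.cong refl)
    fix K assume K: "K \<in> \<K>"
    have "{e. e \<subseteq> K \<and> card e = 2} \<subseteq> all_edges n"
      using K unfolding \<K>_def all_edges_def by (auto simp: card_2_iff)
    moreover have "card {e. e \<subseteq> K \<and> card e = 2} = q choose 2"
      using n_subsets[of K 2] K finite_subset[of K "{..<n}"] unfolding \<K>_def by simp
    ultimately show "measure_pmf.prob (rset (all_edges n) p) {E. {e. e \<subseteq> K \<and> card e = 2} \<subseteq> E} = p ^ (q choose 2)"
      using p by (simp add: prob_rset[OF finite_all_edges] expct_superset_prob[OF finite_all_edges])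
  qed
  also have "\<dots> = real (n choose q) * p ^ (q choose 2)"
    unfolding \<K>_def using n_subsets[of "{..<n}" q] by simp
  also have "\<dots> \<le> real n ^ q * p ^ (q choose 2)"
  proof (intro mult_right_mono)
    show "real (n choose q) \<le> real n ^ q"
    proof (cases "q \<le> n")
      case True
      then have "n choose q \<le> n ^ q" by (rule binomial_le_pow)
      then show ?thesis by (metis of_nat_le_iff of_nat_power)
    qed (simp add: binomial_eq_0)
  qed (use p in simp)
  finally show ?thesis .
qed

lemma real_choose_two: "real (q choose 2) = real q * (real q - 1) / 2"
  by (induction q) (simp_all add: numeral_2_eq_2 field_simps)

lemma frac_two_mult [simp]: "frac (2 * real t) = 0"
  by (metis Ints_of_nat frac_eq_0_iff of_nat_mult of_nat_numeral)

section \<open>G(n,p) with p = n^(-\<alpha> + o(1))\<close>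

locale gnp_power =
  fixes p :: "nat \<Rightarrow> real" and \<alpha> :: real and \<delta> :: "nat \<Rightarrow> real"
  assumes \<alpha>: "\<alpha> > 0" and p: "\<And>n. 0 \<le> p n \<and> p n \<le> 1" and \<delta>: "\<delta> \<longlonglongrightarrow> 0"
    and p_eq: "eventually (\<lambda>n. p n = real n powr (- \<alpha> + \<delta> n)) sequentially"
begin

lemma p_pos: "eventually (\<lambda>n. 0 < p n) sequentially"
  using p_eq eventually_gt_at_top[of 0] by eventually_elim simp

lemma p_powr: "eventually (\<lambda>n. p n powr e = real n powr ((- \<alpha> + \<delta> n) * e)) sequentially"
  using p_eq by eventually_elim (simp add: powr_powr)

lemma exponent_tendsto: "(\<lambda>n. a + (- \<alpha> + \<delta> n) * e) \<longlonglongrightarrow> a - \<alpha> * e"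
proof -
  have "(\<lambda>n. a + (- \<alpha> + \<delta> n) * e) \<longlonglongrightarrow> a + (- \<alpha> + 0) * e" by (intro tendsto_intros \<delta>)
  then show ?thesis by simp
qed

text \<open>First moment: the expected number of cliques is at most n to the power q (1 - \<alpha>
  (q - 1) / 2) + o(1), which is negative for q > 1 + 2 / \<alpha>.\<close>

lemma whp_no_clique:
  assumes q: "1 + 2 / \<alpha> < real q"
  shows "(\<lambda>n. measure_pmf.prob (gnp n (p n)) {E. has_clique n q E}) \<longlonglongrightarrow> 0"
proof (rule tendsto_0_upper)
  let ?e = "real (q choose 2)"
  have "0 < 2 / \<alpha>" using \<alpha> by simp
  then have q1: "1 < real q" using q by linarith
  have "2 < \<alpha> * (real q - 1)" using q \<alpha> by (simp add: field_simps)
  then have "real q * 2 < real q * (\<alpha> * (real q - 1))" using q1 by (intro mult_strict_left_mono) auto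
  then have neg: "real q - \<alpha> * ?e < 0" unfolding real_choose_two by (simp add: algebra_simps)
  show "(\<lambda>n. real n powr (real q + (- \<alpha> + \<delta> n) * ?e)) \<longlonglongrightarrow> 0"
    by (rule powr_tendsto_0[OF exponent_tendsto neg])
  show "eventually (\<lambda>n. measure_pmf.prob (gnp n (p n)) {E. has_clique n q E}
      \<le> real n powr (real q + (- \<alpha> + \<delta> n) * ?e)) sequentially"
    using p_pos p_powr[of ?e] eventually_gt_at_top[of 0]
  proof eventually_elim
    case (elim n)
    have "measure_pmf.prob (gnp n (p n)) {E. has_clique n q E} \<le> real n ^ q * p n ^ (q choose 2)"
      using p by (intro prob_has_clique) auto
    also have "\<dots> = real n powr real q * p n powr ?e" using elim by (simp add: powr_realpow)
    also have "\<dots> = real n powr (real q + (- \<alpha> + \<delta> n) * ?e)" using elim by (simp add: powr_add)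
    finally show ?case .
  qed
qed auto

lemma whp_no_dense_attachment:
  assumes \<kappa>: "1 < \<alpha> * \<kappa>" and s: "0 < s"
  shows "(\<lambda>n. measure_pmf.prob (gnp n (p n)) {E. dense_attachment n R \<kappa> (s * real n) E}) \<longlonglongrightarrow> 0"
proof (rule tendsto_0_upper)
  define x where "x n = real n * 2 ^ R * p n powr \<kappa>" for n
  \<comment> \<open>A cost per vertex below \<open>x0\<close> turns x^(s n) into at most 4^(-n),
    which beats the factor 2^n.\<close>
  define x0 :: real where "x0 = (1/4) powr (1 / s)"
  have x0: "0 < x0" "x0 \<le> 1" unfolding x0_def using s by (auto intro!: powr_le1)
  have "(\<lambda>n. 2 ^ R * real n powr (1 + (- \<alpha> + \<delta> n) * \<kappa>)) \<longlonglongrightarrow> 2 ^ R * 0"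
    using \<kappa> by (intro tendsto_mult_left powr_tendsto_0[OF exponent_tendsto]) simp
  then have lim: "eventually (\<lambda>n. 2 ^ R * real n powr (1 + (- \<alpha> + \<delta> n) * \<kappa>) < x0) sequentially"
    using x0(1) by (intro order_tendstoD(2)) auto
  show "(\<lambda>n. (1/2::real) ^ n) \<longlonglongrightarrow> 0" by (rule LIMSEQ_realpow_zero) auto
  show "eventually (\<lambda>n. measure_pmf.prob (gnp n (p n)) {E. dense_attachment n R \<kappa> (s * real n) E} \<le> (1/2) ^ n) sequentially"
    using lim p_pos p_powr[of \<kappa>] eventually_gt_at_top[of 0]
  proof eventually_elim
    case (elim n)
    have "x n = 2 ^ R * real n powr (1 + (- \<alpha> + \<delta> n) * \<kappa>)"
      unfolding x_def using elim by (simp add: powr_add)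
    then have "x n < x0" using elim by simp
    moreover have "0 < x n" unfolding x_def using elim by simp
    ultimately have x: "x n < x0" "0 < x n" by blast+
    have "measure_pmf.prob (gnp n (p n)) {E. dense_attachment n R \<kappa> (s * real n) E} \<le> 2 ^ n * x n powr (s * real n)"
      unfolding x_def using elim p x x0 by (intro prob_dense_attachment) (auto simp: x_def)
    also have "\<dots> \<le> 2 ^ n * x0 powr (s * real n)"
      using x s by (intro mult_left_mono powr_mono2) auto
    also have "x0 powr (s * real n) = (1/4) powr real n" unfolding x0_def using s by (simp add: powr_powr)
    also have "\<dots> = (1/4) ^ n" by (rule powr_realpow) simp
    also have "2 ^ n * (1/4) ^ n = (1/2 :: real) ^ n" by (simp add: power_mult_distrib[symmetric])
    finally show ?case .
  qed
qed auto

text \<open>Cliques and dense attachments of F are also ones of E, so these two events cover all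
  graphs with too large a chordal subgraph.\<close>

lemma upper_tail:
  assumes q: "1 + 2 / \<alpha> < real R" and \<kappa>: "1 < \<alpha> * \<kappa>" and s: "0 < s"
    and key: "\<And>n F. F \<subseteq> all_edges n \<Longrightarrow> chordal F \<Longrightarrow> \<not> has_clique n R F \<Longrightarrow> b * real n \<le> real (card F)
      \<Longrightarrow> dense_attachment n R \<kappa> (s * real n) F"
  shows "(\<lambda>n. measure_pmf.prob (gnp n (p n)) {E. b * real n \<le> real (max_chordal_edges E)}) \<longlonglongrightarrow> 0"
proof (rule prob_tendsto_0_mono[OF p _ whp_no_clique[OF q] whp_no_dense_attachment[OF \<kappa> s]])
  show "eventually (\<lambda>n. \<forall>E\<subseteq>all_edges n. b * real n \<le> real (max_chordal_edges E) \<longrightarrow>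
      has_clique n R E \<or> dense_attachment n R \<kappa> (s * real n) E) sequentially"
  proof (intro always_eventually allI impI)
    fix n E assume E: "E \<subseteq> all_edges n" "b * real n \<le> real (max_chordal_edges E)"
    obtain F where F: "F \<subseteq> E" "chordal F" "card F = max_chordal_edges E"
      using max_chordal_edges_attained[OF finite_subset[OF E(1) finite_all_edges]] by blast
    show "has_clique n R E \<or> dense_attachment n R \<kappa> (s * real n) E"
    proof (cases "has_clique n R F")
      case True
      then obtain K where "K \<subseteq> {..<n}" "card K = R" "{e. e \<subseteq> K \<and> card e = 2} \<subseteq> F"
        unfolding has_clique_def by blast
      then have "has_clique n R E" using F(1) unfolding has_clique_def by (intro exI[of _ K]) simp
      then show ?thesis by blast
    next
      case False
      have "dense_attachment n R \<kappa> (s * real n) F"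
        using key[of F n] False F E by simp
      then show ?thesis using F(1) unfolding dense_attachment_def by (meson order_trans)
    qed
  qed
qed

text \<open>The strict inequality \<open>bal\<close> holds with a common margin for the finitely
  many T. So one c > 1 satisfies m^|T| p^e(T) \<ge> n^c for all of them and all large n, and n^c
  outweighs the 2^n of the union bound.\<close>

lemma whp_partite_rich:
  assumes S: "\<And>t. S t \<subseteq> {..<t}" and e: "1 \<le> back_edges S {..N}" and \<epsilon>: "0 < \<epsilon>"
    and bal: "\<And>T. T \<subseteq> {..N} \<Longrightarrow> 1 \<le> back_edges S T \<Longrightarrow> 1 < real (card T) - \<alpha> * real (back_edges S T)"
  shows "(\<lambda>n. measure_pmf.prob (gnp n (p n)) {E. \<not> partite_rich n N S (lev n) (nat \<lfloor>\<epsilon> * real n\<rfloor>) E}) \<longlonglongrightarrow> 0"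
proof (rule tendsto_0_upper)
  define \<T> where "\<T> = {T. T \<subseteq> {..N} \<and> 1 \<le> back_edges S T}"
  define D :: real where "D = 2 ^ (N + 3)"
  have D: "0 < D" unfolding D_def by simp
  have fin: "finite \<T>" "\<T> \<noteq> {}" unfolding \<T>_def using e by auto
  obtain c where c: "1 < c" "\<And>T. T \<in> \<T> \<Longrightarrow> c < real (card T) - \<alpha> * real (back_edges S T)"
  proof -
    define \<mu> where "\<mu> = Min ((\<lambda>T. real (card T) - \<alpha> * real (back_edges S T)) ` \<T>)"
    have "1 < \<mu>" unfolding \<mu>_def using fin bal by (subst Min_gr_iff) (auto simp: \<T>_def)
    then obtain c where "1 < c" "c < \<mu>" using dense by blast
    moreover have "\<mu> \<le> real (card T) - \<alpha> * real (back_edges S T)" if "T \<in> \<T>" for T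
      unfolding \<mu>_def using fin that by (intro Min_le) auto
    ultimately show ?thesis using that less_le_trans by blast
  qed
  have m: "eventually (\<lambda>n. \<epsilon> / 2 * real n \<le> real (nat \<lfloor>\<epsilon> * real n\<rfloor>) \<and> 0 < nat \<lfloor>\<epsilon> * real n\<rfloor>) sequentially"
    using eventually_ge_at_top[of "nat \<lceil>2 / \<epsilon>\<rceil>"]
  proof eventually_elim
    case (elim n)
    then have "2 / \<epsilon> \<le> real n" by linarith
    then have "2 \<le> \<epsilon> * real n" using \<epsilon> by (simp add: field_simps)
    then show ?case by linarith
  qed
  have each: "eventually (\<lambda>n. real n powr c \<le> real (nat \<lfloor>\<epsilon> * real n\<rfloor>) ^ card T * p n ^ back_edges S T) sequentially"
    if T: "T \<in> \<T>" for T
  proof -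
    define k where "k = card T"
    define b where "b = back_edges S T"
    have "c < real k - \<alpha> * real b" using c(2)[OF T] unfolding k_def b_def .
    from powr_eventually_ge[OF exponent_tendsto this, of "(2 / \<epsilon>) ^ k"]
    have "eventually (\<lambda>n. (2 / \<epsilon>) ^ k * real n powr c \<le> real n powr (real k + (- \<alpha> + \<delta> n) * real b)) sequentially"
      using \<epsilon> by simp
    then show ?thesis
      using m p_pos p_powr[of "real b"] eventually_gt_at_top[of 0]
    proof eventually_elim
      case (elim n)
      have "real n powr c = (\<epsilon> / 2) ^ k * ((2 / \<epsilon>) ^ k * real n powr c)"
        using \<epsilon> by (simp add: power_mult_distrib[symmetric] mult.assoc[symmetric])
      also have "\<dots> \<le> (\<epsilon> / 2) ^ k * real n powr (real k + (- \<alpha> + \<delta> n) * real b)"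
        using elim \<epsilon> by (intro mult_left_mono) auto
      also have "\<dots> = (\<epsilon> / 2) ^ k * (real n ^ k * p n ^ b)"
        using elim by (simp add: powr_add powr_realpow[symmetric])
      also have "\<dots> = (\<epsilon> / 2 * real n) ^ k * p n ^ b"
        by (simp only: power_mult_distrib mult.assoc)
      also have "\<dots> \<le> real (nat \<lfloor>\<epsilon> * real n\<rfloor>) ^ k * p n ^ b"
        using elim \<epsilon> by (intro mult_right_mono power_mono) auto
      finally show ?case unfolding k_def b_def .
    qed
  qed
  have all: "eventually (\<lambda>n. \<forall>T\<in>\<T>. real n powr c \<le> real (nat \<lfloor>\<epsilon> * real n\<rfloor>) ^ card T * p n ^ back_edges S T) sequentially"
    using each fin(1) by (simp add: eventually_ball_finite)
  \<comment> \<open>The factor 2 makes the Janson bound at most exp (-2 n), which beats 2^n as 2 <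
    exp 2.\<close>
  have big: "eventually (\<lambda>n. 2 * D * real n powr 1 \<le> real n powr c) sequentially"
    using c(1) D by (intro powr_eventually_ge) auto
  show "(\<lambda>n. (2 * exp (- 2) :: real) ^ n) \<longlonglongrightarrow> 0"
  proof (rule LIMSEQ_realpow_zero)
    have "(2::real) < exp 2" using exp_ge_add_one_self[of "2::real"] by linarith
    then show "2 * exp (- 2) < (1::real)" by (simp add: exp_minus field_simps)
  qed simp
  show "eventually (\<lambda>n. measure_pmf.prob (gnp n (p n)) {E. \<not> partite_rich n N S (lev n) (nat \<lfloor>\<epsilon> * real n\<rfloor>) E}
     \<le> (2 * exp (- 2)) ^ n) sequentially"
    using all m p_pos big eventually_gt_at_top[of 0]
  proof eventually_elim
    case (elim n)
    have "measure_pmf.prob (gnp n (p n)) {E. \<not> partite_rich n N S (lev n) (nat \<lfloor>\<epsilon> * real n\<rfloor>) E}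
        \<le> 2 ^ n * exp (- (real n powr c / 2 ^ (N + 3)))"
    proof (rule prob_not_partite_rich[OF _ _ _ _ S e])
      show "real n powr c \<le> real (nat \<lfloor>\<epsilon> * real n\<rfloor>) ^ card T * p n ^ back_edges S T"
        if "T \<subseteq> {..N}" "1 \<le> back_edges S T" for T
        using elim(1) that unfolding \<T>_def by blast
    qed (use elim p in auto)
    also have "\<dots> \<le> 2 ^ n * exp (- (2 * real n))"
    proof -
      have "2 * real n \<le> real n powr c / D" using elim D by (simp add: field_simps)
      then show ?thesis unfolding D_def by simp
    qed
    also have "\<dots> = (2 * exp (- 2)) ^ n"
      by (simp add: power_mult_distrib exp_of_nat_mult[symmetric] mult.commute)
    finally show ?case .
  qed
qed auto

text \<open>Level 0 gets only about \<eta> n vertices and is shared by all copies, so levels 1 to N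
  have nearly n / N vertices each and nearly n / N copies fit. This is why the edge count is divided
  by N although the pattern has N + 1 vertices.\<close>

lemma lower_tail:
  assumes N: "1 \<le> N" and S: "\<And>t. S t \<subseteq> {..<t}" and h: "1 \<le> back_edges S {..N}" and \<epsilon>: "0 < \<epsilon>"
    and cl: "\<And>t s s'. s \<in> S t \<Longrightarrow> s' \<in> S t \<Longrightarrow> s < s' \<Longrightarrow> s \<in> S s'"
    and bal: "\<And>T. T \<subseteq> {..N} \<Longrightarrow> 1 \<le> back_edges S T \<Longrightarrow> 1 < real (card T) - \<alpha> * real (back_edges S T)"
  shows "(\<lambda>n. measure_pmf.prob (gnp n (p n)) {E. real (max_chordal_edges E)
      < (real (\<Sum>t\<le>N. card (S t)) / real N - \<epsilon>) * real n}) \<longlonglongrightarrow> 0"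
proof -
  define H where "H = (\<Sum>t\<le>N. card (S t))"
  have H: "1 \<le> H"
  proof -
    have "back_edges S {..N} \<le> H"
      unfolding back_edges_def H_def using finite_subset[OF S] by (intro sum_mono card_mono) auto
    then show ?thesis using h by linarith
  qed
  \<comment> \<open>Reserving level 0 and stopping at m free vertices costs at most 2 \<eta> n
    copies with H edges each, thus at most \<epsilon> n / 2 edges. The other \<epsilon> n / 2
    absorbs the rounding of \<open>L n\<close>.\<close>
  define \<eta> where "\<eta> = min (1/2) (\<epsilon> / (4 * real H))"
  have \<eta>: "0 < \<eta>" "\<eta> \<le> 1/2" "2 * \<eta> * real H \<le> \<epsilon> / 2"
  proof -
    show "0 < \<eta>" "\<eta> \<le> 1/2" unfolding \<eta>_def using \<epsilon> H by auto
    have "\<eta> \<le> \<epsilon> / (4 * real H)" unfolding \<eta>_def by simp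
    then show "2 * \<eta> * real H \<le> \<epsilon> / 2" using H by (simp add: field_simps)
  qed
  define m where "m n = nat \<lfloor>\<eta> * real n\<rfloor>" for n
  define L where "L n = (n - m n) div N" for n
  \<comment> \<open>Vertices left over by rounding get levels above N, out of reach of the pattern.
    The number \<open>m n\<close> is at once the size of level 0 and the number of free vertices
    that richness demands.\<close>
  define lev where "lev n x = (if x < m n then 0 else Suc ((x - m n) div L n))" for n x
  have mn: "m n \<le> n" "real (m n) \<le> \<eta> * real n" for n
  proof -
    show 1: "real (m n) \<le> \<eta> * real n" unfolding m_def using \<eta> by simp
    have "\<eta> * real n \<le> 1 * real n" using \<eta> by (intro mult_right_mono) auto
    then show "m n \<le> n" using 1 by linarith
  qed
  have LN: "L n * N + m n \<le> n" for n
    unfolding L_def using mn(1)[of n] div_times_less_eq_dividend[of "n - m n" N] by linarith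
  have Llow: "real n / real N - \<eta> * real n - 1 \<le> real (L n)" for n
  proof -
    have "n - m n < (L n + 1) * N"
      unfolding L_def using dividend_less_div_times[of N "n - m n"] N by (simp add: algebra_simps)
    then have "real n - real (m n) < real ((L n + 1) * N)" using mn(1)[of n] by linarith
    then have "real n - \<eta> * real n < (real (L n) + 1) * real N"
      using mn(2)[of n] by (simp add: algebra_simps)
    then have "(real n - \<eta> * real n) / real N < real (L n) + 1" using N by (simp add: pos_divide_less_eq)
    moreover have "\<eta> * real n / real N \<le> \<eta> * real n" 
      using N \<eta>(1) mult_left_mono[of 1 "real N" "\<eta> * real n"] by (simp add: pos_divide_le_eq)
    ultimately show ?thesis by (simp add: diff_divide_distrib)
  qed
  have levL: "card (level n (lev n) t) = L n" if t: "t \<in> {1..N}" and L0: "0 < L n" for n t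
  proof -
    have "level n (lev n) t = {m n + (t - 1) * L n ..< m n + t * L n}" (is "?l = ?r")
    proof (intro equalityI subsetI)
      fix x assume "x \<in> ?l"
      then have "\<not> x < m n" "(x - m n) div L n = t - 1" using t unfolding level_def lev_def by (auto split: if_splits)
      then have "(t - 1) * L n \<le> x - m n \<and> x - m n < (t - 1) * L n + L n" "m n \<le> x"
        using L0 div_mult_mod_eq[of "x - m n" "L n"] mod_less_divisor[OF L0, of "x - m n"] by auto
      moreover have "(t - 1) * L n + L n = t * L n" using t by (cases t) auto
      ultimately show "x \<in> ?r" by auto
    next
      fix x assume x: "x \<in> ?r"
      have tL: "(t - 1) * L n + L n = t * L n" using t by (cases t) auto
      have "t * L n \<le> L n * N" using t by (simp add: mult.commute)
      moreover have "x < m n + t * L n" using x by simp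
      ultimately have "x < n" using LN[of n] by linarith
      moreover have "(x - m n) div L n = t - 1"
        using x tL by (intro div_nat_eqI) (auto simp: algebra_simps)
      ultimately show "x \<in> ?l" using t x unfolding level_def lev_def by auto
    qed
    moreover have "(t - 1) * L n + L n = t * L n" using t by (cases t) auto
    ultimately show ?thesis by simp
  qed
  have lev0: "m n \<le> card (level n (lev n) 0)" for n
  proof -
    have "level n (lev n) 0 = {..<m n}" using mn(1)[of n] unfolding level_def lev_def by auto
    then show ?thesis by simp
  qed
  have "(\<lambda>n. measure_pmf.prob (gnp n (p n)) {E. \<not> partite_rich n N S (lev n) (m n) E}) \<longlonglongrightarrow> 0"
    unfolding m_def by (rule whp_partite_rich[OF S h \<eta>(1) bal])
  then show ?thesis
  proof (rule prob_tendsto_0_mono[OF p, rotated 1, of _ _ "\<lambda>_ _. False"])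
    show "eventually (\<lambda>n. \<forall>E\<subseteq>all_edges n. real (max_chordal_edges E)
        < (real (\<Sum>t\<le>N. card (S t)) / real N - \<epsilon>) * real n
        \<longrightarrow> \<not> partite_rich n N S (lev n) (m n) E \<or> False) sequentially"
      using eventually_ge_at_top[of "nat \<lceil>2 * real H / \<epsilon>\<rceil>"]
    proof eventually_elim
      case (elim n)
      show ?case
      proof (intro allI impI disjI1 notI)
        fix E assume E: "E \<subseteq> all_edges n" "real (max_chordal_edges E) < (real (\<Sum>t\<le>N. card (S t)) / real N - \<epsilon>) * real n"
          and rich: "partite_rich n N S (lev n) (m n) E"
        have "2 * real H / \<epsilon> \<le> real n" using elim by linarith
        then have n: "real H \<le> \<epsilon> / 2 * real n" using \<epsilon> by (simp add: field_simps)
        have "2 * \<eta> * real H * real n \<le> \<epsilon> / 2 * real n" using \<eta>(3) by (intro mult_right_mono) auto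
        then have low: "(real H / real N - \<epsilon>) * real n \<le> (real n / real N - 2 * (\<eta> * real n) - 1) * real H"
          using n by (simp add: algebra_simps)
        have Lm: "real n / real N - 2 * (\<eta> * real n) - 1 \<le> real (L n - m n)"
          using Llow[of n] mn(2)[of n] by linarith
        \<comment> \<open>The assumed strict upper bound on a nonnegative number is positive. This
          yields \<open>L n\<close> > 0, as \<open>levL\<close> requires.\<close>
        have "0 \<le> real (max_chordal_edges E)" by simp
        then have "0 < (real H / real N - \<epsilon>) * real n" using E(2) unfolding H_def by linarith
        then have "0 < (real n / real N - 2 * (\<eta> * real n) - 1) * real H" using low by linarith
        then have "0 < real n / real N - 2 * (\<eta> * real n) - 1" using H by (simp add: zero_less_mult_iff)
        then have "0 < L n" using Lm by linarith
        have "\<exists>F\<subseteq>E. chordal F \<and> card F = (L n - m n) * (\<Sum>t\<le>N. card (S t))"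
        proof (rule chordal_packing[OF rich N _ lev0 S])
          show "card (level n (lev n) t) = L n" if "t \<in> {1..N}" for t
            by (rule levL[OF that \<open>0 < L n\<close>])
          show "s \<in> S s'" if "s \<in> S t" "s' \<in> S t" "s < s'" for t s s'
            by (rule cl[OF that])
        qed
        then obtain F where F: "F \<subseteq> E" "chordal F" "card F = (L n - m n) * H" unfolding H_def by auto
        have "(real H / real N - \<epsilon>) * real n \<le> real (L n - m n) * real H"
          using low mult_right_mono[OF Lm, of "real H"] by linarith
        also have "\<dots> = real (card F)" unfolding F(3) by simp
        also have "\<dots> \<le> real (max_chordal_edges E)"
          using max_chordal_edges_ge[OF finite_subset[OF E(1) finite_all_edges] F(1,2)] by simp
        finally show False using E(2) unfolding H_def by linarith
      qed
    qed
  qed simp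
qed

lemma conv_prob_chordalI:
  assumes up: "\<And>\<epsilon>. 0 < \<epsilon> \<Longrightarrow> (\<lambda>n. measure_pmf.prob (gnp n (p n)) {E. (c + \<epsilon>) * real n \<le> real (max_chordal_edges E)}) \<longlonglongrightarrow> 0"
    and low: "\<And>\<epsilon>. 0 < \<epsilon> \<Longrightarrow> (\<lambda>n. measure_pmf.prob (gnp n (p n)) {E. real (max_chordal_edges E) < (c - \<epsilon>) * real n}) \<longlonglongrightarrow> 0"
  shows "conv_prob_chordal p c"
  unfolding conv_prob_chordal_def
proof (intro allI impI)
  fix \<epsilon> :: real assume \<epsilon>: "0 < \<epsilon>"
  show "(\<lambda>n. measure_pmf.prob (gnp n (p n)) {E. \<epsilon> < \<bar>real (max_chordal_edges E) / real n - c\<bar>}) \<longlonglongrightarrow> 0"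
  proof (rule prob_tendsto_0_mono[OF p _ up[OF \<epsilon>] low[OF \<epsilon>]])
    show "eventually (\<lambda>n. \<forall>E\<subseteq>all_edges n. \<epsilon> < \<bar>real (max_chordal_edges E) / real n - c\<bar> \<longrightarrow>
        (c + \<epsilon>) * real n \<le> real (max_chordal_edges E) \<or> real (max_chordal_edges E) < (c - \<epsilon>) * real n) sequentially"
      using eventually_gt_at_top[of 0]
    proof eventually_elim
      case (elim n)
      show ?case
      proof (intro allI impI)
        fix E assume "\<epsilon> < \<bar>real (max_chordal_edges E) / real n - c\<bar>"
        then have "c + \<epsilon> \<le> real (max_chordal_edges E) / real n \<or> real (max_chordal_edges E) / real n < c - \<epsilon>"
          by linarith
        then show "(c + \<epsilon>) * real n \<le> real (max_chordal_edges E) \<or> real (max_chordal_edges E) < (c - \<epsilon>) * real n"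
          using elim by (simp add: pos_le_divide_eq pos_divide_less_eq)
      qed
    qed
  qed
qed

text \<open>Since T spans at most \<beta> (j - 1) - K edges for j = |T|, the balance condition
  depends only on j.\<close>

lemma lower_tail_window:
  assumes N: "1 \<le> N" and \<beta>: "2 \<le> \<beta>" and K: "\<And>t::nat. K + frac (\<beta> * real t) \<le> \<beta> - 1" and \<epsilon>: "0 < \<epsilon>"
    and bal: "\<And>j. 2 \<le> j \<Longrightarrow> j \<le> N + 1 \<Longrightarrow> \<alpha> * (\<beta> * (real j - 1) - K) < real j - 1"
  shows "(\<lambda>n. measure_pmf.prob (gnp n (p n)) {E. real (max_chordal_edges E)
      < (real (\<Sum>t\<le>N. card (window \<beta> t)) / real N - \<epsilon>) * real n}) \<longlonglongrightarrow> 0"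
proof (rule lower_tail[OF N window_subset _ \<epsilon>])
  have \<beta>0: "0 \<le> \<beta>" using \<beta> by simp
  have "1 \<le> card (window \<beta> 1)" unfolding card_window using width_bounds(2)[OF \<beta>0, of 1] \<beta> by linarith
  then show "1 \<le> back_edges (window \<beta>) {..N}"
    unfolding back_edges_window_atMost using member_le_sum[of 1 "{..N}" "\<lambda>t. card (window \<beta> t)"] N by simp
  show "s \<in> window \<beta> s'" if "s \<in> window \<beta> t" "s' \<in> window \<beta> t" "s < s'" for s s' t
    using window_clique[OF \<beta>0 that] .
  fix T assume T: "T \<subseteq> {..N}" "1 \<le> back_edges (window \<beta>) T"
  have fin: "finite T" using T(1) finite_subset by blast
  note e = window_back_edges_le[OF \<beta> K fin T(2)]
  have "card T \<le> N + 1" using card_mono[OF _ T(1)] by simp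
  then have "\<alpha> * (\<beta> * (real (card T) - 1) - K) < real (card T) - 1" using bal e(1) by blast
  moreover have "\<alpha> * real (back_edges (window \<beta>) T) \<le> \<alpha> * (\<beta> * (real (card T) - 1) - K)"
    using e(2) \<alpha> by (intro mult_left_mono) auto
  ultimately show "1 < real (card T) - \<alpha> * real (back_edges (window \<beta>) T)" by linarith
qed

lemma conv_prob_sparse:
  assumes k: "\<alpha> < (1 + real k) / (1 + 2 * real k)" "(2 + real k) / (3 + 2 * real k) < \<alpha>"
  shows "conv_prob_chordal p ((1 + 2 * real k) / (1 + real k))"
proof (rule conv_prob_chordalI)
  have c: "(1 + 2 * real k) / (1 + real k) = 2 - 1 / (real k + 1)" by (simp add: field_simps)
  fix \<epsilon> :: real assume \<epsilon>: "0 < \<epsilon>"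
  obtain R :: nat where R: "1 + 2 / \<alpha> < real R" using reals_Archimedean2 by blast
  have "0 < 2 / \<alpha>" using \<alpha> by simp
  then have R0: "0 < R" using R by linarith
  show "(\<lambda>n. measure_pmf.prob (gnp n (p n)) {E. ((1 + 2 * real k) / (1 + real k) + \<epsilon>) * real n \<le> real (max_chordal_edges E)}) \<longlonglongrightarrow> 0"
    unfolding c
  proof (rule upper_tail[OF R])
    have "2 + real k < \<alpha> * (3 + 2 * real k)" using k(2) by (simp add: pos_divide_less_eq)
    then show "1 < \<alpha> * (2 - 1 / (real k + 2))" by (simp add: field_simps)
    show "0 < \<epsilon> / real R" using \<epsilon> R0 by simp
    show "dense_attachment n R (2 - 1 / (real k + 2)) (\<epsilon> / real R * real n) F"
      if "F \<subseteq> all_edges n" "chordal F" "\<not> has_clique n R F" "(2 - 1 / (real k + 1) + \<epsilon>) * real n \<le> real (card F)" for n F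
      using chordal_dense_attachment_sparse[OF that(1-3) R0 that(4)] .
  qed
  \<comment> \<open>The pattern is the square of a path on k + 2 vertices. K = 1 because j of its
    vertices span at most 2 j - 3 edges.\<close>
  have "(\<lambda>n. measure_pmf.prob (gnp n (p n)) {E. real (max_chordal_edges E)
      < (real (\<Sum>t\<le>k+1. card (window 2 t)) / real (k + 1) - \<epsilon>) * real n}) \<longlonglongrightarrow> 0"
  proof (rule lower_tail_window[where K = 1, OF _ _ _ \<epsilon>])
    fix j :: nat assume j: "2 \<le> j" "j \<le> k + 1 + 1"
    \<comment> \<open>As \<alpha> > 1/2, the condition is strongest for the largest j, the whole
      pattern with j = k + 2, where it reads \<alpha> (1 + 2 k) < 1 + k.\<close>
    have "(3 + 2 * real k) * 1 < (2 + real k) * 2" by simp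
    then have "1 / 2 < (2 + real k) / (3 + 2 * real k)" by (simp add: field_simps)
    then have \<alpha>2: "1 < 2 * \<alpha>" using k(2) by linarith
    have "\<alpha> * (1 + 2 * real k) < 1 + real k" using k(1) by (simp add: pos_less_divide_eq)
    moreover have "(real j - 2) * (2 * \<alpha> - 1) \<le> real k * (2 * \<alpha> - 1)"
      using j \<alpha>2 by (intro mult_right_mono) auto
    ultimately show "\<alpha> * (2 * (real j - 1) - 1) < real j - 1" by (simp add: algebra_simps)
  qed simp_all
  then show "(\<lambda>n. measure_pmf.prob (gnp n (p n)) {E. real (max_chordal_edges E)
      < ((1 + 2 * real k) / (1 + real k) - \<epsilon>) * real n}) \<longlonglongrightarrow> 0"
    unfolding sum_card_window_2 by simp
qed

lemma conv_prob_dense: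
  assumes \<alpha>2: "\<alpha> \<le> 1 / 2"
  shows "conv_prob_chordal p (1 / \<alpha>)"
proof (rule conv_prob_chordalI)
  fix \<epsilon> :: real assume \<epsilon>: "0 < \<epsilon>"
  obtain R :: nat where R: "1 + 2 / \<alpha> < real R" using reals_Archimedean2 by blast
  have "0 < 2 / \<alpha>" using \<alpha> by simp
  then have R0: "0 < R" using R by linarith
  have pos: "0 < 1 / \<alpha> + \<epsilon>" using \<alpha> \<epsilon> by (simp add: add_pos_pos)
  show "(\<lambda>n. measure_pmf.prob (gnp n (p n)) {E. (1 / \<alpha> + \<epsilon>) * real n \<le> real (max_chordal_edges E)}) \<longlonglongrightarrow> 0"
  proof (rule upper_tail[OF R])
    show "1 < \<alpha> * (1 / \<alpha> + \<epsilon>)" using \<alpha> \<epsilon> by (simp add: distrib_left)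
    show "0 < (1 / \<alpha> + \<epsilon>) / real R" using pos R0 by simp
    show "dense_attachment n R (1 / \<alpha> + \<epsilon>) ((1 / \<alpha> + \<epsilon>) / real R * real n) F"
      if "F \<subseteq> all_edges n" "chordal F" "\<not> has_clique n R F" "(1 / \<alpha> + \<epsilon>) * real n \<le> real (card F)" for n F
      using chordal_dense_attachment[OF that less_imp_le[OF pos] R0] .
  qed
  \<comment> \<open>The windows need \<beta> \<ge> 2. For \<alpha> < 1/2 this leaves room for
    \<beta> slightly below 1 / \<alpha>, with K = 0. For \<alpha> = 1/2 it forces \<beta> = 1 /
    \<alpha>, and K = 1 supplies the strictness of the balance condition.\<close>
  obtain \<beta> K where \<beta>: "2 \<le> \<beta>" "1 / \<alpha> - \<epsilon> / 2 \<le> \<beta>" "\<And>t::nat. K + frac (\<beta> * real t) \<le> \<beta> - 1"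
    "\<And>j::nat. 2 \<le> j \<Longrightarrow> \<alpha> * (\<beta> * (real j - 1) - K) < real j - 1"
  proof (cases "\<alpha> = 1 / 2")
    case True
    show ?thesis
    proof (rule that[of 2 1])
      show "1 / \<alpha> - \<epsilon> / 2 \<le> 2" unfolding True using \<epsilon> by simp
      show "\<alpha> * (2 * (real j - 1) - 1) < real j - 1" for j :: nat unfolding True by simp
    qed simp_all
  next
    case False
    define \<beta> where "\<beta> = max 2 (1 / \<alpha> - \<epsilon> / 2)"
    have "2 < 1 / \<alpha>" using False \<alpha>2 \<alpha> by (simp add: field_simps)
    then have "\<beta> < 1 / \<alpha>" unfolding \<beta>_def using \<epsilon> by simp
    then have \<alpha>\<beta>: "\<alpha> * \<beta> < 1" using \<alpha> by (simp add: field_simps)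
    show ?thesis
    proof (rule that[of \<beta> 0])
      show "0 + frac (\<beta> * real t) \<le> \<beta> - 1" for t :: nat
        using frac_lt_1[of "\<beta> * real t"] unfolding \<beta>_def by linarith
      show "\<alpha> * (\<beta> * (real j - 1) - 0) < real j - 1" if "2 \<le> j" for j :: nat
        using mult_strict_right_mono[OF \<alpha>\<beta>, of "real j - 1"] that by (simp add: mult.assoc)
    qed (simp_all add: \<beta>_def)
  qed
  \<comment> \<open>C is the loss in \<open>sum_card_window_ge\<close>. Of \<epsilon>, one half is
    spent on \<beta>, a quarter on C / N and a quarter in the lower tail.\<close>
  define C where "C = 1 + (\<beta> + 1)\<^sup>2"
  obtain N :: nat where N: "4 * C / \<epsilon> + 1 < real N" using reals_Archimedean2 by blast
  have C0: "0 < C" unfolding C_def by (simp add: add_pos_nonneg)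
  have "0 < 4 * C / \<epsilon>" using C0 \<epsilon> by simp
  then have N1: "1 \<le> N" using N by linarith
  have "4 * C / \<epsilon> < real N" using N by linarith
  then have CN: "C / real N \<le> \<epsilon> / 4" using N1 \<epsilon> by (simp add: field_simps)
  have "(\<beta> * real N - C) / real N \<le> real (\<Sum>t\<le>N. card (window \<beta> t)) / real N"
    using sum_card_window_ge[of \<beta> N] \<beta>(1) unfolding C_def by (intro divide_right_mono) auto
  then have "\<beta> - C / real N \<le> real (\<Sum>t\<le>N. card (window \<beta> t)) / real N"
    using N1 by (simp add: diff_divide_distrib)
  then have dens: "1 / \<alpha> - \<epsilon> \<le> real (\<Sum>t\<le>N. card (window \<beta> t)) / real N - \<epsilon> / 4"
    using CN \<beta>(2) by linarith
  have \<epsilon>4: "0 < \<epsilon> / 4" using \<epsilon> by simp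
  have low: "(\<lambda>n. measure_pmf.prob (gnp n (p n)) {E. real (max_chordal_edges E)
      < (real (\<Sum>t\<le>N. card (window \<beta> t)) / real N - \<epsilon> / 4) * real n}) \<longlonglongrightarrow> 0"
    by (rule lower_tail_window[OF N1 \<beta>(1,3) \<epsilon>4 \<beta>(4)])
  show "(\<lambda>n. measure_pmf.prob (gnp n (p n)) {E. real (max_chordal_edges E) < (1 / \<alpha> - \<epsilon>) * real n}) \<longlonglongrightarrow> 0"
  proof (rule prob_tendsto_0_mono[OF p _ low low])
    show "eventually (\<lambda>n. \<forall>E\<subseteq>all_edges n. real (max_chordal_edges E) < (1 / \<alpha> - \<epsilon>) * real n \<longrightarrow>
        real (max_chordal_edges E) < (real (\<Sum>t\<le>N. card (window \<beta> t)) / real N - \<epsilon> / 4) * real n \<or>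
        real (max_chordal_edges E) < (real (\<Sum>t\<le>N. card (window \<beta> t)) / real N - \<epsilon> / 4) * real n) sequentially"
      using mult_right_mono[OF dens] by (intro always_eventually allI impI disjI1) (meson less_le_trans of_nat_0_le_iff)
  qed
qed

end

section \<open>The threshold index and the conclusion\<close>

text \<open>The thresholds decrease to 1/2, so \<alpha> > 1/2 lies below only finitely many of them:
  k < 1 / (2 \<alpha> - 1). At the largest such k the inequality for k + 1 fails, and it fails
  strictly because \<alpha> is not itself a threshold.\<close>

lemma greatest_threshold:
  fixes \<alpha> :: real
  assumes \<alpha>: "1/2 < \<alpha>" "\<alpha> \<le> 1" and ne: "\<forall>k::nat. \<alpha> \<noteq> (1 + real k) / (1 + 2 * real k)"
  defines "k \<equiv> (GREATEST k::nat. \<alpha> < (1 + real k) / (1 + 2 * real k))"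
  shows "\<alpha> < (1 + real k) / (1 + 2 * real k)" "(2 + real k) / (3 + 2 * real k) < \<alpha>"
proof -
  let ?P = "\<lambda>k::nat. \<alpha> < (1 + real k) / (1 + 2 * real k)"
  have P0: "?P 0" using \<alpha>(2) ne[rule_format, of 0] by simp
  have bd: "j \<le> nat \<lceil>1 / (2 * \<alpha> - 1)\<rceil>" if "?P j" for j
  proof -
    have "\<alpha> * (1 + 2 * real j) < 1 + real j" using that by (simp add: pos_less_divide_eq)
    then have "real j * (2 * \<alpha> - 1) < 1" using \<alpha> by (simp add: algebra_simps)
    then have "real j < 1 / (2 * \<alpha> - 1)" using \<alpha> by (simp add: pos_less_divide_eq)
    then show ?thesis by linarith
  qed
  show "?P k" unfolding k_def using GreatestI_nat[of ?P 0] P0 bd by blast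
  have "\<not> ?P (Suc k)"
  proof
    assume "?P (Suc k)"
    then have "Suc k \<le> k" unfolding k_def using Greatest_le_nat[of ?P "Suc k"] bd unfolding k_def by blast
    then show False by simp
  qed
  moreover have "(1 + real (Suc k)) / (1 + 2 * real (Suc k)) = (2 + real k) / (3 + 2 * real k)" by simp
  ultimately show "(2 + real k) / (3 + 2 * real k) < \<alpha>" using ne[rule_format, of "Suc k"] by simp
qed

theorem theorem2:
  fixes p :: "nat \<Rightarrow> real" and \<alpha> :: real and \<delta> :: "nat \<Rightarrow> real"
  assumes "\<alpha> > 0"
    and "\<And>n. 0 \<le> p n \<and> p n \<le> 1"
    and "\<delta> \<longlonglongrightarrow> 0"
    and "eventually (\<lambda>n. p n = real n powr (- \<alpha> + \<delta> n)) sequentially"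
  shows "(1/2 < \<alpha> \<and> \<alpha> \<le> 1 \<and> (\<forall>k::nat. \<alpha> \<noteq> (1 + real k) / (1 + 2 * real k)) \<longrightarrow>
           (let k\<^sub>\<alpha> = (GREATEST k::nat. \<alpha> < (1 + real k) / (1 + 2 * real k))
            in conv_prob_chordal p ((1 + 2 * real k\<^sub>\<alpha>) / (1 + real k\<^sub>\<alpha>))))
       \<and> (\<alpha> \<le> 1/2 \<longrightarrow> conv_prob_chordal p (1 / \<alpha>))"
proof -
  interpret gnp_power p \<alpha> \<delta> using assms by unfold_locales
  show ?thesis
    unfolding Let_def using conv_prob_sparse[OF greatest_threshold] conv_prob_dense by simp
qed

end
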